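(* Suppose that the system $dx_t=P(x_t)\,dt+\sigma\,dB_t$, $x_0=0$, is noise propagating. For $\epsilon>0$ let $y_{\epsilon,t}=\big(x^1_{\epsilon t}/\epsilon^{\mathfrak b_1},\dots,x^n_{\epsilon t}/\epsilon^{\mathfrak b_n}\big)$, $t\in[0,1]$ (with $y_{\epsilon,t}=\Delta$ if $x_{\epsilon t}=\Delta$). Then, as $\epsilon\to0^+$, the process $t\mapsto y_{\epsilon,t}\in\mathcal E$, $t\in[0,1]$, converges in law to the solution of the SDE $$dy_t=P_{\mathrm D}(y_t)\,dt+\sigma\,dB_t,\qquad y_0=0.$$ Furthermore, the solution of this SDE is nonexplosive.
   Context: Setting. $n\ge1$, $I=\{1,\dots,n\}$, $P=(P^1,\dots,P^n):\mathbf R^n\to\mathbf R^n$ is a polynomial vector field, $\sigma=\mathrm{diag}(\sigma^1,\dots,\sigma^n)$ with constants $\sigma^i\ge0$ (some may vanish), $B_t$ is a standard $n$-dimensional Brownian motion on a filtered probability space, and $x_t$ is the unique pathwise solution of $dx_t=P(x_t)dt+\sigma dB_t$, $x_0=0$, up to its explosion time $\tau_\infty$. Fix a death state $\Delta\notin\mathbf R^n$, give $\mathbf R^n\cup\{\Delta\}$ the topology of the one-point compactification, and set $x_t=\Delta$ for $t\ge\tau_\infty$. Nonexplosive means that the explosion time is a.s. infinite. $\mathcal E$ is the set of continuous $f:[0,1]\to\mathbf R^n\cup\{\Delta\}$ such that $f_{t_0}=\Delta$ implies $f_t=\Delta$ for all $t\ge t_0$, with the topology of uniform convergence (for a metric compatible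 with the compact space $\mathbf R^n\cup\{\Delta\}$). Power scalings (the second coordinates of the paper's pair scalings are all zero here and are omitted). Work in $\tfrac12\mathbf Z_{\ge0}\cup\{\infty\}$ with the usual order, $c+\infty=\infty$, $\ell\cdot\infty=\infty$ for $\ell\ge1$, $0\cdot\infty=0$. For a monomial $m(x)=\alpha(x^1)^{n_1}\cdots(x^n)^{n_n}$, $\alpha\ne0$, put $m(c_1,\dots,c_n)=n_1c_1+\cdots+n_nc_n$; the zero polynomial has value $\infty$; a nonzero polynomial, written as a sum of a minimal number of monomials (standard form), has value the minimum of the values of its monomials. Inductive procedure. $I_0=\{j\in I:\sigma^j>0\}$; $b_{0,j}=1/2$ and $P^j_{\mathrm D}\equiv0$ for $j\in I_0$; $b_{0,j}=\infty$ for $j\notin I_0$. For $\ell\ge0$: if $I\setminus\bigcup_{k=0}^\ell I_k=\emptyset$ or $P^j(b_{\ell,1},\dots,b_{\ell,n})=\infty$ for all $j\in I\setminus\bigcup_{k=0}^\ell I_k$, stop and set $I_i=\emptyset$ for $i\ge\ell+1$. Otherwise let $m_{\ell+1}=\min\{P^j(b_{\ell,1},\dots,b_{\ell,n}):j\in I\setminus\bigcup_{k=0}^\ell I_k\}$, $I_{\ell+1}=\{j\in I\setminus\bigcup_{k=0}^\ell I_k:P^j(b_{\ell,1},\dots,b_{\ell,n})=m_{\ell+1}\}$; $b_{\ell+1,j}=m_{\ell+1}+1$ for $j\in I_{\ell+1}$ and $b_{\ell+1,j}=b_{\ell,j}$ otherwise; for $j\in I_{\ell+1}$ let $P^j_{\mathrm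 D}$ be the sum of those monomials in the standard form of $P^j$ whose value at $(b_{\ell,1},\dots,b_{\ell,n})$ equals $m_{\ell+1}$. The system is noise propagating if $\bigcup_{k=0}^\ell I_k=I$ for some $\ell\ge0$; with $\dim$ the smallest such $\ell$, $\mathfrak b_j:=b_{\dim,j}$. $P_{\mathrm D}=(P^1_{\mathrm D},\dots,P^n_{\mathrm D})$. *)

theory Defs
  imports "HOL-Probability.Probability" "HOL-Library.Poly_Mapping"
begin

section \<open>Polynomials in the variables indexed by a finite type\<close>

text \<open>
  The keys of a polynomial are the exponent vectors of the monomials that occur in its standard
  form, \<^const>\<open>Poly_Mapping.lookup\<close> gives their nonzero coefficients.
\<close>

type_synonym 'n rpoly = "('n \<Rightarrow>\<^sub>0 nat) \<Rightarrow>\<^sub>0 real"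

definition poly_eval :: "'n::finite rpoly \<Rightarrow> real ^ 'n \<Rightarrow> real" where
  "poly_eval p x = (\<Sum>m\<in>Poly_Mapping.keys p.
     Poly_Mapping.lookup p m * (\<Prod>i\<in>UNIV. (x $ i) ^ Poly_Mapping.lookup m i))"

definition poly_field :: "('n::finite \<Rightarrow> 'n rpoly) \<Rightarrow> real ^ 'n \<Rightarrow> real ^ 'n" where
  "poly_field P x = (\<chi> j. poly_eval (P j) x)"


section \<open>Power scalings and the inductive procedure\<close>

text \<open>
  Scalings live in \<^typ>\<open>ennreal\<close>, where $0 \cdot \infty = 0$; only values in
  $\frac12\mathbf Z_{\ge0}\cup\{\infty\}$ arise.
\<close>

definition monom_value :: "('n::finite \<Rightarrow> ennreal) \<Rightarrow> ('n \<Rightarrow>\<^sub>0 nat) \<Rightarrow> ennreal" where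
  "monom_value c m = (\<Sum>i\<in>UNIV. of_nat (Poly_Mapping.lookup m i) * c i)"

definition poly_value :: "('n::finite \<Rightarrow> ennreal) \<Rightarrow> 'n rpoly \<Rightarrow> ennreal" where
  "poly_value c p = (if p = 0 then \<infinity> else Min (monom_value c ` Poly_Mapping.keys p))"

text \<open>
  One step of the procedure, from the set \<open>A\<close> of indices treated so far and the current scaling
  \<open>b\<close>: the minimal value, the new indices (none if the procedure stops) and the new scaling.
\<close>

definition min_value ::
  "('n::finite \<Rightarrow> 'n rpoly) \<Rightarrow> 'n set \<Rightarrow> ('n \<Rightarrow> ennreal) \<Rightarrow> ennreal" where
  "min_value P A b = Min ((\<lambda>j. poly_value b (P j)) ` (UNIV - A))"

definition new_indices ::
  "('n::finite \<Rightarrow> 'n rpoly) \<Rightarrow> 'n set \<Rightarrow> ('n \<Rightarrow> ennreal) \<Rightarrow> 'n set" where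
  "new_indices P A b =
     (if UNIV - A = {} \<or> (\<forall>j\<in>UNIV - A. poly_value b (P j) = \<infinity>) then {}
      else {j \<in> UNIV - A. poly_value b (P j) = min_value P A b})"

definition new_scaling ::
  "('n::finite \<Rightarrow> 'n rpoly) \<Rightarrow> 'n set \<Rightarrow> ('n \<Rightarrow> ennreal) \<Rightarrow> 'n \<Rightarrow> ennreal" where
  "new_scaling P A b j = (if j \<in> new_indices P A b then min_value P A b + 1 else b j)"

primrec stage ::
  "real ^ 'n \<Rightarrow> ('n::finite \<Rightarrow> 'n rpoly) \<Rightarrow> nat \<Rightarrow> 'n set \<times> ('n \<Rightarrow> ennreal)" where
  "stage \<sigma> P 0 = ({j. \<sigma> $ j > 0}, \<lambda>j. if \<sigma> $ j > 0 then 1 / 2 else \<infinity>)"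
| "stage \<sigma> P (Suc l) =
     (case stage \<sigma> P l of (A, b) \<Rightarrow> (A \<union> new_indices P A b, new_scaling P A b))"

text \<open>\<open>treated \<sigma> P l\<close> is $\bigcup_{k\le l} I_k$ (see \<open>treated_eq\<close> below), \<open>scaling \<sigma> P l\<close> is
  $b_l$, \<open>level \<sigma> P l\<close> is $I_l$.\<close>

definition treated :: "real ^ 'n \<Rightarrow> ('n::finite \<Rightarrow> 'n rpoly) \<Rightarrow> nat \<Rightarrow> 'n set" where
  "treated \<sigma> P l = fst (stage \<sigma> P l)"

definition scaling :: "real ^ 'n \<Rightarrow> ('n::finite \<Rightarrow> 'n rpoly) \<Rightarrow> nat \<Rightarrow> 'n \<Rightarrow> ennreal" where
  "scaling \<sigma> P l = snd (stage \<sigma> P l)"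

primrec level :: "real ^ 'n \<Rightarrow> ('n::finite \<Rightarrow> 'n rpoly) \<Rightarrow> nat \<Rightarrow> 'n set" where
  "level \<sigma> P 0 = {j. \<sigma> $ j > 0}"
| "level \<sigma> P (Suc l) = new_indices P (treated \<sigma> P l) (scaling \<sigma> P l)"

lemma treated_eq: "treated \<sigma> P l = (\<Union>k\<le>l. level \<sigma> P k)"
proof (induction l)
  case (Suc l)
  have "treated \<sigma> P (Suc l) = treated \<sigma> P l \<union> level \<sigma> P (Suc l)"
    by (simp add: treated_def scaling_def case_prod_unfold)
  then show ?case using Suc by (auto simp: atMost_Suc)
qed (simp add: treated_def)

definition noise_propagating :: "real ^ 'n \<Rightarrow> ('n::finite \<Rightarrow> 'n rpoly) \<Rightarrow> bool" where
  "noise_propagating \<sigma> P \<longleftrightarrow> (\<exists>l. (\<Union>k\<le>l. level \<sigma> P k) = UNIV)"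

definition prop_dim :: "real ^ 'n \<Rightarrow> ('n::finite \<Rightarrow> 'n rpoly) \<Rightarrow> nat" where
  "prop_dim \<sigma> P = (LEAST l. (\<Union>k\<le>l. level \<sigma> P k) = UNIV)"

definition final_scaling :: "real ^ 'n \<Rightarrow> ('n::finite \<Rightarrow> 'n rpoly) \<Rightarrow> 'n \<Rightarrow> ennreal" where
  "final_scaling \<sigma> P = scaling \<sigma> P (prop_dim \<sigma> P)"

text \<open>The levels are disjoint, so the index \<open>l\<close> below is unique. The value for indices in no
  level is irrelevant: there are none if the system is noise propagating.\<close>

definition dominant :: "real ^ 'n \<Rightarrow> ('n::finite \<Rightarrow> 'n rpoly) \<Rightarrow> 'n \<Rightarrow> 'n rpoly" where
  "dominant \<sigma> P j =
     (if j \<in> level \<sigma> P 0 then 0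
      else let l = (THE l. j \<in> level \<sigma> P (Suc l)) in
        \<Sum>m | m \<in> Poly_Mapping.keys (P j) \<and>
              monom_value (scaling \<sigma> P l) m = min_value P (treated \<sigma> P l) (scaling \<sigma> P l).
          Poly_Mapping.single m (Poly_Mapping.lookup (P j) m))"


section \<open>Stochastic differential equations with additive noise\<close>

locale brownian_motion = prob_space M + filtration "space M" F
  for M :: "'a measure" and F :: "real \<Rightarrow> 'a measure" +
  fixes B :: "real \<Rightarrow> 'a \<Rightarrow> real ^ 'n::finite"
  assumes subalgebra: "\<And>t. 0 \<le> t \<Longrightarrow> subalgebra M (F t)"
    and adapted: "\<And>t. 0 \<le> t \<Longrightarrow> B t \<in> borel_measurable (F t)"
    and continuous: "\<And>\<omega>. \<omega> \<in> space M \<Longrightarrow> continuous_on {0..} (\<lambda>t. B t \<omega>)"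
    and start: "AE \<omega> in M. B 0 \<omega> = 0"
    and increment_indep_past: "\<And>s t. 0 \<le> s \<Longrightarrow> s < t \<Longrightarrow>
      indep_set (sets (F s)) {(\<lambda>\<omega>. B t \<omega> - B s \<omega>) -` S \<inter> space M | S. S \<in> sets borel}"
    and increment_indep_coords: "\<And>s t. 0 \<le> s \<Longrightarrow> s < t \<Longrightarrow>
      indep_vars (\<lambda>_. borel) (\<lambda>i \<omega>. (B t \<omega> - B s \<omega>) $ i) UNIV"
    and increment_normal: "\<And>s t i. 0 \<le> s \<Longrightarrow> s < t \<Longrightarrow>
      distributed M lborel (\<lambda>\<omega>. (B t \<omega> - B s \<omega>) $ i) (normal_density 0 (sqrt (t - s)))"

text \<open>The state space is $\mathbf R^n \cup \{\Delta\}$, with \<^const>\<open>None\<close> as the death state.\<close>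

abbreviation state_topology :: "(real ^ 'n) option topology" where
  "state_topology \<equiv> Alexandroff_compactification euclidean"

definition borel_of :: "'e topology \<Rightarrow> 'e measure" where
  "borel_of T = sigma (topspace T) {U. openin T U}"

text \<open>
  The solution of $dx_t = V(x_t)\,dt + \sigma\,dB_t$, $x_0 = 0$, up to explosion, with
  $\sigma$ the constant matrix with diagonal \<open>\<sigma>\<close>; the stochastic integral is therefore
  $\sigma B_t$. As the paths are continuous in the one-point compactification, a path that reaches
  the death state at a finite time $\tau$ leaves every compact subset of $\mathbf R^n$ as
  $t \uparrow \tau$; so the solution is maximal.
\<close>

definition sde_solution ::
  "'a measure \<Rightarrow> (real \<Rightarrow> 'a measure) \<Rightarrow> (real \<Rightarrow> 'a \<Rightarrow> real ^ 'n) \<Rightarrow>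
   (real ^ 'n \<Rightarrow> real ^ 'n) \<Rightarrow> real ^ 'n \<Rightarrow> (real \<Rightarrow> 'a \<Rightarrow> (real ^ 'n) option) \<Rightarrow> bool" where
  "sde_solution M F B V \<sigma> x \<longleftrightarrow>
     (\<forall>t\<ge>0. x t \<in> F t \<rightarrow>\<^sub>M borel_of state_topology) \<and>
     (\<forall>\<omega>\<in>space M.
        continuous_map (top_of_set {0..}) state_topology (\<lambda>t. x t \<omega>) \<and>
        (\<forall>s\<ge>0. \<forall>t\<ge>s. x s \<omega> = None \<longrightarrow> x t \<omega> = None)) \<and>
     (AE \<omega> in M. x 0 \<omega> = Some 0 \<and>
        (\<forall>t\<ge>0. x t \<omega> \<noteq> None \<longrightarrow>
           the (x t \<omega>) = integral {0..t} (\<lambda>s. V (the (x s \<omega>))) + (\<chi> i. \<sigma> $ i * B t \<omega> $ i)))"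

definition explosion_time :: "(real \<Rightarrow> 'a \<Rightarrow> 'e option) \<Rightarrow> 'a \<Rightarrow> ereal" where
  "explosion_time x \<omega> = Inf {ereal t | t. 0 \<le> t \<and> x t \<omega> = None}"

definition nonexplosive :: "'a measure \<Rightarrow> (real \<Rightarrow> 'a \<Rightarrow> 'e option) \<Rightarrow> bool" where
  "nonexplosive M x \<longleftrightarrow> (AE \<omega> in M. explosion_time x \<omega> = \<infinity>)"


section \<open>Path space and convergence in law\<close>

text \<open>
  The space of paths on $[0,1]$ with the uniform metric induced by a metric \<open>m\<close> on
  $\mathbf R^n \cup \{\Delta\}$. Paths are represented by functions that are \<^const>\<open>undefined\<close>
  outside $[0,1]$.
\<close>

definition path_space :: "'e option metric \<Rightarrow> (real \<Rightarrow> 'e option) metric" where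
  "path_space m = submetric (cfunspace (top_of_set {0..1}) m)
     {f. \<forall>s\<in>{0..1}. \<forall>t\<in>{s..1}. f s = None \<longrightarrow> f t = None}"

definition path01 :: "(real \<Rightarrow> 'a \<Rightarrow> 'e) \<Rightarrow> 'a \<Rightarrow> real \<Rightarrow> 'e" where
  "path01 x \<omega> = restrict (\<lambda>t. x t \<omega>) {0..1}"

definition converges_in_law ::
  "'a measure \<Rightarrow> 'e topology \<Rightarrow> ('i \<Rightarrow> 'a \<Rightarrow> 'e) \<Rightarrow> 'i filter \<Rightarrow> ('a \<Rightarrow> 'e) \<Rightarrow> bool" where
  "converges_in_law M T X G Y \<longleftrightarrow>
     (\<forall>\<^sub>F i in G. X i \<in> M \<rightarrow>\<^sub>M borel_of T) \<and> Y \<in> M \<rightarrow>\<^sub>M borel_of T \<and>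
     (\<forall>\<phi>. continuous_map T euclideanreal \<phi> \<and> bounded (\<phi> ` topspace T) \<longrightarrow>
        ((\<lambda>i. \<integral>\<omega>. \<phi> (X i \<omega>) \<partial>M) \<longlongrightarrow> (\<integral>\<omega>. \<phi> (Y \<omega>) \<partial>M)) G)"

definition rescale ::
  "('n \<Rightarrow> ennreal) \<Rightarrow> (real \<Rightarrow> 'a \<Rightarrow> (real ^ 'n) option) \<Rightarrow> real \<Rightarrow> real \<Rightarrow> 'a \<Rightarrow> (real ^ 'n) option"
  where
  "rescale c x \<epsilon> t \<omega> =
     map_option (\<lambda>v. \<chi> j. v $ j / \<epsilon> powr enn2real (c j)) (x (\<epsilon> * t) \<omega>)"

text \<open>Metrics compatible with the one-point compactification exist.\<close>

lemma compatible_metric_exists: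
  "\<exists>m. mtopology_of m = (state_topology :: (real ^ 'n::finite) option topology)"
proof -
  define \<phi> :: "(real ^ 'n) option \<Rightarrow> real \<times> (real ^ 'n)" where
    "\<phi> = (\<lambda>z. case z of None \<Rightarrow> 0 | Some u \<Rightarrow> (1 / (1 + u \<bullet> u)) *\<^sub>R (1, u))"
  have pos: "1 + u \<bullet> u > 0" for u :: "real ^ 'n"
    by (simp add: add_pos_nonneg)
  have \<phi>_None: "\<phi> None = 0" by (simp add: \<phi>_def)
  have norm_\<phi>: "norm (\<phi> (Some u)) ^ 2 = 1 / (1 + u \<bullet> u)" for u
  proof -
    define r where "r = 1 + u \<bullet> u"
    have r: "r > 0" using pos[of u] by (simp add: r_def)
    have "norm (\<phi> (Some u)) ^ 2 = (1 / r) * (1 / r) + (1 / r) * ((1 / r) * (r - 1))"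
      unfolding power2_norm_eq_inner \<phi>_def by (simp add: r_def)
    also have "\<dots> = 1 / r" using r by (simp add: field_simps)
    finally show ?thesis by (simp add: r_def)
  qed
  have cont_Some: "continuous_on UNIV (\<lambda>u. \<phi> (Some u))"
    unfolding \<phi>_def using pos
    by (auto intro!: continuous_intros simp: less_imp_neq[symmetric])
  have inj: "inj \<phi>"
  proof (rule injI)
    fix a b assume eq: "\<phi> a = \<phi> b"
    show "a = b"
    proof (cases a; cases b)
      fix u v assume ab: "a = Some u" "b = Some v"
      with eq have 1: "1 / (1 + u \<bullet> u) = 1 / (1 + v \<bullet> v)"
        and 2: "(1 / (1 + u \<bullet> u)) *\<^sub>R u = (1 / (1 + v \<bullet> v)) *\<^sub>R v"
        by (auto simp: \<phi>_def)
      from 2 have "(1 / (1 + u \<bullet> u)) *\<^sub>R u = (1 / (1 + u \<bullet> u)) *\<^sub>R v"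
        by (simp only: 1)
      then show ?thesis using pos[of u] ab by simp
    next
      fix u assume "a = None" "b = Some u"
      then show ?thesis using eq pos[of u] by (simp add: \<phi>_def zero_prod_def)
    next
      fix u assume "a = Some u" "b = None"
      then show ?thesis using eq pos[of u] by (simp add: \<phi>_def zero_prod_def)
    qed simp
  qed
  have cont: "continuous_map state_topology euclidean \<phi>"
    unfolding continuous_map_def
  proof (intro conjI allI impI)
    fix U :: "(real \<times> (real ^ 'n)) set" assume "openin euclidean U"
    then have U: "open U" by simp
    have vU: "open {u. \<phi> (Some u) \<in> U}"
      using continuous_on_open_vimage[of UNIV "\<lambda>u. \<phi> (Some u)"] cont_Some U
      by (auto simp: vimage_def)
    show "openin state_topology {z \<in> topspace state_topology. \<phi> z \<in> U}"
    proof (cases "0 \<in> U")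
      case False
      then have "{z \<in> topspace state_topology. \<phi> z \<in> U} = Some ` {u. \<phi> (Some u) \<in> U}"
        by (intro set_eqI, rename_tac z, case_tac z) (simp_all add: \<phi>_None image_iff)
      then show ?thesis using vU by (auto simp: openin_Alexandroff_compactification)
    next
      case True
      define C where "C = {u. \<phi> (Some u) \<notin> U}"
      obtain e where e: "e > 0" "ball 0 e \<subseteq> U" using U True openE by blast
      have "closed C" using vU unfolding C_def closed_def by (simp add: Compl_eq)
      moreover have "bounded C"
      proof (rule boundedI)
        fix u assume "u \<in> C"
        then have "\<phi> (Some u) \<notin> ball 0 e" using e unfolding C_def by auto
        then have "e ^ 2 \<le> norm (\<phi> (Some u)) ^ 2" using e by (intro power_mono) auto
        then have "(1 + u \<bullet> u) * e ^ 2 \<le> 1"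
          using pos[of u] by (simp add: norm_\<phi> field_simps)
        then have "1 + norm u ^ 2 \<le> 1 / e ^ 2"
          using e by (simp add: field_simps power2_norm_eq_inner)
        moreover have "norm u \<le> 1 + norm u ^ 2"
          using zero_le_power2[of "norm u - 1"] norm_ge_zero[of u]
          by (simp add: power2_diff del: norm_ge_zero zero_le_power2)
        ultimately show "norm u \<le> 1 / e ^ 2" by linarith
      qed
      ultimately have "compact C" by (simp add: compact_eq_bounded_closed)
      moreover have "{z \<in> topspace state_topology. \<phi> z \<in> U}
          = insert None (Some ` (topspace euclidean - C))"
      proof (rule set_eqI)
        fix z show "z \<in> {z \<in> topspace state_topology. \<phi> z \<in> U} \<longleftrightarrow>
            z \<in> insert None (Some ` (topspace euclidean - C))"
          using True \<phi>_None by (cases z) (simp_all add: C_def image_iff)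
      qed
      ultimately show ?thesis
        unfolding openin_Alexandroff_compactification
        by (intro disjI2 exI[of _ C]) (simp add: compact_imp_closed)
    qed
  qed auto
  have "homeomorphic_map state_topology (subtopology euclidean (range \<phi>)) \<phi>"
  proof (rule continuous_imp_homeomorphic_map)
    show "continuous_map state_topology (subtopology euclidean (range \<phi>)) \<phi>"
      using cont by (simp add: continuous_map_in_subtopology)
    show "Hausdorff_space (subtopology euclidean (range \<phi>))"
      by (simp add: Hausdorff_space_subtopology)
    show "\<phi> ` topspace state_topology = topspace (subtopology euclidean (range \<phi>))"
      by (simp add: UNIV_option_conv)
    show "inj_on \<phi> (topspace state_topology)"
      using inj by (rule inj_on_subset) simp
  qed simp
  then have "(state_topology :: (real ^ 'n) option topology) homeomorphic_space subtopology euclidean (range \<phi>)"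
    unfolding homeomorphic_space by blast
  moreover have "metrizable_space (subtopology euclidean (range \<phi>))"
    by (rule metrizable_space_subtopology[OF metrizable_space_euclidean])
  ultimately have "metrizable_space (state_topology :: (real ^ 'n) option topology)"
    using homeomorphic_metrizable_space by blast
  then obtain M d where d: "Metric_space M d"
    and eq: "(state_topology :: (real ^ 'n) option topology) = Metric_space.mtopology M d"
    unfolding metrizable_space_def by blast
  have "mtopology_of (metric (M, d)) = Metric_space.mtopology M d"
    by (simp add: mtopology_of_def Metric_space.mspace_metric[OF d] Metric_space.mdist_metric[OF d])
  then show ?thesis using eq by metis
qed

end

theory Submission
  imports Defs
begin

text \<open>
  Write \<open>b\<close> for the final scaling and \<open>y\<^sub>\<epsilon>\<close> for the rescaled process. The substitution
  \<open>s \<mapsto> \<epsilon> s\<close> in the integral equation of \<open>x\<close> shows that \<open>y\<^sub>\<epsilon>\<close> solves an equation with drift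
  \<open>V\<^sub>\<epsilon>\<^sup>j(v) = \<epsilon> powr (1 - b\<^sub>j) * P\<^sup>j(\<epsilon> powr b * v)\<close>, driven by
  \<open>W\<^sub>\<epsilon>(t) = B(\<epsilon> t) / sqrt \<epsilon>\<close>: a coordinate with noise has \<open>b\<^sub>j = 1/2\<close>. The proof compares
  \<open>y\<^sub>\<epsilon>\<close>, path by path, with the solution of the dominant equation driven by the same \<open>W\<^sub>\<epsilon>\<close>.
  
  \<^bold>\<open>The drift.\<close> In \<open>V\<^sub>\<epsilon>\<^sup>j\<close> a monomial of \<open>P\<^sup>j\<close> is multiplied by a power of \<open>\<epsilon>\<close> whose
  exponent is \<open>1 - b\<^sub>j\<close> plus the value of the monomial at \<open>b\<close>. The inductive procedure is made such
  that this exponent is zero for the monomials of the dominant part and positive for all others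
  (\<open>exponent_dominant\<close>). The point to check is that a monomial with an infinite value at the stage
  when \<open>j\<close> is treated does not become too small at later stages; the scalings assigned later are
  large enough for this (\<open>later_scaling_ge\<close>). Therefore \<open>V\<^sub>\<epsilon>\<close> tends to the dominant field
  uniformly on balls (\<open>scaled_field_tendsto_dominant\<close>).
  
  \<^bold>\<open>The dominant equation.\<close> The dominant field is triangular: the component \<open>j\<close> depends only on
  coordinates treated before \<open>j\<close> (\<open>dominant_triangular\<close>). Such an equation is solved by finitely
  many integrations, so the Picard iteration becomes stationary (\<open>picard_dominant_fixed_point\<close>). This
  gives a functional \<open>\<Phi>\<close> of the driving path (\<open>dominant_path\<close>) that is defined for all times,
  measurable and nonanticipating; hence a solution exists, and it does not explode.
  
  \<^bold>\<open>Stability.\<close> A Gronwall estimate, with a first-exit argument that excludes explosion, bounds the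
  distance of solutions of two integral equations with the same noise in terms of the distance of
  the drifts on a ball (\<open>integral_equation_stability\<close>). With equal drifts it yields uniqueness for
  the dominant equation. With the drifts \<open>V\<^sub>\<epsilon>\<close> and the dominant field it yields that
  \<open>y\<^sub>\<epsilon>\<close> is close to \<open>\<Phi>(W\<^sub>\<epsilon>)\<close> for small \<open>\<epsilon>\<close>, uniformly over all realizations for
  which \<open>\<Phi>(W\<^sub>\<epsilon>)\<close> stays in a given ball (\<open>rescaled_path_close\<close>).
  
  \<^bold>\<open>Convergence in law.\<close> By Brownian scaling \<open>W\<^sub>\<epsilon>\<close> is a Brownian motion, so \<open>\<Phi>(W\<^sub>\<epsilon>)\<close> has
  the law of \<open>\<Phi>(B)\<close> for every \<open>\<epsilon>\<close>. Thus \<open>y\<^sub>\<epsilon>\<close> is coupled to processes of one fixed law, which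
  takes the place of tightness: a bounded continuous function of paths is nearly constant near
  every path in a closed set whose probability under that law is as close to one as desired
  (\<open>exists_good_paths\<close>, \<open>convergence_in_law_by_coupling\<close>). That finite-dimensional laws determine
  the law on path space, and that the path maps are measurable, follows because every open set of
  paths is the trace of a set in the product \<open>\<sigma>\<close>-algebra (\<open>open_path_set_trace\<close>).
\<close>

section \<open>Power scalings and the dominant part of the field\<close>

lemma treated_Suc: "treated \<sigma> P (Suc l) = treated \<sigma> P l \<union> level \<sigma> P (Suc l)"
  by (simp add: treated_def scaling_def case_prod_unfold)

lemma scaling_Suc: "scaling \<sigma> P (Suc l) = new_scaling P (treated \<sigma> P l) (scaling \<sigma> P l)"
  by (simp add: treated_def scaling_def case_prod_unfold)

lemma treated_mono: "k \<le> l \<Longrightarrow> treated \<sigma> P k \<subseteq> treated \<sigma> P l"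
  unfolding treated_eq by (intro UN_mono) auto

lemma level_Suc_disjoint: "level \<sigma> P (Suc l) \<inter> treated \<sigma> P l = {}"
  by (auto simp: new_indices_def)

lemma scaling_untreated: "j \<notin> treated \<sigma> P l \<Longrightarrow> scaling \<sigma> P l j = \<infinity>"
proof (induction l)
  case 0
  then show ?case by (simp add: treated_def scaling_def)
next
  case (Suc l)
  then show ?case by (simp add: treated_Suc scaling_Suc new_scaling_def)
qed

lemma scaling_treated_stable:
  assumes "j \<in> treated \<sigma> P l" "l \<le> l'"
  shows "scaling \<sigma> P l' j = scaling \<sigma> P l j"
  using assms(2)
proof (induction l' rule: dec_induct)
  case (step k)
  have "j \<notin> level \<sigma> P (Suc k)"
    using level_Suc_disjoint[of \<sigma> P k] treated_mono[OF step(1), of \<sigma> P] assms(1) by blast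
  then show ?case using step by (simp add: scaling_Suc new_scaling_def)
qed simp

lemma level_Suc_min_value:
  assumes "j \<in> level \<sigma> P (Suc l)"
  shows "poly_value (scaling \<sigma> P l) (P j) = min_value P (treated \<sigma> P l) (scaling \<sigma> P l)"
    and "min_value P (treated \<sigma> P l) (scaling \<sigma> P l) < \<infinity>"
    and "scaling \<sigma> P (Suc l) j = min_value P (treated \<sigma> P l) (scaling \<sigma> P l) + 1"
proof -
  let ?A = "treated \<sigma> P l" and ?b = "scaling \<sigma> P l"
  show "poly_value ?b (P j) = min_value P ?A ?b"
    using assms by (auto simp: new_indices_def split: if_splits)
  obtain i where i: "i \<in> UNIV - ?A" "poly_value ?b (P i) \<noteq> \<infinity>"
    using assms by (auto simp: new_indices_def split: if_splits)
  have "min_value P ?A ?b \<le> poly_value ?b (P i)"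
    unfolding min_value_def using i by (intro Min_le) auto
  then show "min_value P ?A ?b < \<infinity>"
    using i by (simp add: less_top le_less_trans)
  show "scaling \<sigma> P (Suc l) j = min_value P ?A ?b + 1"
    using assms by (simp add: scaling_Suc new_scaling_def)
qed

lemma half_ennreal: "(1 / 2 :: ennreal) = ennreal (1 / 2)"
  using ennreal_divide_numeral[of 1 "num.Bit0 num.One"] by simp

text \<open>
  A stage treats new indices only if its minimal value is finite: the procedure stops as soon as
  all remaining values are infinite.
\<close>

lemma scaling_treated_finite: "j \<in> treated \<sigma> P l \<Longrightarrow> scaling \<sigma> P l j < \<infinity>"
proof (induction l)
  case 0
  then have "scaling \<sigma> P 0 j = ennreal (1 / 2)"
    unfolding half_ennreal[symmetric] by (simp add: treated_def scaling_def)
  then show ?case by (simp only: ennreal_less_top infinity_ennreal_def)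
next
  case (Suc l)
  show ?case
  proof (cases "j \<in> treated \<sigma> P l")
    case True
    then show ?thesis using Suc scaling_treated_stable[OF True, of "Suc l"] by simp
  next
    case False
    then have "j \<in> level \<sigma> P (Suc l)" using Suc by (simp add: treated_Suc)
    from level_Suc_min_value(2,3)[OF this] show ?thesis by (simp add: less_top)
  qed
qed

lemma monom_value_ge_component:
  assumes "Poly_Mapping.lookup m i \<noteq> 0"
  shows "c i \<le> monom_value c m"
proof -
  have "1 * c i \<le> of_nat (Poly_Mapping.lookup m i) * c i"
    using assms by (intro mult_right_mono) (simp_all add: Suc_le_eq)
  also have "\<dots> \<le> monom_value c m"
    unfolding monom_value_def by (rule member_le_sum) auto
  finally show ?thesis by simp
qed

lemma monom_value_cong:
  assumes "\<And>i. Poly_Mapping.lookup m i \<noteq> 0 \<Longrightarrow> c i = d i"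
  shows "monom_value c m = monom_value d m"
  unfolding monom_value_def using assms
  by (intro sum.cong refl) (metis mult_zero_left of_nat_0)

lemma min_value_le_monom_value:
  assumes "j \<notin> A" "m \<in> Poly_Mapping.keys (P j)"
  shows "min_value P A b \<le> monom_value b m"
proof -
  have "min_value P A b \<le> poly_value b (P j)"
    unfolding min_value_def using assms by (intro Min_le) auto
  also have "\<dots> \<le> monom_value b m"
    using assms by (auto simp: poly_value_def)
  finally show ?thesis .
qed

text \<open>
  The minimal values of the procedure do not decrease. At a later stage a monomial of an untreated
  component either involves only indices treated at stage \<open>l\<close>, and then its value has not changed
  since that stage, or it contains an index \<open>i\<close> treated afterwards, and then it is at least the
  scaling of \<open>i\<close>, to which the induction hypothesis applies.
\<close>

lemma later_scaling_ge:
  assumes "k \<notin> treated \<sigma> P l" "l \<le> l'"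
  shows "scaling \<sigma> P l' k \<ge> min_value P (treated \<sigma> P l) (scaling \<sigma> P l) + 1"
  using assms(2,1)
proof (induction l' arbitrary: k rule: dec_induct)
  case base
  then show ?case by (simp add: scaling_untreated)
next
  case (step l')
  define \<mu> where "\<mu> = min_value P (treated \<sigma> P l) (scaling \<sigma> P l)"
  have mono: "\<mu> \<le> monom_value (scaling \<sigma> P l') m"
    if j: "j \<notin> treated \<sigma> P l'" and m: "m \<in> Poly_Mapping.keys (P j)" for j m
  proof (cases "\<forall>i. Poly_Mapping.lookup m i \<noteq> 0 \<longrightarrow> i \<in> treated \<sigma> P l")
    case True
    then have "monom_value (scaling \<sigma> P l') m = monom_value (scaling \<sigma> P l) m"
      using step.hyps(1) by (intro monom_value_cong scaling_treated_stable) auto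
    moreover have "j \<notin> treated \<sigma> P l" using j treated_mono[OF step.hyps(1), of \<sigma> P] by blast
    ultimately show ?thesis unfolding \<mu>_def using min_value_le_monom_value m by metis
  next
    case False
    then obtain i where i: "Poly_Mapping.lookup m i \<noteq> 0" "i \<notin> treated \<sigma> P l" by auto
    have "\<mu> \<le> \<mu> + 1" by simp
    also have "\<dots> \<le> scaling \<sigma> P l' i" unfolding \<mu>_def by (rule step.IH[OF i(2)])
    also have "\<dots> \<le> monom_value (scaling \<sigma> P l') m" by (rule monom_value_ge_component[OF i(1)])
    finally show ?thesis .
  qed
  show ?case
  proof (cases "k \<in> level \<sigma> P (Suc l')")
    case False
    then show ?thesis using step by (simp add: scaling_Suc new_scaling_def)
  next
    case True
    then have "k \<in> UNIV - treated \<sigma> P l'" using level_Suc_disjoint[of \<sigma> P l'] by blast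
    then have ne: "UNIV - treated \<sigma> P l' \<noteq> {}" by blast
    have "\<mu> \<le> poly_value (scaling \<sigma> P l') (P j)" if "j \<notin> treated \<sigma> P l'" for j
      using mono[OF that] by (auto simp: poly_value_def intro!: Min.boundedI)
    then have "\<mu> \<le> min_value P (treated \<sigma> P l') (scaling \<sigma> P l')"
      unfolding min_value_def using ne by (intro Min.boundedI) auto
    then show ?thesis
      unfolding level_Suc_min_value(3)[OF True] \<mu>_def[symmetric] by (rule add_right_mono)
  qed
qed

lemma lookup_sum_single:
  assumes "finite S"
  shows "Poly_Mapping.lookup (\<Sum>m\<in>S. Poly_Mapping.single m (f m)) k = (if k \<in> S then f k else (0::real))"
  using assms by (simp add: Poly_Mapping.lookup_sum lookup_single when_def)

text \<open>
  The levels are disjoint, so the definite description in the definition of the dominant part picks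
  the level of \<open>j\<close>.
\<close>

lemma lookup_dominant_level_Suc:
  assumes j: "j \<in> level \<sigma> P (Suc l)"
  shows "Poly_Mapping.lookup (dominant \<sigma> P j) m =
    (if monom_value (scaling \<sigma> P l) m = min_value P (treated \<sigma> P l) (scaling \<sigma> P l)
     then Poly_Mapping.lookup (P j) m else 0)"
proof -
  have j0: "j \<notin> treated \<sigma> P l" using j level_Suc_disjoint[of \<sigma> P l] by blast
  have *: "(THE k. j \<in> level \<sigma> P (Suc k)) = l"
  proof (rule the_equality[of _ l])
    fix k assume k: "j \<in> level \<sigma> P (Suc k)"
    have "j \<notin> treated \<sigma> P k" using k level_Suc_disjoint[of \<sigma> P k] by blast
    moreover have "j \<in> treated \<sigma> P (Suc k)" "j \<in> treated \<sigma> P (Suc l)"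
      using k j by (auto simp: treated_Suc)
    ultimately show "k = l"
      using j0 treated_mono[of "Suc k" l \<sigma> P] treated_mono[of "Suc l" k \<sigma> P]
      by (metis Suc_leI linorder_neqE_nat subsetD)
  qed (rule j)
  have "j \<notin> level \<sigma> P 0"
    using j0 treated_mono[of 0 l \<sigma> P] by (auto simp: treated_eq)
  then have "dominant \<sigma> P j = (\<Sum>m | m \<in> Poly_Mapping.keys (P j) \<and>
              monom_value (scaling \<sigma> P l) m = min_value P (treated \<sigma> P l) (scaling \<sigma> P l).
          Poly_Mapping.single m (Poly_Mapping.lookup (P j) m))"
    unfolding dominant_def by (simp only: if_False Let_def *)
  then show ?thesis
    by (simp add: lookup_sum_single in_keys_iff)
qed

text \<open>
  An untreated coordinate has infinite scaling, so a monomial that contains it cannot attain the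
  finite minimal value.
\<close>

lemma dominant_triangular:
  assumes j: "j \<in> level \<sigma> P (Suc l)" and m: "m \<in> Poly_Mapping.keys (dominant \<sigma> P j)"
    and i: "Poly_Mapping.lookup m i \<noteq> 0"
  shows "i \<in> treated \<sigma> P l"
proof (rule ccontr)
  assume "i \<notin> treated \<sigma> P l"
  then have "monom_value (scaling \<sigma> P l) m = \<infinity>"
    using monom_value_ge_component[OF i, of "scaling \<sigma> P l"]
    by (simp add: scaling_untreated top_unique)
  then show False
    using m level_Suc_min_value(2)[OF j]
    by (auto simp: in_keys_iff lookup_dominant_level_Suc[OF j] split: if_splits)
qed

lemma treated_prop_dim:
  assumes "noise_propagating \<sigma> P"
  shows "treated \<sigma> P (prop_dim \<sigma> P) = UNIV"
  using assms unfolding noise_propagating_def prop_dim_def treated_eq by (rule LeastI_ex)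

text \<open>
  Under noise propagation all final scalings are finite; their real values are the exponents
  of \<open>\<epsilon>\<close> in the rescaling.
\<close>

abbreviation "scale_exp \<sigma> P j \<equiv> enn2real (final_scaling \<sigma> P j)"

lemma final_scaling_ennreal:
  assumes "noise_propagating \<sigma> P"
  shows "final_scaling \<sigma> P j = ennreal (scale_exp \<sigma> P j)"
  using scaling_treated_finite[of j \<sigma> P "prop_dim \<sigma> P"] treated_prop_dim[OF assms]
  by (simp add: final_scaling_def)

lemma monom_value_final:
  assumes "noise_propagating \<sigma> P"
  shows "monom_value (final_scaling \<sigma> P) m =
    ennreal (\<Sum>i\<in>UNIV. real (Poly_Mapping.lookup m i) * scale_exp \<sigma> P i)"
  unfolding monom_value_def
  by (subst final_scaling_ennreal[OF assms], subst sum_ennreal[symmetric])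
     (auto simp: ennreal_mult ennreal_of_nat_eq_real_of_nat)

lemma noise_propagating_level_cases:
  assumes "noise_propagating \<sigma> P"
  obtains "j \<in> level \<sigma> P 0" | l where "j \<in> level \<sigma> P (Suc l)" "l < prop_dim \<sigma> P"
proof -
  have "j \<in> (\<Union>k\<le>prop_dim \<sigma> P. level \<sigma> P k)"
    using treated_prop_dim[OF assms] by (simp add: treated_eq)
  then obtain k where "k \<le> prop_dim \<sigma> P" "j \<in> level \<sigma> P k" by blast
  then show ?thesis using that by (cases k) auto
qed

lemma scale_exp_noisy:
  assumes "\<sigma> $ j > 0"
  shows "scale_exp \<sigma> P j = 1 / 2"
proof -
  have "j \<in> treated \<sigma> P 0" using assms by (simp add: treated_eq)
  then have "final_scaling \<sigma> P j = 1 / 2"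
    using scaling_treated_stable[of j \<sigma> P 0 "prop_dim \<sigma> P"] assms
    by (simp add: final_scaling_def) (simp add: scaling_def)
  then have "final_scaling \<sigma> P j = ennreal (1 / 2)" by (simp only: half_ennreal)
  moreover have "enn2real (ennreal (1 / 2)) = 1 / 2" by (rule enn2real_ennreal) simp
  ultimately show ?thesis by (simp only:)
qed

text \<open>
  For a noisy \<open>j\<close> the dominant part is zero and the exponent is at least \<open>1 / 2\<close>. Now let \<open>j\<close> be
  treated at a later stage. If all indices in the monomial are treated before \<open>j\<close>, its value is the same at the final scaling
  as when \<open>j\<close> was treated, and there it is compared with the minimal value, which is
  \<open>scale_exp \<sigma> P j - 1\<close>. Otherwise it contains an index treated with \<open>j\<close> or later; by
  \<open>later_scaling_ge\<close> the final scaling of that index exceeds the minimal value by at least one, and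
  the exponent is positive.
\<close>

lemma exponent_dominant:
  fixes \<sigma> :: "real ^ 'n::finite"
  assumes np: "noise_propagating \<sigma> P" and m: "m \<in> Poly_Mapping.keys (P j)"
  defines "e \<equiv> 1 - scale_exp \<sigma> P j + (\<Sum>i\<in>UNIV. real (Poly_Mapping.lookup m i) * scale_exp \<sigma> P i)"
  shows "if m \<in> Poly_Mapping.keys (dominant \<sigma> P j) then e = 0 else e > 0"
  using np
proof (cases rule: noise_propagating_level_cases[of \<sigma> P j])
  case 1
  have "0 \<le> (\<Sum>i\<in>UNIV. real (Poly_Mapping.lookup m i) * scale_exp \<sigma> P i)"
    by (intro sum_nonneg) simp
  moreover have "scale_exp \<sigma> P j = 1 / 2" using 1 by (intro scale_exp_noisy) simp
  ultimately have "e > 0" unfolding e_def by linarith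
  then show ?thesis using 1 by (simp add: dominant_def)
next
  case (2 l)
  define s where "s = (\<Sum>i\<in>UNIV. real (Poly_Mapping.lookup m i) * scale_exp \<sigma> P i)"
  have s0: "s \<ge> 0" unfolding s_def by (intro sum_nonneg) simp
  let ?\<mu> = "min_value P (treated \<sigma> P l) (scaling \<sigma> P l)"
  obtain \<mu> where \<mu>: "?\<mu> = ennreal \<mu>" "\<mu> \<ge> 0"
    using level_Suc_min_value(2)[OF 2(1)] by (cases ?\<mu>) auto
  have j: "j \<notin> treated \<sigma> P l" using 2 level_Suc_disjoint[of \<sigma> P l] by blast
  have "j \<in> treated \<sigma> P (Suc l)" using 2 by (simp add: treated_Suc)
  then have "final_scaling \<sigma> P j = ennreal \<mu> + 1"
    using scaling_treated_stable[of j \<sigma> P "Suc l" "prop_dim \<sigma> P"] 2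
      level_Suc_min_value(3)[OF 2(1)] \<mu> by (simp add: final_scaling_def)
  also have "\<dots> = ennreal (\<mu> + 1)" using \<mu> by (simp add: ennreal_plus)
  finally have bj: "scale_exp \<sigma> P j = \<mu> + 1" using \<mu> by simp
  then have e: "e = s - \<mu>" unfolding e_def s_def by simp
  have fin: "monom_value (final_scaling \<sigma> P) m = ennreal s"
    unfolding s_def by (rule monom_value_final[OF np])
  have dom: "m \<in> Poly_Mapping.keys (dominant \<sigma> P j) \<longleftrightarrow> monom_value (scaling \<sigma> P l) m = ?\<mu>"
    using m by (simp add: in_keys_iff lookup_dominant_level_Suc[OF 2(1)])
  show ?thesis
  proof (cases "\<forall>i. Poly_Mapping.lookup m i \<noteq> 0 \<longrightarrow> i \<in> treated \<sigma> P l")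
    case True
    then have "monom_value (final_scaling \<sigma> P) m = monom_value (scaling \<sigma> P l) m"
      unfolding final_scaling_def using 2
      by (intro monom_value_cong scaling_treated_stable) auto
    then have eq: "monom_value (scaling \<sigma> P l) m = ennreal s" using fin by simp
    moreover have "?\<mu> \<le> monom_value (scaling \<sigma> P l) m"
      using j m by (rule min_value_le_monom_value)
    ultimately have "\<mu> \<le> s" "monom_value (scaling \<sigma> P l) m = ?\<mu> \<longleftrightarrow> s = \<mu>"
      using \<mu> s0 by (simp_all add: ennreal_le_iff)
    then show ?thesis using e dom by auto
  next
    case False
    then obtain i where i: "Poly_Mapping.lookup m i \<noteq> 0" "i \<notin> treated \<sigma> P l" by auto
    have "ennreal (\<mu> + 1) = ?\<mu> + 1" using \<mu> by (simp add: ennreal_plus)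
    also have "\<dots> \<le> final_scaling \<sigma> P i"
      unfolding final_scaling_def using 2 by (intro later_scaling_ge[OF i(2)]) simp
    also have "\<dots> \<le> ennreal s" unfolding fin[symmetric] by (rule monom_value_ge_component[OF i(1)])
    finally have "\<mu> + 1 \<le> s" using s0 by (simp add: ennreal_le_iff)
    moreover have "m \<notin> Poly_Mapping.keys (dominant \<sigma> P j)"
      using i 2 dominant_triangular by metis
    ultimately show ?thesis using e by simp
  qed
qed

lemma lookup_dominant:
  assumes "noise_propagating \<sigma> P" "m \<in> Poly_Mapping.keys (dominant \<sigma> P j)"
  shows "Poly_Mapping.lookup (dominant \<sigma> P j) m = Poly_Mapping.lookup (P j) m"
  using assms(1)
proof (cases rule: noise_propagating_level_cases[of \<sigma> P j])
  case 1
  then show ?thesis using assms(2) by (simp add: dominant_def)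
next
  case (2 l)
  then show ?thesis using assms(2)
    by (simp add: in_keys_iff lookup_dominant_level_Suc[OF 2(1)] split: if_splits)
qed

text \<open>
  The drift of the process whose coordinates are \<open>v $ j / \<epsilon> powr b j\<close> in the time scale \<open>\<epsilon> t\<close>.
\<close>

definition scaled_field ::
  "('n \<Rightarrow> real) \<Rightarrow> ('n::finite \<Rightarrow> 'n rpoly) \<Rightarrow> real \<Rightarrow> real ^ 'n \<Rightarrow> real ^ 'n"
  where
  "scaled_field b P \<epsilon> v =
     (\<chi> j. \<epsilon> powr (1 - b j) * poly_field P (\<chi> i. \<epsilon> powr b i * v $ i) $ j)"

lemma scaled_field_monomials:
  assumes "\<epsilon> > 0"
  shows "scaled_field b P \<epsilon> v $ j = (\<Sum>m\<in>Poly_Mapping.keys (P j).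
     \<epsilon> powr (1 - b j + (\<Sum>i\<in>UNIV. real (Poly_Mapping.lookup m i) * b i)) *
     (Poly_Mapping.lookup (P j) m * (\<Prod>i\<in>UNIV. (v $ i) ^ Poly_Mapping.lookup m i)))"
proof -
  have "(\<Prod>i\<in>UNIV. (\<epsilon> powr b i * v $ i) ^ Poly_Mapping.lookup m i) =
      \<epsilon> powr (\<Sum>i\<in>UNIV. real (Poly_Mapping.lookup m i) * b i) *
      (\<Prod>i\<in>UNIV. (v $ i) ^ Poly_Mapping.lookup m i)" for m
    using assms by (simp add: power_mult_distrib prod.distrib powr_sum powr_power)
  then show ?thesis
    using assms by (simp add: scaled_field_def poly_field_def poly_eval_def sum_distrib_left
        powr_add mult_ac)
qed

text \<open>
  On a ball the monomials are bounded, so the difference is at most a finite sum of constants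
  times positive powers of \<open>\<epsilon>\<close>, one for each monomial outside the dominant part.
\<close>

lemma scaled_field_tendsto_dominant:
  fixes \<sigma> :: "real ^ 'n::finite"
  assumes np: "noise_propagating \<sigma> P" and \<eta>: "\<eta> > 0"
  shows "\<forall>\<^sub>F \<epsilon> in at_right 0. \<forall>v\<in>cball 0 R.
    norm (scaled_field (scale_exp \<sigma> P) P \<epsilon> v - poly_field (dominant \<sigma> P) v) \<le> \<eta>"
proof -
  define e where "e j m = 1 - scale_exp \<sigma> P j +
      (\<Sum>i\<in>UNIV. real (Poly_Mapping.lookup m i) * scale_exp \<sigma> P i)" for j m
  define K where "K = max R 0"
  define D where "D j = Poly_Mapping.keys (dominant \<sigma> P j)" for j
  define c where "c j m = \<bar>Poly_Mapping.lookup (P j) m\<bar> * (\<Prod>i\<in>UNIV. K ^ Poly_Mapping.lookup m i)" for j m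
  define r where "r \<epsilon> = (\<Sum>j\<in>UNIV. \<Sum>m\<in>Poly_Mapping.keys (P j) - D j. \<epsilon> powr e j m * c j m)" for \<epsilon>
  have DP: "D j \<subseteq> Poly_Mapping.keys (P j)" for j
    using lookup_dominant[OF np] unfolding D_def by (metis in_keys_iff subsetI)
  have bound: "norm (scaled_field (scale_exp \<sigma> P) P \<epsilon> v - poly_field (dominant \<sigma> P) v) \<le> r \<epsilon>"
    if \<epsilon>: "\<epsilon> > 0" and v: "v \<in> cball 0 R" for \<epsilon> v
  proof -
    define q where "q m = (\<Prod>i\<in>UNIV. (v $ i) ^ Poly_Mapping.lookup m i)" for m
    have q: "\<bar>q m\<bar> \<le> (\<Prod>i\<in>UNIV. K ^ Poly_Mapping.lookup m i)" for m
    proof -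
      have "\<bar>v $ i\<bar> \<le> K" for i
        using component_le_norm_cart[of v i] v by (simp add: K_def)
      then show ?thesis
        unfolding q_def abs_prod power_abs by (intro prod_mono conjI power_mono) auto
    qed
    have diff: "(scaled_field (scale_exp \<sigma> P) P \<epsilon> v - poly_field (dominant \<sigma> P) v) $ j =
      (\<Sum>m\<in>Poly_Mapping.keys (P j) - D j. \<epsilon> powr e j m * (Poly_Mapping.lookup (P j) m * q m))" for j
    proof -
      have "scaled_field (scale_exp \<sigma> P) P \<epsilon> v $ j =
          (\<Sum>m\<in>Poly_Mapping.keys (P j). \<epsilon> powr e j m * (Poly_Mapping.lookup (P j) m * q m))"
        unfolding scaled_field_monomials[OF \<epsilon>] e_def q_def ..
      also have "\<dots> = (\<Sum>m\<in>Poly_Mapping.keys (P j) - D j. \<epsilon> powr e j m * (Poly_Mapping.lookup (P j) m * q m))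
          + (\<Sum>m\<in>D j. \<epsilon> powr e j m * (Poly_Mapping.lookup (P j) m * q m))"
        by (rule sum.subset_diff[OF DP]) simp
      also have "(\<Sum>m\<in>D j. \<epsilon> powr e j m * (Poly_Mapping.lookup (P j) m * q m)) =
          (\<Sum>m\<in>D j. Poly_Mapping.lookup (dominant \<sigma> P j) m * q m)"
      proof (rule sum.cong[OF refl])
        fix m assume m: "m \<in> D j"
        then have "e j m = 0"
          using exponent_dominant[OF np, of m j] DP[of j] unfolding e_def D_def by auto
        then show "\<epsilon> powr e j m * (Poly_Mapping.lookup (P j) m * q m) =
            Poly_Mapping.lookup (dominant \<sigma> P j) m * q m"
          using lookup_dominant[OF np, of m j] m \<epsilon> by (simp add: D_def)
      qed
      also have "\<dots> = poly_field (dominant \<sigma> P) v $ j"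
        by (simp add: poly_field_def poly_eval_def D_def q_def)
      finally show ?thesis by simp
    qed
    have "norm (scaled_field (scale_exp \<sigma> P) P \<epsilon> v - poly_field (dominant \<sigma> P) v) \<le>
      (\<Sum>j\<in>UNIV. \<bar>(scaled_field (scale_exp \<sigma> P) P \<epsilon> v - poly_field (dominant \<sigma> P) v) $ j\<bar>)"
      by (rule norm_le_l1_cart)
    also have "\<dots> \<le> r \<epsilon>"
      unfolding diff r_def
    proof (rule sum_mono)
      fix j :: 'n
      have "\<bar>\<Sum>m\<in>Poly_Mapping.keys (P j) - D j. \<epsilon> powr e j m * (Poly_Mapping.lookup (P j) m * q m)\<bar>
        \<le> (\<Sum>m\<in>Poly_Mapping.keys (P j) - D j. \<bar>\<epsilon> powr e j m * (Poly_Mapping.lookup (P j) m * q m)\<bar>)"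
        by (rule sum_abs)
      also have "\<dots> \<le> (\<Sum>m\<in>Poly_Mapping.keys (P j) - D j. \<epsilon> powr e j m * c j m)"
        unfolding c_def abs_mult using q by (intro sum_mono mult_mono) auto
      finally show "\<bar>\<Sum>m\<in>Poly_Mapping.keys (P j) - D j. \<epsilon> powr e j m * (Poly_Mapping.lookup (P j) m * q m)\<bar>
        \<le> (\<Sum>m\<in>Poly_Mapping.keys (P j) - D j. \<epsilon> powr e j m * c j m)" .
    qed
    finally show ?thesis .
  qed
  have "((\<lambda>\<epsilon>. \<epsilon> powr e j m * c j m) \<longlongrightarrow> 0 * c j m) (at_right 0)"
    if "m \<in> Poly_Mapping.keys (P j) - D j" for j m
  proof -
    have "e j m > 0"
      using exponent_dominant[OF np, of m j] that unfolding e_def D_def by auto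
    then have "((\<lambda>\<epsilon>::real. \<epsilon> powr e j m) \<longlongrightarrow> 0) (at_right 0)"
      using tendsto_powr'[OF tendsto_ident_at tendsto_const, of 0 "e j m" "{0<..}"]
      by (simp add: eventually_at_filter)
    then show ?thesis by (rule tendsto_mult_right)
  qed
  then have "(r \<longlongrightarrow> (\<Sum>j\<in>UNIV. \<Sum>m\<in>Poly_Mapping.keys (P j) - D j. 0 * c j m)) (at_right 0)"
    unfolding r_def by (intro tendsto_sum)
  then have "(r \<longlongrightarrow> 0) (at_right 0)" by simp
  then have "\<forall>\<^sub>F \<epsilon> in at_right 0. r \<epsilon> < \<eta>" using \<eta> by (rule order_tendstoD)
  then show ?thesis
    using eventually_at_right_less[of 0]
    by eventually_elim (use bound in \<open>force intro: order_trans less_imp_le\<close>)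
qed

section \<open>Lipschitz bounds and the Gronwall inequality\<close>

lemma continuous_poly_eval: "continuous_on S (poly_eval p)"
  unfolding poly_eval_def by (intro continuous_intros)

lemma continuous_poly_field: "continuous_on S (poly_field P)"
  unfolding poly_field_def by (intro continuous_intros continuous_on_subset[OF continuous_poly_eval]) auto

lemma lipschitz_on_mult_bounded:
  fixes f g :: "'a::heine_borel \<Rightarrow> real"
  assumes "C-lipschitz_on S f" "D-lipschitz_on S g"
    and "bounded S"
  shows "\<exists>E. E-lipschitz_on S (\<lambda>x. f x * g x)"
proof -
  have "bounded (f ` S)" "bounded (g ` S)"
    using bounded_uniformly_continuous_image[OF lipschitz_on_uniformly_continuous[OF assms(1)] assms(3)]
      bounded_uniformly_continuous_image[OF lipschitz_on_uniformly_continuous[OF assms(2)] assms(3)]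
    by auto
  then obtain K L where K: "\<And>x. x \<in> S \<Longrightarrow> \<bar>f x\<bar> \<le> K" and L: "\<And>x. x \<in> S \<Longrightarrow> \<bar>g x\<bar> \<le> L"
    by (auto simp: bounded_iff)
  have C: "C \<ge> 0" and D: "D \<ge> 0" using assms lipschitz_on_nonneg by blast+
  have "(max K 0 * D + max L 0 * C)-lipschitz_on S (\<lambda>x. f x * g x)"
  proof (rule lipschitz_onI)
    fix x y assume xy: "x \<in> S" "y \<in> S"
    have "f x * g x - f y * g y = f x * (g x - g y) + g y * (f x - f y)"
      by (simp add: algebra_simps)
    then have "dist (f x * g x) (f y * g y) \<le> \<bar>f x\<bar> * dist (g x) (g y) + \<bar>g y\<bar> * dist (f x) (f y)"
      unfolding dist_real_def by (metis abs_mult abs_triangle_ineq)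
    also have "\<dots> \<le> max K 0 * (D * dist x y) + max L 0 * (C * dist x y)"
      using K[OF xy(1)] L[OF xy(2)] lipschitz_onD[OF assms(1) xy] lipschitz_onD[OF assms(2) xy]
      by (intro add_mono mult_mono) auto
    finally show "dist (f x * g x) (f y * g y) \<le> (max K 0 * D + max L 0 * C) * dist x y"
      by (simp add: algebra_simps)
  qed (use C D in auto)
  then show ?thesis ..
qed

lemma lipschitz_poly_eval:
  fixes p :: "'n::finite rpoly"
  assumes S: "bounded S"
  shows "\<exists>L. L-lipschitz_on S (poly_eval p)"
proof -
  have comp: "1-lipschitz_on S (\<lambda>x. x $ i)" for i :: 'n
    by (rule lipschitz_onI) (simp_all add: dist_vec_nth_le)
  have pow: "\<exists>L. L-lipschitz_on S (\<lambda>x. (x $ i) ^ k)" for i :: 'n and k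
  proof (induction k)
    case 0
    show ?case using lipschitz_on_constant[of S "1::real"] by auto
  next
    case (Suc k)
    then show ?case using lipschitz_on_mult_bounded[OF comp _ S] by auto
  qed
  have prod: "\<exists>L. L-lipschitz_on S (\<lambda>x. \<Prod>i\<in>A. (x $ i) ^ k i)" if "finite A" for A :: "'n set" and k
    using that
  proof induction
    case empty
    show ?case using lipschitz_on_constant[of S "1::real"] by auto
  next
    case (insert i A)
    then show ?case using lipschitz_on_mult_bounded[OF _ _ S] pow[of i "k i"] by auto
  qed
  have "\<exists>L. L-lipschitz_on S (\<lambda>x. \<Sum>m\<in>A. Poly_Mapping.lookup p m * (\<Prod>i\<in>UNIV. (x $ i) ^ Poly_Mapping.lookup m i))"
    if "finite A" for A
    using that
  proof induction
    case empty
    show ?case using lipschitz_on_constant[of S "0::real"] by auto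
  next
    case (insert m A)
    obtain D where "D-lipschitz_on S (\<lambda>x. \<Prod>i\<in>UNIV. (x $ i) ^ Poly_Mapping.lookup m i)"
      using prod[of UNIV "Poly_Mapping.lookup m"] by auto
    moreover obtain E where "E-lipschitz_on S
        (\<lambda>x. \<Sum>m\<in>A. Poly_Mapping.lookup p m * (\<Prod>i\<in>UNIV. (x $ i) ^ Poly_Mapping.lookup m i))"
      using insert.IH by auto
    ultimately have "(\<bar>Poly_Mapping.lookup p m\<bar> * D + E)-lipschitz_on S
        (\<lambda>x. Poly_Mapping.lookup p m * (\<Prod>i\<in>UNIV. (x $ i) ^ Poly_Mapping.lookup m i) +
          (\<Sum>m\<in>A. Poly_Mapping.lookup p m * (\<Prod>i\<in>UNIV. (x $ i) ^ Poly_Mapping.lookup m i)))"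
      by (intro lipschitz_on_add lipschitz_on_cmult_real)
    then show ?case using insert.hyps by auto
  qed
  from this[OF finite_keys[of p]] show ?thesis unfolding poly_eval_def[abs_def] .
qed

lemma norm_le_card_bound:
  fixes v :: "real ^ 'n::finite"
  assumes "\<And>i. \<bar>v $ i\<bar> \<le> c"
  shows "norm v \<le> real CARD('n) * c"
proof -
  have "norm v \<le> (\<Sum>i\<in>UNIV. \<bar>v $ i\<bar>)" by (rule norm_le_l1_cart)
  also have "\<dots> \<le> (\<Sum>i\<in>(UNIV::'n set). c)" using assms by (rule sum_mono)
  finally show ?thesis by simp
qed

lemma lipschitz_poly_field:
  fixes P :: "'n::finite \<Rightarrow> 'n rpoly"
  assumes S: "bounded S"
  obtains L where "L-lipschitz_on S (poly_field P)"
proof -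
  obtain L :: "'n \<Rightarrow> real" where L: "\<And>j. (L j)-lipschitz_on S (poly_eval (P j))"
    using choice[of "\<lambda>j L. L-lipschitz_on S (poly_eval (P j))"] lipschitz_poly_eval[OF S] by blast
  have L0: "L j \<ge> 0" for j using L lipschitz_on_nonneg by blast
  have "(real CARD('n) * (\<Sum>j\<in>UNIV. L j))-lipschitz_on S (poly_field P)"
  proof (rule lipschitz_onI)
    fix x y assume xy: "x \<in> S" "y \<in> S"
    have "norm (poly_field P x - poly_field P y) \<le> real CARD('n) * ((\<Sum>j\<in>UNIV. L j) * dist x y)"
    proof (rule norm_le_card_bound)
      fix i
      have "\<bar>(poly_field P x - poly_field P y) $ i\<bar> \<le> L i * dist x y"
        using lipschitz_onD[OF L xy, of i] by (simp add: poly_field_def dist_real_def)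
      also have "\<dots> \<le> (\<Sum>j\<in>UNIV. L j) * dist x y"
        using L0 by (intro mult_right_mono member_le_sum) auto
      finally show "\<bar>(poly_field P x - poly_field P y) $ i\<bar> \<le> (\<Sum>j\<in>UNIV. L j) * dist x y" .
    qed
    then show "dist (poly_field P x) (poly_field P y) \<le> real CARD('n) * (\<Sum>j\<in>UNIV. L j) * dist x y"
      by (simp add: dist_norm)
  qed (simp add: sum_nonneg L0)
  then show ?thesis by (rule that)
qed

text \<open>
  The function \<open>exp (- (L * s)) * (a + L * integral {0..s} g)\<close> has a nonpositive derivative.
\<close>

lemma gronwall:
  fixes g :: "real \<Rightarrow> real"
  assumes g: "continuous_on {0..T} g" and L: "L \<ge> 0"
    and le: "\<And>t. t \<in> {0..T} \<Longrightarrow> g t \<le> a + L * integral {0..t} g"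
    and t: "t \<in> {0..T}"
  shows "g t \<le> a * exp (L * t)"
proof -
  define G where "G s = a + L * integral {0..s} g" for s
  define h where "h s = exp (- (L * s)) * G s" for s
  have G: "(G has_real_derivative L * g s) (at s within {0..t})" if "s \<in> {0..t}" for s
  proof -
    have "(G has_real_derivative 0 + L * g s) (at s within {0..T})"
      unfolding G_def using that t
      by (intro DERIV_add DERIV_const DERIV_cmult integral_has_real_derivative[OF g]) auto
    then show ?thesis using t by (auto intro: DERIV_subset)
  qed
  have E: "((\<lambda>s. exp (- (L * s))) has_real_derivative exp (- (L * s)) * - L) (at s within {0..t})" for s
    by (auto intro!: derivative_eq_intros)
  have h: "(h has_real_derivative exp (- (L * s)) * L * (g s - G s)) (at s within {0..t})"
    if "s \<in> {0..t}" for s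
    unfolding h_def by (rule DERIV_cong[OF DERIV_mult[OF E G[OF that]]]) (simp add: algebra_simps)
  obtain s where s: "s \<in> {0..t}" "h t - h 0 = exp (- (L * s)) * L * (g s - G s) * (t - 0)"
    using mvt_very_simple[of 0 t h "\<lambda>s y. exp (- (L * s)) * L * (g s - G s) * y"] t h
    by (auto simp: has_field_derivative_def)
  have "g s - G s \<le> 0" using le[of s] s t by (simp add: G_def)
  then have "exp (- (L * s)) * L * (g s - G s) * (t - 0) \<le> 0"
    using L t by (intro mult_nonpos_nonneg mult_nonneg_nonpos) auto
  then have "h t \<le> h 0" using s by linarith
  then have "exp (- (L * t)) * G t \<le> a" by (simp add: h_def G_def)
  then have "G t \<le> a * exp (L * t)"
    by (simp add: exp_minus field_simps)
  then show ?thesis using le[OF t] by (simp add: G_def)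
qed

section \<open>Stability of integral equations on the one-point compactification\<close>

lemma openin_Some_preimage:
  assumes y: "continuous_map (top_of_set S) state_topology y" and U: "open U"
  shows "openin (top_of_set S) {t \<in> S. y t \<in> Some ` U}"
  using openin_continuous_map_preimage[OF y, of "Some ` U"] U by simp

lemma closedin_Some_preimage:
  assumes y: "continuous_map (top_of_set S) state_topology y" and K: "compact K"
  shows "closedin (top_of_set S) {t \<in> S. y t \<in> Some ` K}"
  using closedin_continuous_map_preimage[OF y, of "Some ` K"] K
  by (simp add: compact_imp_closed)

text \<open>
  The embedding of \<open>\<real>\<^sup>n\<close> into its one-point compactification is open, so preimages of open sets
  under \<open>the \<circ> y\<close> are preimages of open sets under \<open>y\<close>.
\<close>

lemma continuous_on_the_state:
  assumes y: "continuous_map (top_of_set S) state_topology y" and "\<And>t. t \<in> S \<Longrightarrow> y t \<noteq> None"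
  shows "continuous_on S (\<lambda>t. the (y t))"
proof -
  have "openin (top_of_set S) {t \<in> S. the (y t) \<in> U}" if "open U" for U
  proof -
    have "{t \<in> S. the (y t) \<in> U} = {t \<in> S. y t \<in> Some ` U}"
      using assms(2) by (force simp: image_iff)
    then show ?thesis using openin_Some_preimage[OF y that] by simp
  qed
  then have "continuous_map (top_of_set S) euclidean (\<lambda>t. the (y t))"
    by (simp add: continuous_map_def)
  then show ?thesis by simp
qed

text \<open>
  The path \<open>y\<close> may reach the death state, and the drifts are compared only on the ball of radius
  \<open>K + 1\<close>, so Gronwall applies only as long as \<open>y\<close> stays in that ball. It gives the bound \<open>c < 1\<close>
  there. If \<open>y\<close> did not stay within distance \<open>c'\<close> of \<open>z\<close>, where \<open>c < c' < 1\<close>, there would be a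
  first time at which it fails to do so; up to and including that time \<open>y\<close> is in the closed ball,
  which is compact and therefore also closed in the compactification, so the distance is at most
  \<open>c\<close> even at that time: a contradiction. In particular \<open>y\<close> does not explode.
\<close>

lemma integral_equation_stability:
  fixes y :: "real \<Rightarrow> (real ^ 'n::finite) option" and z u :: "real \<Rightarrow> real ^ 'n"
    and V W :: "real ^ 'n \<Rightarrow> real ^ 'n"
  assumes T: "T \<ge> 0"
    and y: "continuous_map (top_of_set {0..T}) state_topology y"
    and z: "continuous_on {0..T} z"
    and y0: "y 0 \<noteq> None"
    and y_eq: "\<And>t. t \<in> {0..T} \<Longrightarrow> y t \<noteq> None \<Longrightarrow>
      the (y t) = integral {0..t} (\<lambda>s. V (the (y s))) + u t"
    and z_eq: "\<And>t. t \<in> {0..T} \<Longrightarrow> z t = integral {0..t} (\<lambda>s. W (z s)) + u t"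
    and zK: "\<And>t. t \<in> {0..T} \<Longrightarrow> norm (z t) \<le> K"
    and W: "L-lipschitz_on (cball 0 (K + 1)) W"
    and V: "continuous_on (cball 0 (K + 1)) V"
    and VW: "\<And>v. v \<in> cball 0 (K + 1) \<Longrightarrow> norm (V v - W v) \<le> \<eta>"
    and small: "\<eta> * T * exp (L * T) < 1"
    and t: "t \<in> {0..T}"
  shows "\<exists>v. y t = Some v \<and> norm (v - z t) \<le> \<eta> * T * exp (L * T)"
proof -
  define c where "c = \<eta> * T * exp (L * T)"
  have L: "L \<ge> 0" using W by (rule lipschitz_on_nonneg)
  have K: "K \<ge> 0" using zK[of 0] T norm_ge_zero[of "z 0"] by (simp del: norm_ge_zero)
  have \<eta>: "\<eta> \<ge> 0" using VW[of 0] K norm_ge_zero[of "V 0 - W 0"] by (simp del: norm_ge_zero)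
  have c0: "c \<ge> 0" unfolding c_def using \<eta> T by simp
  have Wc: "continuous_on (cball 0 (K + 1)) W"
    using lipschitz_on_uniformly_continuous[OF W] by (rule uniformly_continuous_imp_continuous)
  have close: "norm (the (y r) - z r) \<le> c"
    if r: "r \<in> {0..T}" and near: "\<And>s. s \<in> {0..r} \<Longrightarrow> y s \<in> Some ` cball 0 (K + 1)" for r
  proof -
    define v where "v s = the (y s)" for s
    have yv: "y s \<noteq> None" "v s \<in> cball 0 (K + 1)" if "s \<in> {0..r}" for s
      using near[OF that] by (auto simp: v_def)
    have "continuous_map (top_of_set {0..r}) state_topology y"
      using continuous_map_from_subtopology_mono[OF y, of "{0..r}"] r by auto
    then have vc: "continuous_on {0..r} v"
      unfolding v_def by (rule continuous_on_the_state) (use yv in auto)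
    have zc: "continuous_on {0..r} z" using z r by (auto intro: continuous_on_subset)
    have zb: "z s \<in> cball 0 (K + 1)" if "s \<in> {0..r}" for s
      using zK[of s] that r by simp
    have Vv: "continuous_on {0..r} (\<lambda>s. V (v s))"
      by (rule continuous_on_compose2[OF V vc]) (use yv in auto)
    have Wz: "continuous_on {0..r} (\<lambda>s. W (z s))"
      by (rule continuous_on_compose2[OF Wc zc]) (use zb in auto)
    have nc: "continuous_on {0..r} (\<lambda>s. norm (v s - z s))"
      by (intro continuous_intros vc zc)
    have "norm (v s - z s) \<le> \<eta> * T + L * integral {0..s} (\<lambda>s. norm (v s - z s))" if s: "s \<in> {0..r}" for s
    proof -
      have sub: "{0..s} \<subseteq> {0..r}" and sT: "s \<in> {0..T}" using s r by auto
      have i1: "(\<lambda>s. V (v s)) integrable_on {0..s}" and i2: "(\<lambda>s. W (z s)) integrable_on {0..s}"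
        and i3: "(\<lambda>s. norm (v s - z s)) integrable_on {0..s}"
        using continuous_on_subset[OF Vv sub] continuous_on_subset[OF Wz sub]
          continuous_on_subset[OF nc sub] by (auto intro: integrable_continuous_interval)
      have "v s - z s = integral {0..s} (\<lambda>s. V (v s) - W (z s))"
        using y_eq[OF sT] z_eq[OF sT] yv(1)[OF s] i1 i2 by (simp add: v_def integral_diff)
      also have "norm \<dots> \<le> integral {0..s} (\<lambda>s. \<eta> + L * norm (v s - z s))"
      proof (rule integral_norm_bound_integral)
        show "(\<lambda>s. V (v s) - W (z s)) integrable_on {0..s}" using i1 i2 by (rule integrable_diff)
        show "(\<lambda>s. \<eta> + L * norm (v s - z s)) integrable_on {0..s}"
          by (intro integrable_continuous_interval continuous_intros continuous_on_subset[OF vc sub]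
              continuous_on_subset[OF zc sub])
        fix q assume "q \<in> {0..s}"
        then have q: "q \<in> {0..r}" using sub by auto
        have "norm (V (v q) - W (z q)) \<le> norm (V (v q) - W (v q)) + norm (W (v q) - W (z q))"
          using norm_triangle_ineq[of "V (v q) - W (v q)" "W (v q) - W (z q)"] by simp
        also have "\<dots> \<le> \<eta> + L * norm (v q - z q)"
          using VW[OF yv(2)[OF q]] lipschitz_onD[OF W yv(2)[OF q] zb[OF q]]
          by (intro add_mono) (simp_all add: dist_norm)
        finally show "norm (V (v q) - W (z q)) \<le> \<eta> + L * norm (v q - z q)" .
      qed
      also have "\<dots> = \<eta> * s + L * integral {0..s} (\<lambda>s. norm (v s - z s))"
        using s i3 by (subst integral_add) (auto simp: integrable_on_mult_right)
      also have "\<eta> * s \<le> \<eta> * T" using \<eta> s r by (intro mult_left_mono) auto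
      finally show ?thesis by simp
    qed
    then have "norm (v r - z r) \<le> \<eta> * T * exp (L * r)"
      using r by (intro gronwall[OF nc L]) auto
    also have "\<dots> \<le> c" unfolding c_def
      using r L \<eta> T by (intro mult_left_mono) (auto intro: mult_left_mono)
    finally show ?thesis by (simp add: v_def)
  qed
  define c' where "c' = (c + 1) / 2"
  have c': "c < c'" "c' < 1" "0 < c'" using small c0 unfolding c_def[symmetric] c'_def by auto
  \<comment> \<open>The set of times at which \<open>y\<close> is within \<open>c'\<close> of \<open>z\<close> is relatively open, so a nonempty
      complement has a least element.\<close>
  define G where "G = {t \<in> {0..T}. \<exists>v. y t = Some v \<and> norm (v - z t) < c'}"
  have "openin (top_of_set {0..T}) G"
  proof -
    define S' where "S' = {t \<in> {0..T}. y t \<in> Some ` UNIV}"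
    have S': "openin (top_of_set {0..T}) S'"
      unfolding S'_def by (rule openin_Some_preimage[OF y]) simp
    have sub: "S' \<subseteq> {0..T}" by (auto simp: S'_def)
    have "continuous_map (top_of_set S') state_topology y"
      by (rule continuous_map_from_subtopology_mono[OF y sub])
    then have "continuous_on S' (\<lambda>t. the (y t))"
      by (rule continuous_on_the_state) (auto simp: S'_def)
    then have "continuous_on S' (\<lambda>t. norm (the (y t) - z t))"
      using continuous_on_subset[OF z sub] by (intro continuous_intros)
    then have "openin (top_of_set S') (S' \<inter> (\<lambda>t. norm (the (y t) - z t)) -` {..<c'})"
      by (rule continuous_openin_preimage_gen) simp
    moreover have "S' \<inter> (\<lambda>t. norm (the (y t) - z t)) -` {..<c'} = G"
      by (auto simp: S'_def G_def)
    ultimately show ?thesis using S' openin_trans by metis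
  qed
  then have "closedin (top_of_set {0..T}) ({0..T} - G)" by (simp add: closedin_diff)
  then have "compact ({0..T} - G)" by (metis closedin_compact compact_Icc)
  moreover have bad: "False" if ts: "ts \<in> {0..T} - G" "\<And>s. s \<in> {0..T} - G \<Longrightarrow> ts \<le> s" for ts
  proof -
    have y0z: "y 0 = Some (z 0)"
      using y_eq[of 0] z_eq[of 0] y0 T by auto
    then have "ts > 0" using ts(1) T c' by (cases "ts = 0") (auto simp: G_def)
    have before: "y s \<in> Some ` cball 0 (K + 1)" if s: "s \<in> {0..<ts}" for s
    proof -
      have "s \<in> G" using ts s by force
      then obtain v where v: "y s = Some v" "norm (v - z s) < c'" by (auto simp: G_def)
      have "norm v \<le> norm (v - z s) + norm (z s)"
        using norm_triangle_ineq[of "v - z s" "z s"] by simp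
      also have "\<dots> \<le> K + 1" using v c' zK[of s] s ts(1) by simp
      finally show ?thesis using v by auto
    qed
    have "closedin (top_of_set {0..T}) {t \<in> {0..T}. y t \<in> Some ` cball 0 (K + 1)}"
      by (rule closedin_Some_preimage[OF y]) simp
    then have cl: "closed {t \<in> {0..T}. y t \<in> Some ` cball 0 (K + 1)}"
      by (meson closed_atLeastAtMost closedin_closed_trans)
    have "{0..<ts} \<subseteq> {t \<in> {0..T}. y t \<in> Some ` cball 0 (K + 1)}"
      using before ts(1) by auto
    then have "closure {0..<ts} \<subseteq> {t \<in> {0..T}. y t \<in> Some ` cball 0 (K + 1)}"
      using cl by (simp add: closure_minimal)
    then have all: "y s \<in> Some ` cball 0 (K + 1)" if "s \<in> {0..ts}" for s
      using that \<open>ts > 0\<close> by auto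
    have "norm (the (y ts) - z ts) \<le> c"
      by (rule close[OF _ all]) (use ts(1) in auto)
    moreover have "y ts \<noteq> None" using all[of ts] \<open>ts > 0\<close> by auto
    ultimately have "ts \<in> G" using ts(1) c' by (auto simp: G_def)
    then show False using ts(1) by simp
  qed
  ultimately have "{0..T} - G = {}"
    using compact_attains_inf[of "{0..T} - G"] by metis
  then have GT: "G = {0..T}" by (auto simp: G_def)
  have "y s \<in> Some ` cball 0 (K + 1)" if "s \<in> {0..T}" for s
  proof -
    have "s \<in> G" using GT that by simp
    then obtain v where v: "y s = Some v" "norm (v - z s) < c'" by (auto simp: G_def)
    have "norm v \<le> norm (v - z s) + norm (z s)"
      using norm_triangle_ineq[of "v - z s" "z s"] by simp
    also have "\<dots> \<le> K + 1" using v c' zK[OF that] by simp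
    finally show ?thesis using v by auto
  qed
  then have "norm (the (y t) - z t) \<le> c" "y t \<noteq> None"
    using t by (auto intro!: close)
  then show ?thesis unfolding c_def by auto
qed

section \<open>Explicit solution of the dominant equation\<close>

text \<open>
  For continuous integrands this is the integral. In contrast to the integral, it is visibly a
  measurable function of the values of \<open>f\<close> at the times up to \<open>t\<close>, for arbitrary functions \<open>f\<close>: a
  functional defined with it can be applied to all elements of a product space.
\<close>

definition riemann_lim :: "(real \<Rightarrow> real ^ 'n::finite) \<Rightarrow> real \<Rightarrow> real ^ 'n" where
  "riemann_lim f t = lim (\<lambda>n. (t / real n) *\<^sub>R (\<Sum>k<n. f (real k * (t / real n))))"

text \<open>
  On each of the \<open>n\<close> intervals of length \<open>h\<close> the integrand differs from its value at the left
  endpoint by at most \<open>e\<close>.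
\<close>

lemma left_sum_error:
  fixes f :: "real \<Rightarrow> 'b::euclidean_space"
  assumes f: "continuous_on {0..real n * h} f" and h: "h \<ge> 0"
    and e: "\<And>s s'. s \<in> {0..real n * h} \<Longrightarrow> s' \<in> {0..real n * h} \<Longrightarrow> \<bar>s - s'\<bar> \<le> h \<Longrightarrow> norm (f s - f s') \<le> e"
  shows "norm (integral {0..real n * h} f - h *\<^sub>R (\<Sum>k<n. f (real k * h))) \<le> real n * h * e"
  using f e
proof (induction n)
  case (Suc n)
  define a b where "a = real n * h" and "b = real (Suc n) * h"
  have ab: "0 \<le> a" "a \<le> b" "b = a + h" using h by (auto simp: algebra_simps a_def b_def)
  note prems = Suc.prems[folded b_def]
  have int: "f integrable_on {0..b}" using prems(1) by (rule integrable_continuous_interval)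
  have IH: "norm (integral {0..a} f - h *\<^sub>R (\<Sum>k<n. f (real k * h))) \<le> a * e"
  proof (rule Suc.IH[folded a_def])
    show "continuous_on {0..a} f" using prems(1) ab by (auto intro: continuous_on_subset)
  qed (use prems(2) ab in auto)
  have int2: "f integrable_on {a..b}"
    using int by (rule integrable_subinterval_real) (use ab in auto)
  have "norm (integral {a..b} (\<lambda>s. f s - f a)) \<le> integral {a..b} (\<lambda>s. e)"
    using ab by (intro integral_norm_bound_integral integrable_diff int2 prems(2)) auto
  moreover have "integral {a..b} (\<lambda>s. f s - f a) = integral {a..b} f - h *\<^sub>R f a"
    using ab by (subst integral_diff[OF int2]) auto
  moreover have "integral {a..b} (\<lambda>s. e) = h * e"
    using ab by simp
  ultimately have piece: "norm (integral {a..b} f - h *\<^sub>R f a) \<le> h * e"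
    by (simp only:)
  have "integral {0..b} f = integral {0..a} f + integral {a..b} f"
    by (rule Henstock_Kurzweil_Integration.integral_combine[OF ab(1,2) int, symmetric])
  then have "integral {0..b} f - h *\<^sub>R (\<Sum>k<Suc n. f (real k * h)) =
    (integral {0..a} f - h *\<^sub>R (\<Sum>k<n. f (real k * h))) + (integral {a..b} f - h *\<^sub>R f a)"
    by (simp add: scaleR_add_right a_def)
  also have "norm \<dots> \<le> a * e + h * e"
    by (rule order_trans[OF norm_triangle_ineq add_mono[OF IH piece]])
  also have "a * e + h * e = b * e" using ab(3) by (simp add: algebra_simps)
  finally show ?case unfolding b_def .
qed simp

lemma riemann_lim_eq_integral:
  assumes f: "continuous_on {0..t} f" and t: "t \<ge> 0"
  shows "riemann_lim f t = integral {0..t} f"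
proof -
  have "(\<lambda>n. (t / real n) *\<^sub>R (\<Sum>k<n. f (real k * (t / real n)))) \<longlonglongrightarrow> integral {0..t} f"
  proof (rule LIMSEQ_I)
    fix r :: real assume r: "r > 0"
    define e where "e = r / (t + 1)"
    have e: "e > 0" using r t by (simp add: e_def)
    have "uniformly_continuous_on {0..t} f" using f by (rule compact_uniformly_continuous) simp
    then obtain d where d: "d > 0"
      "\<And>s s'. s \<in> {0..t} \<Longrightarrow> s' \<in> {0..t} \<Longrightarrow> dist s' s < d \<Longrightarrow> dist (f s') (f s) < e"
      unfolding uniformly_continuous_on_def using e by metis
    obtain N :: nat where N: "real N > t / d" using reals_Archimedean2 by blast
    show "\<exists>no. \<forall>n\<ge>no. norm ((t / real n) *\<^sub>R (\<Sum>k<n. f (real k * (t / real n))) - integral {0..t} f) < r"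
    proof (intro exI allI impI)
      fix n assume n: "n \<ge> max N 1"
      then have nt: "real n * (t / real n) = t" by simp
      have "real N \<le> real n" using n by simp
      then have "t / d < real n" using N by linarith
      then have h: "t / real n < d" using d n by (simp add: field_simps)
      have "norm (integral {0..real n * (t / real n)} f - (t / real n) *\<^sub>R (\<Sum>k<n. f (real k * (t / real n))))
          \<le> real n * (t / real n) * e"
      proof (rule left_sum_error)
        fix s s' assume "s \<in> {0..real n * (t / real n)}" "s' \<in> {0..real n * (t / real n)}"
          "\<bar>s - s'\<bar> \<le> t / real n"
        then show "norm (f s - f s') \<le> e"
          using d(2)[of s' s] h unfolding nt by (simp add: dist_norm less_imp_le)
      qed (use f nt t in auto)
      also have "\<dots> < r"
        using r t unfolding nt e_def by (simp add: field_simps)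
      finally show "norm ((t / real n) *\<^sub>R (\<Sum>k<n. f (real k * (t / real n))) - integral {0..t} f) < r"
        unfolding nt by (simp add: norm_minus_commute)
    qed
  qed
  then show ?thesis unfolding riemann_lim_def by (rule limI)
qed

lemma measurable_riemann_lim:
  assumes f: "\<And>s. s \<in> {0..t} \<Longrightarrow> (\<lambda>a. f a s) \<in> borel_measurable N" and t: "t \<ge> 0"
  shows "(\<lambda>a. riemann_lim (f a) t) \<in> borel_measurable N"
proof -
  have "(\<lambda>a. (t / real n) *\<^sub>R (\<Sum>k<n. f a (real k * (t / real n)))) \<in> borel_measurable N" for n
  proof (intro borel_measurable_scaleR borel_measurable_const borel_measurable_sum f)
    fix k assume "k \<in> {..<n}"
    then have "real k * t \<le> real n * t" using t by (intro mult_right_mono) auto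
    then show "real k * (t / real n) \<in> {0..t}"
      using t \<open>k \<in> {..<n}\<close> by (auto simp: field_simps)
  qed
  then show ?thesis
    unfolding riemann_lim_def by (rule borel_measurable_lim_metric)
qed

text \<open>
  The Picard iteration for \<open>y t = integral {0..t} (V \<circ> y) + u t\<close>, started at \<open>u\<close>.
\<close>

primrec picard :: "(real ^ 'n \<Rightarrow> real ^ 'n::finite) \<Rightarrow> nat \<Rightarrow> (real \<Rightarrow> real ^ 'n) \<Rightarrow> real \<Rightarrow> real ^ 'n" where
  "picard V 0 u = u"
| "picard V (Suc l) u = (\<lambda>t. riemann_lim (\<lambda>s. V (picard V l u s)) t + u t)"

lemma picard_cong:
  assumes "\<And>s. s \<in> {0..t} \<Longrightarrow> u s = u' s" "t \<ge> 0"
  shows "picard V l u t = picard V l u' t"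
  using assms
proof (induction l arbitrary: t)
  case 0
  then show ?case by auto
next
  case (Suc l)
  have grid: "real k * (t / real n) \<in> {0..t}" if "k < n" for k n
  proof -
    have "real k * t \<le> real n * t" using Suc.prems that by (intro mult_right_mono) auto
    then show ?thesis using Suc.prems that by (auto simp: field_simps)
  qed
  have "picard V l u s = picard V l u' s" if "s \<in> {0..t}" for s
    using that Suc.prems by (intro Suc.IH) auto
  then have "(\<Sum>k<n. V (picard V l u (real k * (t / real n)))) =
      (\<Sum>k<n. V (picard V l u' (real k * (t / real n))))" for n
    using grid by (intro sum.cong) auto
  then show ?case using Suc.prems by (simp add: riemann_lim_def)
qed

lemma measurable_picard:
  assumes V: "continuous_on UNIV V"
    and u: "\<And>s. s \<in> {0..t} \<Longrightarrow> (\<lambda>a. u a s) \<in> borel_measurable N" and t: "t \<ge> 0"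
  shows "(\<lambda>a. picard V l (u a) t) \<in> borel_measurable N"
  using u t
proof (induction l arbitrary: t)
  case 0
  then show ?case by auto
next
  case (Suc l)
  have "(\<lambda>a. V (picard V l (u a) s)) \<in> borel_measurable N" if "s \<in> {0..t}" for s
    using that Suc.prems
    by (intro borel_measurable_continuous_on[OF V] Suc.IH) auto
  then have "(\<lambda>a. riemann_lim (\<lambda>s. V (picard V l (u a) s)) t) \<in> borel_measurable N"
    using Suc.prems by (intro measurable_riemann_lim)
  then show ?case using Suc.prems by auto
qed

lemma
  assumes V: "continuous_on UNIV V" and u: "continuous_on {0..T} u"
  shows continuous_on_picard: "continuous_on {0..T} (picard V l u)"
    and picard_Suc_integral: "t \<in> {0..T} \<Longrightarrow>
      picard V (Suc l) u t = integral {0..t} (\<lambda>s. V (picard V l u s)) + u t"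
proof -
  have step: "riemann_lim (\<lambda>s. V (w s)) t = integral {0..t} (\<lambda>s. V (w s))"
    if "continuous_on {0..T} w" "t \<in> {0..T}" for w t
  proof (rule riemann_lim_eq_integral)
    have "continuous_on {0..t} w" using that by (auto intro: continuous_on_subset)
    then show "continuous_on {0..t} (\<lambda>s. V (w s))" by (rule continuous_on_compose2[OF V]) simp
  qed (use that in simp)
  show *: "continuous_on {0..T} (picard V l u)" for l
  proof (induction l)
    case 0
    then show ?case using u by simp
  next
    case (Suc l)
    have "continuous_on {0..T} (\<lambda>t. integral {0..t} (\<lambda>s. V (picard V l u s)) + u t)"
      using continuous_on_compose2[OF V Suc]
      by (intro continuous_on_add u indefinite_integral_continuous_1 integrable_continuous_interval) simp
    then show ?case
      by (rule continuous_on_eq) (simp add: step[OF Suc])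
  qed
  show "t \<in> {0..T} \<Longrightarrow> picard V (Suc l) u t = integral {0..t} (\<lambda>s. V (picard V l u s)) + u t"
    by (simp add: step[OF *])
qed

lemma picard_integrable:
  assumes V: "continuous_on UNIV V" and u: "continuous_on {0..T} u" and t: "t \<in> {0..T}"
  shows "(\<lambda>s. V (picard V l u s)) integrable_on {0..t}"
proof -
  have "continuous_on {0..t} (picard V l u)"
    by (rule continuous_on_subset[OF continuous_on_picard[OF V u]]) (use t in auto)
  then have "continuous_on {0..t} (\<lambda>s. V (picard V l u s))"
    by (rule continuous_on_compose2[OF V]) simp
  then show ?thesis by (rule integrable_continuous_interval)
qed

lemma dominant_depends_on_treated:
  assumes j: "j \<in> level \<sigma> P (Suc l)"
    and eq: "\<And>i. i \<in> treated \<sigma> P l \<Longrightarrow> v $ i = w $ i"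
  shows "poly_eval (dominant \<sigma> P j) v = poly_eval (dominant \<sigma> P j) w"
  unfolding poly_eval_def
proof (intro sum.cong refl arg_cong2[where f = "(*)"] prod.cong)
  fix m i assume "m \<in> Poly_Mapping.keys (dominant \<sigma> P j)"
  then show "v $ i ^ Poly_Mapping.lookup m i = w $ i ^ Poly_Mapping.lookup m i"
    using dominant_triangular[OF j] eq by (cases "Poly_Mapping.lookup m i = 0") auto
qed

text \<open>
  By induction on the level: the component \<open>j\<close> of the next iterate depends only on coordinates
  treated earlier, which have already reached their final values; noisy components have zero drift
  and are final from the beginning.
\<close>

lemma picard_stabilizes:
  fixes \<sigma> :: "real ^ 'n::finite" and P :: "'n \<Rightarrow> 'n rpoly"
  defines "V \<equiv> poly_field (dominant \<sigma> P)"
  assumes V: "continuous_on UNIV V" and u: "continuous_on {0..T} u"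
    and "j \<in> treated \<sigma> P l" "l \<le> k" "t \<in> {0..T}"
  shows "picard V k u t $ j = picard V l u t $ j"
  using assms(4-6)
proof (induction l arbitrary: k j t)
  case 0
  have zero: "V v $ j = 0" for v
    using 0 by (simp add: V_def poly_field_def dominant_def treated_eq poly_eval_def)
  show ?case
  proof (cases k)
    case (Suc k')
    have "integral {0..t} (\<lambda>s. V (picard V k' u s)) $ j = integral {0..t} (\<lambda>s. V (picard V k' u s) $ j)"
      using 0 by (intro integral_component_eq_cart[symmetric] picard_integrable[OF V u]) auto
    then show ?thesis using 0 zero by (simp add: Suc picard_Suc_integral[OF V u] del: picard.simps(2))
  qed simp
next
  case (Suc l)
  obtain k' where k: "k = Suc k'" "l \<le> k'" using Suc.prems by (cases k) auto
  have comp: "picard V (Suc i) u t $ j = integral {0..t} (\<lambda>s. V (picard V i u s) $ j) + u t $ j" for i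
  proof -
    have "integral {0..t} (\<lambda>s. V (picard V i u s)) $ j = integral {0..t} (\<lambda>s. V (picard V i u s) $ j)"
      using Suc.prems by (intro integral_component_eq_cart[symmetric] picard_integrable[OF V u]) auto
    then show ?thesis using Suc.prems by (simp add: picard_Suc_integral[OF V u] del: picard.simps(2))
  qed
  show ?case
  proof (cases "j \<in> treated \<sigma> P l")
    case True
    then show ?thesis using Suc.IH[of j k t] Suc.IH[of j "Suc l" t] Suc.prems by simp
  next
    case False
    then have j: "j \<in> level \<sigma> P (Suc l)" using Suc.prems by (simp add: treated_Suc)
    have "V (picard V k' u s) $ j = V (picard V l u s) $ j" if "s \<in> {0..t}" for s
    proof -
      have "picard V k' u s $ i = picard V l u s $ i" if "i \<in> treated \<sigma> P l" for i
        using Suc.IH[OF that k(2)] \<open>s \<in> {0..t}\<close> Suc.prems by auto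
      then have "poly_eval (dominant \<sigma> P j) (picard V k' u s) = poly_eval (dominant \<sigma> P j) (picard V l u s)"
        by (rule dominant_depends_on_treated[OF j])
      moreover have "V v $ j = poly_eval (dominant \<sigma> P j) v" for v
        by (simp add: V_def poly_field_def)
      ultimately show ?thesis by (simp only:)
    qed
    then have "integral {0..t} (\<lambda>s. V (picard V k' u s) $ j) =
        integral {0..t} (\<lambda>s. V (picard V l u s) $ j)"
      by (rule integral_cong)
    then show ?thesis unfolding k comp by (rule arg_cong)
  qed
qed

text \<open>
  After \<open>prop_dim \<sigma> P\<close> steps all indices are treated, so one more step changes nothing.
\<close>

lemma picard_dominant_fixed_point:
  fixes \<sigma> :: "real ^ 'n::finite" and P :: "'n \<Rightarrow> 'n rpoly"
  defines "V \<equiv> poly_field (dominant \<sigma> P)"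
  assumes np: "noise_propagating \<sigma> P"
    and V: "continuous_on UNIV V" and u: "continuous_on {0..T} u" and t: "t \<in> {0..T}"
  shows "picard V (prop_dim \<sigma> P) u t =
    integral {0..t} (\<lambda>s. V (picard V (prop_dim \<sigma> P) u s)) + u t"
proof -
  have "picard V (Suc (prop_dim \<sigma> P)) u t = picard V (prop_dim \<sigma> P) u t"
    unfolding vec_eq_iff V_def
    using treated_prop_dim[OF np] u t V by (intro allI picard_stabilizes) (auto simp: V_def)
  then show ?thesis using picard_Suc_integral[OF V u t] by simp
qed

section \<open>The Borel sets of the path space\<close>

lemma space_borel_of [simp]: "space (borel_of T) = topspace T"
  unfolding borel_of_def by (rule space_measure_of) (auto dest: openin_subset)

lemma sets_borel_of: "sets (borel_of T) = sigma_sets (topspace T) {U. openin T U}"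
  unfolding borel_of_def by (rule sets_measure_of) (auto dest: openin_subset)

lemma openin_in_borel_of: "openin T U \<Longrightarrow> U \<in> sets (borel_of T)"
  by (simp add: sets_borel_of sigma_sets.Basic)

lemma closedin_in_borel_of: "closedin T C \<Longrightarrow> C \<in> sets (borel_of T)"
  using sets.compl_sets[OF openin_in_borel_of[of T "topspace T - C"]] closedin_subset[of T C]
  by (simp add: closedin_def double_diff)

lemma borel_of_euclidean: "borel_of euclidean = borel"
  unfolding borel_of_def borel_def by simp

lemma continuous_map_borel_of:
  assumes "continuous_map S T f"
  shows "f \<in> borel_of S \<rightarrow>\<^sub>M borel_of T"
proof (rule measurable_sigma_sets[OF sets_borel_of])
  show "{U. openin T U} \<subseteq> Pow (topspace T)" by (auto dest: openin_subset)
  show "f \<in> space (borel_of S) \<rightarrow> topspace T"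
    using assms by (simp add: continuous_map_funspace)
  fix U assume "U \<in> {U. openin T U}"
  then have "openin S {x \<in> topspace S. f x \<in> U}" using assms by (auto simp: continuous_map_def)
  moreover have "f -` U \<inter> space (borel_of S) = {x \<in> topspace S. f x \<in> U}" by auto
  ultimately show "f -` U \<inter> space (borel_of S) \<in> sets (borel_of S)"
    by (simp add: openin_in_borel_of)
qed

abbreviation "state_borel \<equiv> borel_of (state_topology :: (real ^ 'n::finite) option topology)"

lemma measurable_Some_state: "Some \<in> borel \<rightarrow>\<^sub>M (state_borel :: (real ^ 'n::finite) option measure)"
  using continuous_map_borel_of[OF continuous_map_Some[of "euclidean :: (real ^ 'n) topology"]]
  by (simp add: borel_of_euclidean)

locale compatible_metric =
  fixes m :: "(real ^ 'n::finite) option metric"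
  assumes compatible: "mtopology_of m = state_topology"
begin

lemma mspace_state [simp]: "mspace m = UNIV"
  using arg_cong[OF compatible, of topspace] by (simp add: UNIV_option_conv)

lemma Metric_space_state: "Metric_space UNIV (mdist m)"
  using Metric_space_mspace_mdist[of m] by simp

lemma mdist_refl [simp]: "mdist m v v = 0"
  by (subst mdist_zero) auto

lemma mem_path_space:
  "f \<in> mspace (path_space m) \<longleftrightarrow> f \<in> extensional {0..1} \<and>
     continuous_map (top_of_set {0..1}) state_topology f \<and>
     (\<forall>s\<in>{0..1}. \<forall>t\<in>{s..1}. f s = None \<longrightarrow> f t = None)"
  unfolding path_space_def mspace_submetric
  by (subst compactin_mspace_cfunspace) (auto simp: compatible)

lemma mdist_path_space_le:
  assumes "f \<in> mspace (path_space m)" "g \<in> mspace (path_space m)"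
  shows "mdist (path_space m) f g \<le> a \<longleftrightarrow> (\<forall>t\<in>{0..1}. mdist m (f t) (g t) \<le> a)"
proof -
  have "f \<in> mspace (cfunspace (top_of_set {0..1}) m)" "g \<in> mspace (cfunspace (top_of_set {0..1}) m)"
    using assms by (simp_all only: path_space_def mspace_submetric Int_iff)
  from cfunspace_mdist_le[OF this] show ?thesis by (simp add: path_space_def)
qed

lemma path_uniformly_continuous:
  assumes "f \<in> mspace (path_space m)" "r > 0"
  obtains d where "d > 0"
    "\<And>s t. s \<in> {0..1} \<Longrightarrow> t \<in> {0..1} \<Longrightarrow> dist s t < d \<Longrightarrow> mdist m (f s) (f t) < r"
proof -
  have "uniformly_continuous_map (submetric euclidean_metric {0..1}) m f"
    using assms(1)
    by (intro continuous_imp_uniformly_continuous_map)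
       (simp add: mtopology_of_submetric compatible mem_path_space compact_space_subtopology)
  then show ?thesis using that assms(2) unfolding uniformly_continuous_map_def by auto
qed

lemma Some_uniformly_continuous:
  fixes K :: "(real ^ 'n) set"
  assumes "compact K" "r > 0"
  obtains d where "d > 0"
    "\<And>v w. v \<in> K \<Longrightarrow> w \<in> K \<Longrightarrow> dist v w < d \<Longrightarrow> mdist m (Some v) (Some w) < r"
proof -
  have "continuous_map (top_of_set K) state_topology Some"
    using continuous_map_Some continuous_map_from_subtopology by blast
  then have "uniformly_continuous_map (submetric euclidean_metric K) m Some"
    using assms(1)
    by (intro continuous_imp_uniformly_continuous_map)
       (simp add: mtopology_of_submetric compatible compact_space_subtopology)
  then show ?thesis using that assms(2) unfolding uniformly_continuous_map_def by auto
qed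

text \<open>
  The rational points together with the death state are dense for every compatible metric, since
  balls are open and \<open>Some\<close> is continuous.
\<close>

lemma countable_dense_states:
  obtains D :: "(real ^ 'n) option set" where "countable D" "D \<noteq> {}"
    "\<And>v r. r > 0 \<Longrightarrow> \<exists>q\<in>D. mdist m v q < r"
proof -
  obtain E :: "(real ^ 'n) set" where E: "countable E" "\<And>X. open X \<Longrightarrow> X \<noteq> {} \<Longrightarrow> \<exists>d\<in>E. d \<in> X"
    using countable_dense_setE by blast
  show ?thesis
  proof
    show "countable (insert None (Some ` E))" using E by simp
    fix v and r :: real assume r: "r > 0"
    show "\<exists>q\<in>insert None (Some ` E). mdist m v q < r"
    proof (cases v)
      case None
      then show ?thesis using r by simp
    next
      case (Some u)
      have "openin state_topology (mball_of m v r)"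
        unfolding compatible[symmetric] mtopology_of_def mball_of_def
        by (intro Metric_space.openin_mball) (simp add: Metric_space_state)
      then have "openin euclidean {x \<in> topspace euclidean. Some x \<in> mball_of m v r}"
        by (rule openin_continuous_map_preimage[OF continuous_map_Some])
      then have "open {x. Some x \<in> mball_of m v r}" by simp
      moreover have "u \<in> {x. Some x \<in> mball_of m v r}"
        using r Some by simp
      ultimately obtain d where "d \<in> E" "Some d \<in> mball_of m v r"
        using E(2)[of "{x. Some x \<in> mball_of m v r}"] by blast
      then show ?thesis by auto
    qed
  qed simp
qed

abbreviation "cylinders \<equiv> PiM {0..1::real} (\<lambda>_. state_borel :: (real ^ 'n) option measure)"

text \<open>
  Paths that stay in the closed ball of radius \<open>r\<close> around the point \<open>qs ! k\<close> during the \<open>k\<close>-th of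
  \<open>length qs\<close> equal subintervals of \<open>{0..1}\<close>. Only rational times are tested, which makes the set
  measurable in the product space; a continuous path satisfies the condition at the
  rational times only if it satisfies it at all times.
\<close>

definition tube :: "(real ^ 'n) option list \<Rightarrow> real \<Rightarrow> (real \<Rightarrow> (real ^ 'n) option) set" where
  "tube qs r = {f \<in> space cylinders. \<forall>k<length qs.
     \<forall>t\<in>{real k / length qs..real (Suc k) / length qs} \<inter> \<rat>. mdist m (f t) (qs ! k) \<le> r}"

lemma interval_in_unit:
  assumes "k < n" "t \<in> {real k / real n..real (Suc k) / real n}"
  shows "t \<in> {0..1}"
proof -
  have "0 \<le> real k / real n" "real (Suc k) / real n \<le> 1" using assms(1) by (auto simp: field_simps)
  then show ?thesis using assms(2) unfolding atLeastAtMost_iff by (blast intro: order_trans)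
qed

lemma sets_tube: "tube qs r \<in> sets cylinders"
proof -
  have *: "{f \<in> space cylinders. mdist m (f t) (qs ! k) \<le> r} \<in> sets cylinders"
    if "k < length qs" "t \<in> {real k / length qs..real (Suc k) / length qs} \<inter> \<rat>" for k t
  proof -
    have t: "t \<in> {0..1}" using interval_in_unit that by blast
    have "closedin state_topology (mcball_of m (qs ! k) r)"
      unfolding compatible[symmetric] mtopology_of_def mcball_of_def
      by (intro Metric_space.closedin_mcball) (simp add: Metric_space_state)
    then have "mcball_of m (qs ! k) r \<in> sets state_borel" by (rule closedin_in_borel_of)
    then have "(\<lambda>f. f t) -` mcball_of m (qs ! k) r \<inter> space cylinders \<in> sets cylinders"
      by (rule measurable_sets[OF measurable_component_singleton[OF t]])
    moreover have "(\<lambda>f. f t) -` mcball_of m (qs ! k) r \<inter> space cylinders =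
        {f \<in> space cylinders. mdist m (f t) (qs ! k) \<le> r}"
      by (auto simp: mdist_commute)
    ultimately show ?thesis by simp
  qed
  define J where "J = (SIGMA k:{..<length qs}. {real k / length qs..real (Suc k) / length qs} \<inter> \<rat>)"
  have "countable J"
    unfolding J_def by (intro countable_SIGMA countable_Int2 countable_rat) simp
  then have "(\<Union>(k, t)\<in>J. space cylinders - {f \<in> space cylinders. mdist m (f t) (qs ! k) \<le> r})
      \<in> sets cylinders"
    by (intro sets.countable_UN') (use * in \<open>auto simp: J_def simp del: of_nat_Suc\<close>)
  then have "space cylinders - (\<Union>(k, t)\<in>J. space cylinders -
      {f \<in> space cylinders. mdist m (f t) (qs ! k) \<le> r}) \<in> sets cylinders"
    by (rule sets.compl_sets)
  also have "space cylinders - (\<Union>(k, t)\<in>J. space cylinders -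
      {f \<in> space cylinders. mdist m (f t) (qs ! k) \<le> r}) = tube qs r"
    unfolding tube_def J_def by fast
  finally show ?thesis .
qed

lemma path_in_tube:
  assumes f: "f \<in> mspace (path_space m)" and "f \<in> tube qs r"
    and k: "k < length qs" "t \<in> {real k / length qs..real (Suc k) / length qs}"
  shows "mdist m (f t) (qs ! k) \<le> r"
proof -
  let ?I = "{real k / length qs..real (Suc k) / length qs}"
  have sub: "?I \<subseteq> {0..1}" using interval_in_unit[OF k(1)] by blast
  have "closedin state_topology (mcball_of m (qs ! k) r)"
    unfolding compatible[symmetric] mtopology_of_def mcball_of_def
    by (intro Metric_space.closedin_mcball) (simp add: Metric_space_state)
  moreover have "continuous_map (top_of_set {0..1}) state_topology f"
    using f by (simp add: mem_path_space)
  then have "continuous_map (top_of_set ?I) state_topology f"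
    by (rule continuous_map_from_subtopology_mono[OF _ sub])
  ultimately have "closedin (top_of_set ?I) {s \<in> ?I. f s \<in> mcball_of m (qs ! k) r}"
    using closedin_continuous_map_preimage by fastforce
  then have cl: "closed {s \<in> ?I. f s \<in> mcball_of m (qs ! k) r}"
    by (meson closed_atLeastAtMost closedin_closed_trans)
  have "?I \<inter> \<rat> \<subseteq> {s \<in> ?I. f s \<in> mcball_of m (qs ! k) r}"
    using assms(2) k(1) by (auto simp: tube_def mdist_commute)
  then have *: "closure (?I \<inter> \<rat>) \<subseteq> {s \<in> ?I. f s \<in> mcball_of m (qs ! k) r}"
    using cl by (simp add: closure_minimal)
  have "t \<in> closure (?I \<inter> \<rat>)"
  proof -
    have lt: "real k / length qs < real (Suc k) / length qs"
      using k(1) by (intro divide_strict_right_mono) auto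
    have "t \<in> closure {real k / length qs<..<real (Suc k) / length qs}"
      using k(2) lt by simp
    also have "{real k / length qs<..<real (Suc k) / length qs} \<subseteq> closure (?I \<inter> \<rat>)"
    proof
      fix s assume s: "s \<in> {real k / length qs<..<real (Suc k) / length qs}"
      show "s \<in> closure (?I \<inter> \<rat>)"
        unfolding closure_approachable
      proof (intro allI impI)
        fix e :: real assume e: "e > 0"
        have "s < min (s + e) (real (Suc k) / length qs)" using e s by auto
        then obtain q where "q \<in> \<rat>" "s < q" "q < min (s + e) (real (Suc k) / length qs)"
          using Rats_dense_in_real by blast
        then show "\<exists>q\<in>?I \<inter> \<rat>. dist q s < e"
          using s by (intro bexI[of _ q]) (auto simp: dist_real_def)
      qed
    qed
    then have "closure {real k / length qs<..<real (Suc k) / length qs} \<subseteq> closure (?I \<inter> \<rat>)"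
      by (simp add: closure_minimal)
    finally show ?thesis .
  qed
  with * show ?thesis by (auto simp: mdist_commute)
qed

lemma mspace_subset_cylinders: "mspace (path_space m) \<subseteq> space cylinders"
  by (auto simp: mem_path_space space_PiM PiE_def UNIV_option_conv[symmetric])

text \<open>
  Tubes around points of a countable dense set, with radii \<open>1 / Suc n\<close>, form a countable family
  of product-measurable sets. By uniform continuity every path lies in tubes of arbitrarily small
  radius, and two paths in a tube of radius \<open>r\<close> have distance at most \<open>2 * r\<close>. So an open set of
  paths is the union of those tubes all of whose paths belong to it.
\<close>

lemma open_path_set_trace:
  assumes U: "openin (mtopology_of (path_space m)) U"
  shows "\<exists>A\<in>sets cylinders. U = A \<inter> mspace (path_space m)"
proof -
  let ?X = "mspace (path_space m)"
  obtain D where D: "countable D" "D \<noteq> {}" "\<And>v r. r > 0 \<Longrightarrow> \<exists>q\<in>D. mdist m v q < r"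
    by (rule countable_dense_states) (rule that)
  define I where "I = {(qs, n). qs \<in> lists D \<and> tube qs (1 / real (Suc n)) \<inter> ?X \<subseteq> U}"
  have "countable (lists D \<times> (UNIV :: nat set))" using D(1) by (intro countable_SIGMA) auto
  then have I: "countable I" by (rule countable_subset[rotated]) (auto simp: I_def)
  define A where "A = (\<Union>(qs, n)\<in>I. tube qs (1 / real (Suc n)))"
  have "A \<in> sets cylinders"
    unfolding A_def using I sets_tube by (intro sets.countable_UN') auto
  moreover have "U = A \<inter> ?X"
  proof (intro equalityI subsetI)
    fix f assume fU: "f \<in> U"
    have UX: "U \<subseteq> ?X" using openin_subset[OF U] by simp
    then have f: "f \<in> ?X" using fU by blast
    obtain e where e: "e > 0" "mball_of (path_space m) f e \<subseteq> U"
      using U fU unfolding mtopology_of_def mball_of_def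
      by (auto simp: Metric_space.openin_mtopology[OF Metric_space_mspace_mdist])
    obtain n where n: "inverse (real (Suc n)) < e / 2"
      using reals_Archimedean[of "e / 2"] e(1) by auto
    define r where "r = 1 / real (Suc n)"
    have r: "r > 0" "2 * r < e" using n by (auto simp: r_def field_simps)
    obtain d where d: "d > 0"
      "\<And>s t. s \<in> {0..1} \<Longrightarrow> t \<in> {0..1} \<Longrightarrow> dist s t < d \<Longrightarrow> mdist m (f s) (f t) < r / 2"
      using path_uniformly_continuous[OF f, of "r / 2"] r by auto
    obtain N where N: "inverse (real (Suc N)) < d" using reals_Archimedean[OF d(1)] by auto
    define L where "L = Suc N"
    have L: "L > 0" "1 / real L < d" using N by (auto simp: L_def field_simps)
    obtain q where q: "\<And>k. q k \<in> D" "\<And>k. mdist m (f (real k / L)) (q k) < r / 2"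
    proof -
      have "\<exists>q. \<forall>k::nat. q k \<in> D \<and> mdist m (f (real k / L)) (q k) < r / 2"
        using D(3)[of "r / 2"] r by (intro choice allI) auto
      then show ?thesis using that by blast
    qed
    define qs where "qs = map q [0..<L]"
    have qs: "length qs = L" "qs \<in> lists D" "\<And>k. k < L \<Longrightarrow> qs ! k = q k"
      using q by (auto simp: qs_def)
    have "f \<in> tube qs r"
      unfolding tube_def
    proof (intro CollectI conjI allI impI ballI)
      show "f \<in> space cylinders" using f mspace_subset_cylinders by blast
      fix k t assume k: "k < length qs" and t: "t \<in> {real k / length qs..real (Suc k) / length qs} \<inter> \<rat>"
      have t1: "t \<in> {0..1}" using interval_in_unit[OF k] t by blast
      have k1: "real k / L \<in> {0..1}" using k qs(1) by (auto simp: field_simps)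
      have "dist t (real k / L) \<le> 1 / L"
        using t qs(1) by (auto simp: dist_real_def add_divide_distrib)
      then have "mdist m (f t) (f (real k / L)) < r / 2"
        using L(2) by (intro d(2)[OF t1 k1]) linarith
      moreover have "mdist m (f (real k / L)) (qs ! k) < r / 2" using q k qs by simp
      ultimately show "mdist m (f t) (qs ! k) \<le> r"
        using mdist_triangle[of "f t" m "f (real k / L)" "qs ! k"] by simp
    qed
    moreover have "tube qs r \<inter> ?X \<subseteq> U"
    proof
      fix g assume g: "g \<in> tube qs r \<inter> ?X"
      have "mdist m (f t) (g t) \<le> 2 * r" if t: "t \<in> {0..1}" for t
      proof -
        \<comment> \<open>The index of a subinterval that contains \<open>t\<close>; the time 1 belongs to the last one.\<close>
        define k where "k = (if t = 1 then L - 1 else nat \<lfloor>t * real L\<rfloor>)"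
        have k: "k < L \<and> t \<in> {real k / L..real (Suc k) / L}"
        proof (cases "t = 1")
          case True
          then show ?thesis using L by (auto simp: k_def field_simps of_nat_diff)
        next
          case False
          have "t * real L < 1 * real L" using False t L by (intro mult_strict_right_mono) auto
          then have lt: "t * real L < real L" by simp
          have "0 \<le> t * real L" using t by simp
          then have k: "real k = of_int \<lfloor>t * real L\<rfloor>" using False by (simp add: k_def)
          then have "real k \<le> t * real L" "t * real L \<le> real (Suc k)" by linarith+
          moreover from this(1) lt have "k < L" by linarith
          ultimately show ?thesis using L by (simp add: field_simps)
        qed
        have "mdist m (f t) (qs ! k) \<le> r" "mdist m (g t) (qs ! k) \<le> r"
          using path_in_tube[OF f \<open>f \<in> tube qs r\<close>, of k t] path_in_tube[of g qs r k t] g k qs(1) by auto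
        then show ?thesis
          using mdist_triangle[of "f t" m "qs ! k" "g t"] by (simp add: mdist_commute)
      qed
      then have "mdist (path_space m) f g \<le> 2 * r"
        using mdist_path_space_le[OF f] g by blast
      then have "g \<in> mball_of (path_space m) f e" using f g r by simp
      then show "g \<in> U" using e by blast
    qed
    ultimately show "f \<in> A \<inter> ?X"
      using f qs(2) unfolding A_def I_def r_def by auto
  next
    fix f assume "f \<in> A \<inter> ?X"
    then show "f \<in> U" unfolding A_def I_def by auto
  qed
  ultimately show ?thesis by blast
qed

abbreviation "path_borel \<equiv> borel_of (mtopology_of (path_space m))"

lemma path_borel_trace:
  assumes "A \<in> sets path_borel"
  shows "\<exists>A'\<in>sets cylinders. A = A' \<inter> mspace (path_space m)"
proof -
  let ?X = "mspace (path_space m)"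
  have "sigma_sets ?X {U. openin (mtopology_of (path_space m)) U} \<subseteq> sets (restrict_space cylinders ?X)"
  proof (rule sets.sigma_sets_subset')
    show "{U. openin (mtopology_of (path_space m)) U} \<subseteq> sets (restrict_space cylinders ?X)"
      using open_path_set_trace by (auto simp: sets_restrict_space)
    show "?X \<in> sets (restrict_space cylinders ?X)"
      using mspace_subset_cylinders sets.top[of "restrict_space cylinders ?X"]
      by (simp add: space_restrict_space Int_absorb2)
  qed
  then show ?thesis using assms by (auto simp: sets_borel_of sets_restrict_space)
qed

lemma measurable_path:
  assumes X: "X \<in> N \<rightarrow>\<^sub>M cylinders" and "X \<in> space N \<rightarrow> mspace (path_space m)"
  shows "X \<in> N \<rightarrow>\<^sub>M path_borel"
proof (rule measurableI)
  show "a \<in> space N \<Longrightarrow> X a \<in> space path_borel" for a using assms(2) by auto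
  fix A assume "A \<in> sets path_borel"
  then obtain A' where A': "A' \<in> sets cylinders" "A = A' \<inter> mspace (path_space m)"
    using path_borel_trace by blast
  then have "X -` A \<inter> space N = X -` A' \<inter> space N" using assms(2) by auto
  then show "X -` A \<inter> space N \<in> sets N" using measurable_sets[OF X A'(1)] by simp
qed

text \<open>
  With product-measurable sets as representatives, laws on path space are determined by laws on the
  product space, hence by finite-dimensional distributions.
\<close>

lemma path_distr_eq:
  assumes X: "X \<in> N \<rightarrow>\<^sub>M cylinders" "X \<in> space N \<rightarrow> mspace (path_space m)"
    and Y: "Y \<in> N' \<rightarrow>\<^sub>M cylinders" "Y \<in> space N' \<rightarrow> mspace (path_space m)"
    and eq: "distr N cylinders X = distr N' cylinders Y"
  shows "distr N path_borel X = distr N' path_borel Y"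
proof (rule measure_eqI)
  fix A assume "A \<in> sets (distr N path_borel X)"
  then have A: "A \<in> sets path_borel" by simp
  then obtain A' where A': "A' \<in> sets cylinders" "A = A' \<inter> mspace (path_space m)"
    using path_borel_trace by blast
  have "emeasure (distr N path_borel X) A = emeasure (distr N cylinders X) A'"
    using A A' X by (auto simp: emeasure_distr measurable_path intro!: arg_cong[where f = "emeasure N"])
  also have "\<dots> = emeasure (distr N' path_borel Y) A"
    unfolding eq using A A' Y
    by (auto simp: emeasure_distr measurable_path intro!: arg_cong[where f = "emeasure N'"])
  finally show "emeasure (distr N path_borel X) A = emeasure (distr N' path_borel Y) A" .
qed simp

end

section \<open>Uniqueness of the law of Brownian motion and Brownian scaling\<close>

lemma measurable_vec_lambda:
  assumes "\<And>i. (\<lambda>a. f a i) \<in> borel_measurable N"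
  shows "(\<lambda>a. (\<chi> i. f a i) :: real ^ 'n::finite) \<in> borel_measurable N"
  using assms by (auto simp: borel_measurable_euclidean_space[where 'c = "real ^ 'n"] Basis_vec_def inner_axis)

lemma (in brownian_motion) random_variable_B [measurable]: "0 \<le> t \<Longrightarrow> B t \<in> borel_measurable M"
  using measurable_from_subalg[OF subalgebra adapted] .

text \<open>
  The right-hand side depends on \<open>t - s\<close> only, not on the process.
\<close>

lemma (in brownian_motion) increment_distr:
  assumes st: "0 \<le> s" "s < t"
  shows "distr M borel (\<lambda>\<omega>. B t \<omega> - B s \<omega>) =
    distr (PiM UNIV (\<lambda>_::'n. density lborel (\<lambda>x. ennreal (normal_density 0 (sqrt (t - s)) x)))) borel
      (\<lambda>f. \<chi> i. f i)"
proof -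
  define X where "X i \<omega> = (B t \<omega> - B s \<omega>) $ i" for i \<omega>
  have "(\<lambda>\<omega>. B t \<omega> - B s \<omega>) \<in> borel_measurable M"
    using st by (intro borel_measurable_diff random_variable_B) auto
  from measurable_compose[OF this borel_measurable_nth]
  have [measurable]: "X i \<in> borel_measurable M" for i by (simp add: X_def[abs_def])
  have marg: "distr M borel (X i) = density lborel (\<lambda>x. ennreal (normal_density 0 (sqrt (t - s)) x))" for i
  proof -
    have "distr M borel (X i) = distr M lborel (X i)" by (rule distr_cong) auto
    also have "\<dots> = density lborel (\<lambda>x. ennreal (normal_density 0 (sqrt (t - s)) x))"
      using increment_normal[OF st, of i] unfolding X_def[abs_def] by (rule distributed_distr_eq_density)
    finally show ?thesis .
  qed
  have "indep_vars (\<lambda>_. borel) X UNIV"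
    using increment_indep_coords[OF st] unfolding X_def[abs_def] .
  then have "distr M (PiM UNIV (\<lambda>_. borel)) (\<lambda>\<omega>. \<lambda>i\<in>UNIV. X i \<omega>) = PiM UNIV (\<lambda>i. distr M borel (X i))"
    by (subst (asm) indep_vars_iff_distr_eq_PiM) auto
  then have joint: "distr M (PiM UNIV (\<lambda>_. borel)) (\<lambda>\<omega>. \<lambda>i\<in>UNIV. X i \<omega>) =
    PiM UNIV (\<lambda>_. density lborel (\<lambda>x. ennreal (normal_density 0 (sqrt (t - s)) x)))"
    by (simp only: marg)
  have "(\<lambda>f::'n \<Rightarrow> real. \<chi> i. f i) \<in> borel_measurable (PiM UNIV (\<lambda>_. borel))"
    by (rule measurable_vec_lambda) simp
  moreover have "(\<lambda>\<omega>. \<lambda>i\<in>UNIV. X i \<omega>) \<in> M \<rightarrow>\<^sub>M PiM UNIV (\<lambda>_. borel)"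
    by (rule measurable_restrict) simp
  ultimately have "distr (distr M (PiM UNIV (\<lambda>_. borel)) (\<lambda>\<omega>. \<lambda>i\<in>UNIV. X i \<omega>)) borel (\<lambda>f. \<chi> i. f i) =
    distr M borel (\<lambda>\<omega>. B t \<omega> - B s \<omega>)"
    by (subst distr_distr) (auto simp: X_def o_def vec_eq_iff intro!: distr_cong)
  then show ?thesis unfolding joint by simp
qed

text \<open>
  Independence in terms of two families of events, for random variables with values in spaces
  of different types.
\<close>

lemma (in prob_space) distr_pair_indep_set:
  assumes X: "X \<in> M \<rightarrow>\<^sub>M S" and Y: "Y \<in> M \<rightarrow>\<^sub>M T" and ind: "indep_set \<G> \<H>"
    and G: "\<And>A. A \<in> sets S \<Longrightarrow> X -` A \<inter> space M \<in> \<G>"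
    and H: "\<And>A. A \<in> sets T \<Longrightarrow> Y -` A \<inter> space M \<in> \<H>"
  shows "distr M (S \<Otimes>\<^sub>M T) (\<lambda>\<omega>. (X \<omega>, Y \<omega>)) = distr M S X \<Otimes>\<^sub>M distr M T Y"
proof (rule pair_measure_eqI[symmetric])
  interpret X: prob_space "distr M S X" using X by (rule prob_space_distr)
  interpret Y: prob_space "distr M T Y" using Y by (rule prob_space_distr)
  show "sigma_finite_measure (distr M S X)" "sigma_finite_measure (distr M T Y)" by unfold_locales
  show "sets (distr M S X \<Otimes>\<^sub>M distr M T Y) = sets (distr M (S \<Otimes>\<^sub>M T) (\<lambda>\<omega>. (X \<omega>, Y \<omega>)))"
    by (simp cong: sets_pair_measure_cong)
  fix A C assume "A \<in> sets (distr M S X)" "C \<in> sets (distr M T Y)"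
  then have AC: "A \<in> sets S" "C \<in> sets T" by simp_all
  have XY: "(\<lambda>\<omega>. (X \<omega>, Y \<omega>)) \<in> M \<rightarrow>\<^sub>M S \<Otimes>\<^sub>M T" using X Y by simp
  have "(\<lambda>\<omega>. (X \<omega>, Y \<omega>)) -` (A \<times> C) \<inter> space M = (X -` A \<inter> space M) \<inter> (Y -` C \<inter> space M)" by auto
  then have "emeasure (distr M (S \<Otimes>\<^sub>M T) (\<lambda>\<omega>. (X \<omega>, Y \<omega>))) (A \<times> C) =
      ennreal (prob ((X -` A \<inter> space M) \<inter> (Y -` C \<inter> space M)))"
    using AC XY by (simp add: emeasure_distr emeasure_eq_measure)
  also have "\<dots> = ennreal (prob (X -` A \<inter> space M) * prob (Y -` C \<inter> space M))"
    using indep_setD[OF ind G[OF AC(1)] H[OF AC(2)]] by simp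
  also have "\<dots> = emeasure (distr M S X) A * emeasure (distr M T Y) C"
    using AC X Y by (simp add: emeasure_distr emeasure_eq_measure ennreal_mult)
  finally show "emeasure (distr M S X) A * emeasure (distr M T Y) C =
      emeasure (distr M (S \<Otimes>\<^sub>M T) (\<lambda>\<omega>. (X \<omega>, Y \<omega>))) (A \<times> C)" by simp
qed

lemma (in brownian_motion)
  assumes st: "0 \<le> s" "s < t" and J: "J \<subseteq> {0..s}"
  shows measurable_past: "(\<lambda>\<omega>. \<lambda>r\<in>J. B r \<omega>) \<in> M \<rightarrow>\<^sub>M PiM J (\<lambda>_. borel)"
    and measurable_increment: "(\<lambda>\<omega>. B t \<omega> - B s \<omega>) \<in> borel_measurable M"
    and distr_past_increment: "distr M (PiM J (\<lambda>_. borel) \<Otimes>\<^sub>M borel) (\<lambda>\<omega>. (\<lambda>r\<in>J. B r \<omega>, B t \<omega> - B s \<omega>)) =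
      distr M (PiM J (\<lambda>_. borel)) (\<lambda>\<omega>. \<lambda>r\<in>J. B r \<omega>) \<Otimes>\<^sub>M distr M borel (\<lambda>\<omega>. B t \<omega> - B s \<omega>)"
proof -
  have "B r \<in> borel_measurable (F s)" if "r \<in> J" for r
  proof (rule measurable_from_subalg)
    have "r \<le> s" using that J by auto
    then show "subalgebra (F s) (F r)"
      using sets_F_mono[of r s] space_F by (simp add: subalgebra_def)
    show "B r \<in> borel_measurable (F r)" using that J by (intro adapted) auto
  qed
  then have X: "(\<lambda>\<omega>. \<lambda>r\<in>J. B r \<omega>) \<in> F s \<rightarrow>\<^sub>M PiM J (\<lambda>_. borel)"
    by (rule measurable_restrict)
  show XM: "(\<lambda>\<omega>. \<lambda>r\<in>J. B r \<omega>) \<in> M \<rightarrow>\<^sub>M PiM J (\<lambda>_. borel)"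
    using measurable_from_subalg[OF subalgebra[OF st(1)] X] .
  show D: "(\<lambda>\<omega>. B t \<omega> - B s \<omega>) \<in> borel_measurable M"
    using st by (intro borel_measurable_diff random_variable_B) auto
  show "distr M (PiM J (\<lambda>_. borel) \<Otimes>\<^sub>M borel) (\<lambda>\<omega>. (\<lambda>r\<in>J. B r \<omega>, B t \<omega> - B s \<omega>)) =
      distr M (PiM J (\<lambda>_. borel)) (\<lambda>\<omega>. \<lambda>r\<in>J. B r \<omega>) \<Otimes>\<^sub>M distr M borel (\<lambda>\<omega>. B t \<omega> - B s \<omega>)"
    by (rule distr_pair_indep_set[OF XM D increment_indep_past[OF st]])
       (use measurable_sets[OF X] space_F[of s] in auto)
qed

text \<open>
  The value at a time later than all times in \<open>J\<close> is the last value plus an increment that is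
  independent of the values at times in \<open>J\<close>.
\<close>

lemma (in brownian_motion) distr_insert_time:
  assumes st: "0 \<le> s" "s < t" and J: "J \<subseteq> {0..s}" "s \<in> J"
  shows "distr M (PiM (insert t J) (\<lambda>_. borel)) (\<lambda>\<omega>. \<lambda>r\<in>insert t J. B r \<omega>) =
    distr (distr M (PiM J (\<lambda>_. borel)) (\<lambda>\<omega>. \<lambda>r\<in>J. B r \<omega>) \<Otimes>\<^sub>M distr M borel (\<lambda>\<omega>. B t \<omega> - B s \<omega>))
      (PiM (insert t J) (\<lambda>_. borel)) (\<lambda>(f, d). f(t := f s + d))"
proof -
  have X[measurable]: "(\<lambda>\<omega>. \<lambda>r\<in>J. B r \<omega>) \<in> M \<rightarrow>\<^sub>M PiM J (\<lambda>_. borel)"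
    and [measurable]: "(\<lambda>\<omega>. B t \<omega> - B s \<omega>) \<in> borel_measurable M"
    by (rule measurable_past[OF st J(1)], rule measurable_increment[OF st J(1)])
  have comp: "(\<lambda>x. fst x s) \<in> borel_measurable (PiM J (\<lambda>_. borel) \<Otimes>\<^sub>M (borel :: (real^'n) measure))"
    using measurable_compose[OF measurable_fst measurable_component_singleton[OF J(2)]] .
  have h: "(\<lambda>(f, d). f(t := f s + d)) \<in> PiM J (\<lambda>_. borel) \<Otimes>\<^sub>M borel \<rightarrow>\<^sub>M PiM (insert t J) (\<lambda>_. borel :: (real ^ 'n) measure)"
    unfolding case_prod_unfold
    by (rule measurable_fun_upd[where J = J])
       (auto intro: borel_measurable_add[OF comp measurable_snd])
  show ?thesis
    unfolding distr_past_increment[OF st J(1), symmetric]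
    using st J by (subst distr_distr[OF h]) (auto simp: o_def fun_eq_iff intro!: distr_cong)
qed

text \<open>
  Times are added in increasing order. The time 0 is always included, so that every new time \<open>t\<close> has
  a predecessor \<open>s\<close> from which the increment is taken.
\<close>

lemma brownian_finite_dim_law_unique:
  fixes B :: "real \<Rightarrow> 'a \<Rightarrow> real ^ 'n::finite" and C :: "real \<Rightarrow> 'b \<Rightarrow> real ^ 'n"
  assumes "brownian_motion M F B" "brownian_motion N G C"
    and "finite J" "J \<subseteq> {0<..}"
  shows "distr M (PiM (insert 0 J) (\<lambda>_. borel)) (\<lambda>\<omega>. \<lambda>r\<in>insert 0 J. B r \<omega>) =
    distr N (PiM (insert 0 J) (\<lambda>_. borel)) (\<lambda>\<omega>. \<lambda>r\<in>insert 0 J. C r \<omega>)"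
  using assms(3,4)
proof (induction J rule: finite_linorder_max_induct)
  case empty
  have start: "distr M (PiM {0} (\<lambda>_. borel)) (\<lambda>\<omega>. \<lambda>r\<in>{0}. B r \<omega>) =
      return (PiM {0} (\<lambda>_. borel)) (\<lambda>r\<in>{0}. 0 :: real ^ 'n)"
    if "brownian_motion M F B" for M :: "'c measure" and F B
  proof -
    interpret brownian_motion M F B by fact
    have "distr M (PiM {0} (\<lambda>_. borel)) (\<lambda>\<omega>. \<lambda>r\<in>{0::real}. B r \<omega>) =
        distr M (PiM {0} (\<lambda>_. borel)) (\<lambda>\<omega>. \<lambda>r\<in>{0::real}. 0 :: real ^ 'n)"
    proof (rule distr_cong_AE)
      show "AE \<omega> in M. (\<lambda>r\<in>{0::real}. B r \<omega>) = (\<lambda>r\<in>{0}. 0)"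
        using start by eventually_elim (simp add: restrict_def fun_eq_iff)
      show "(\<lambda>\<omega>. \<lambda>r\<in>{0}. B r \<omega>) \<in> M \<rightarrow>\<^sub>M PiM {0} (\<lambda>_. borel)"
        by (rule measurable_restrict) (auto intro: random_variable_B)
      show "(\<lambda>\<omega>. \<lambda>r\<in>{0}. 0) \<in> M \<rightarrow>\<^sub>M PiM {0} (\<lambda>_. borel)"
        by (rule measurable_restrict) auto
    qed auto
    also have "\<dots> = return (PiM {0} (\<lambda>_. borel)) (\<lambda>r\<in>{0}. 0 :: real ^ 'n)"
      by (rule distr_const) (simp add: space_PiM)
    finally show ?thesis .
  qed
  show ?case by (simp only: start[OF assms(1)] start[OF assms(2)])
next
  case (insert t J)
  interpret B: brownian_motion M F B by fact
  interpret C: brownian_motion N G C by fact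
  define s where "s = Max (insert 0 J)"
  have s: "s \<in> insert 0 J" "insert 0 J \<subseteq> {0..s}" "0 \<le> s" "s < t"
  proof -
    show "s \<in> insert 0 J" unfolding s_def using insert(1) by (intro Max_in) auto
    then show "0 \<le> s" "s < t" using insert(2,4) by auto
    show "insert 0 J \<subseteq> {0..s}"
      using insert(1,4) unfolding s_def by (auto simp: less_imp_le)
  qed
  have "distr M borel (\<lambda>\<omega>. B t \<omega> - B s \<omega>) = distr N borel (\<lambda>\<omega>. C t \<omega> - C s \<omega>)"
    using B.increment_distr[OF s(3,4)] C.increment_distr[OF s(3,4)] by simp
  moreover have "J \<subseteq> {0<..}" using insert(4) by simp
  ultimately show ?case
    unfolding insert_commute[of 0 t J]
    by (simp only: B.distr_insert_time[OF s(3,4,2,1)] C.distr_insert_time[OF s(3,4,2,1)] insert.IH)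
qed

lemma brownian_law_unique:
  fixes B :: "real \<Rightarrow> 'a \<Rightarrow> real ^ 'n::finite" and C :: "real \<Rightarrow> 'b \<Rightarrow> real ^ 'n"
  assumes BM: "brownian_motion M F B" "brownian_motion N G C" and I: "I \<subseteq> {0..}"
  shows "distr M (PiM I (\<lambda>_. borel)) (\<lambda>\<omega>. \<lambda>r\<in>I. B r \<omega>) = distr N (PiM I (\<lambda>_. borel)) (\<lambda>\<omega>. \<lambda>r\<in>I. C r \<omega>)"
proof -
  interpret B: brownian_motion M F B by fact
  interpret C: brownian_motion N G C by fact
  have mB: "(\<lambda>\<omega>. \<lambda>r\<in>I. B r \<omega>) \<in> M \<rightarrow>\<^sub>M PiM I (\<lambda>_. borel)"
    using I by (intro measurable_restrict B.random_variable_B) auto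
  have mC: "(\<lambda>\<omega>. \<lambda>r\<in>I. C r \<omega>) \<in> N \<rightarrow>\<^sub>M PiM I (\<lambda>_. borel)"
    using I by (intro measurable_restrict C.random_variable_B) auto
  show ?thesis
  proof (rule measure_eqI_PiM_infinite)
  show "finite_measure (distr M (PiM I (\<lambda>_. borel)) (\<lambda>\<omega>. \<lambda>r\<in>I. B r \<omega>))"
    using B.prob_space_distr[OF mB] by (simp add: prob_space_def)
  fix A and J :: "real set"
  assume J: "finite J" "J \<subseteq> I" and A: "\<And>i. i \<in> J \<Longrightarrow> A i \<in> sets (borel :: (real ^ 'n) measure)"
  define K where "K = insert 0 J"
  have K: "K = insert 0 (J - {0})" "finite (J - {0})" "J - {0} \<subseteq> {0<..}" "K \<subseteq> {0..}" "finite K"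
    using J I unfolding K_def by force+
  define Z where "Z = prod_emb K (\<lambda>_. borel :: (real ^ 'n) measure) J (Pi\<^sub>E J A)"
  have Z: "Z \<in> sets (PiM K (\<lambda>_. borel))"
    unfolding Z_def using J A by (intro sets_PiM_I) (auto simp: K_def)
  have cyl: "emeasure (distr M (PiM I (\<lambda>_. borel)) (\<lambda>\<omega>. \<lambda>r\<in>I. B r \<omega>)) (prod_emb I (\<lambda>_. borel) J (Pi\<^sub>E J A)) =
      emeasure (distr M (PiM K (\<lambda>_. borel)) (\<lambda>\<omega>. \<lambda>r\<in>K. B r \<omega>)) Z"
    if "brownian_motion M F B" for M :: "'c measure" and F B
  proof -
    interpret brownian_motion M F B by fact
    have mI: "(\<lambda>\<omega>. \<lambda>r\<in>I. B r \<omega>) \<in> M \<rightarrow>\<^sub>M PiM I (\<lambda>_. borel)"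
      using I by (intro measurable_restrict random_variable_B) auto
    have mK: "(\<lambda>\<omega>. \<lambda>r\<in>K. B r \<omega>) \<in> M \<rightarrow>\<^sub>M PiM K (\<lambda>_. borel)"
      using K by (intro measurable_restrict random_variable_B) auto
    have "prod_emb I (\<lambda>_. borel) J (Pi\<^sub>E J A) \<in> sets (PiM I (\<lambda>_. borel))"
      using J A by (intro sets_PiM_I) auto
    moreover have "(\<lambda>\<omega>. \<lambda>r\<in>I. B r \<omega>) -` prod_emb I (\<lambda>_. borel) J (Pi\<^sub>E J A) \<inter> space M =
        (\<lambda>\<omega>. \<lambda>r\<in>K. B r \<omega>) -` Z \<inter> space M"
      using J(2) by (auto simp: prod_emb_def Z_def space_PiM PiE_iff K_def subset_iff)
    ultimately show ?thesis using mI mK Z by (simp add: emeasure_distr)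
  qed
  show "emeasure (distr M (PiM I (\<lambda>_. borel)) (\<lambda>\<omega>. \<lambda>r\<in>I. B r \<omega>)) (prod_emb I (\<lambda>_. borel) J (Pi\<^sub>E J A)) =
    emeasure (distr N (PiM I (\<lambda>_. borel)) (\<lambda>\<omega>. \<lambda>r\<in>I. C r \<omega>)) (prod_emb I (\<lambda>_. borel) J (Pi\<^sub>E J A))"
    unfolding cyl[OF BM(1)] cyl[OF BM(2)] K(1)
    using brownian_finite_dim_law_unique[OF BM K(2,3)] by simp
qed simp_all
qed

text \<open>
  Dividing an increment of variance \<open>e * (t - s)\<close> by \<open>sqrt e\<close> gives variance \<open>t - s\<close>.
\<close>

lemma (in brownian_motion) brownian_scaling:
  assumes e: "e > 0"
  shows "brownian_motion M (\<lambda>t. F (e * t)) (\<lambda>t \<omega>. (1 / sqrt e) *\<^sub>R B (e * t) \<omega>)"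
proof
  have e0: "0 \<le> e * t" if "0 \<le> t" for t using e that by simp
  have lt: "e * s < e * t" if "s < t" for s t using e that by simp
  show "space (F (e * i)) = space M" for i by (rule space_F)
  show "i \<le> j \<Longrightarrow> sets (F (e * i)) \<subseteq> sets (F (e * j))" for i j
    using e by (intro sets_F_mono) simp
  show "0 \<le> t \<Longrightarrow> subalgebra M (F (e * t))" for t using e0 by (rule subalgebra)
  show "0 \<le> t \<Longrightarrow> (\<lambda>\<omega>. (1 / sqrt e) *\<^sub>R B (e * t) \<omega>) \<in> borel_measurable (F (e * t))" for t
    using adapted[OF e0] by simp
  show "continuous_on {0..} (\<lambda>t. (1 / sqrt e) *\<^sub>R B (e * t) \<omega>)" if "\<omega> \<in> space M" for \<omega>
    by (intro continuous_intros continuous_on_compose2[OF continuous[OF that]]) (use e0 in auto)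
  show "AE \<omega> in M. (1 / sqrt e) *\<^sub>R B (e * 0) \<omega> = 0" using start by simp
  fix s t :: real assume s: "0 \<le> s" "s < t"
  have scale: "(1 / sqrt e) *\<^sub>R B (e * t) \<omega> - (1 / sqrt e) *\<^sub>R B (e * s) \<omega> =
      (1 / sqrt e) *\<^sub>R (B (e * t) \<omega> - B (e * s) \<omega>)" for \<omega>
    by (simp add: scaleR_diff_right)
  have "{(\<lambda>\<omega>. (1 / sqrt e) *\<^sub>R (B (e * t) \<omega> - B (e * s) \<omega>)) -` S \<inter> space M | S. S \<in> sets borel} \<subseteq>
      {(\<lambda>\<omega>. B (e * t) \<omega> - B (e * s) \<omega>) -` S \<inter> space M | S. S \<in> sets borel}"
  proof safe
    fix S :: "(real ^ 'n) set" assume "S \<in> sets borel"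
    then have "(\<lambda>v. (1 / sqrt e) *\<^sub>R v) -` S \<in> sets borel"
      using measurable_sets_borel[of "\<lambda>v::real^'n. (1 / sqrt e) *\<^sub>R v" borel S] by simp
    then show "\<exists>S'. (\<lambda>\<omega>. (1 / sqrt e) *\<^sub>R (B (e * t) \<omega> - B (e * s) \<omega>)) -` S \<inter> space M =
        (\<lambda>\<omega>. B (e * t) \<omega> - B (e * s) \<omega>) -` S' \<inter> space M \<and> S' \<in> sets borel"
      by (intro exI[of _ "(\<lambda>v. (1 / sqrt e) *\<^sub>R v) -` S"]) auto
  qed
  then show "indep_set (sets (F (e * s)))
      {(\<lambda>\<omega>. (1 / sqrt e) *\<^sub>R B (e * t) \<omega> - (1 / sqrt e) *\<^sub>R B (e * s) \<omega>) -` S \<inter> space M | S. S \<in> sets borel}"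
    using increment_indep_past[OF e0[OF s(1)] lt[OF s(2)]] unfolding scale indep_set_def
    by (elim indep_sets_mono_sets) (auto split: bool.splits)
  show "indep_vars (\<lambda>_. borel)
      (\<lambda>i \<omega>. ((1 / sqrt e) *\<^sub>R B (e * t) \<omega> - (1 / sqrt e) *\<^sub>R B (e * s) \<omega>) $ i) UNIV"
    using indep_vars_compose2[OF increment_indep_coords[OF e0[OF s(1)] lt[OF s(2)]],
        of "\<lambda>_ x. (1 / sqrt e) * x" "\<lambda>_. borel"]
    unfolding scale by simp
  show "distributed M lborel
      (\<lambda>\<omega>. ((1 / sqrt e) *\<^sub>R B (e * t) \<omega> - (1 / sqrt e) *\<^sub>R B (e * s) \<omega>) $ i)
      (normal_density 0 (sqrt (t - s)))" for i
  proof -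
    have "distributed M lborel (\<lambda>\<omega>. 0 + (1 / sqrt e) * ((B (e * t) \<omega> - B (e * s) \<omega>) $ i))
        (normal_density (0 + (1 / sqrt e) * 0) (\<bar>1 / sqrt e\<bar> * sqrt (e * t - e * s)))"
      by (rule normal_density_affine[OF increment_normal[OF e0[OF s(1)] lt[OF s(2)]]])
         (use e s in auto)
    moreover have "\<bar>1 / sqrt e\<bar> * sqrt (e * t - e * s) = sqrt (t - s)"
      using e by (simp add: right_diff_distrib[symmetric] real_sqrt_mult)
    ultimately show ?thesis unfolding scale by simp
  qed
qed

section \<open>Convergence in law from a coupling with processes of a fixed law\<close>

context compatible_metric
begin

lemma continuous_map_evaluation:
  assumes t: "t \<in> {0..1}"
  shows "continuous_map (mtopology_of (path_space m)) state_topology (\<lambda>f. f t)"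
proof -
  have "uniformly_continuous_map (path_space m) m (\<lambda>f. f t)"
    unfolding uniformly_continuous_map_def
  proof (intro conjI allI impI)
    fix r :: real assume r: "r > 0"
    have "mdist m (g t) (f t) < r"
      if "f \<in> mspace (path_space m)" "g \<in> mspace (path_space m)" "mdist (path_space m) g f < r" for f g
      using mdist_path_space_le[OF that(2,1), of "mdist (path_space m) g f"] that(3) t by fastforce
    then show "\<exists>d>0. \<forall>f\<in>mspace (path_space m). \<forall>g\<in>mspace (path_space m).
        mdist (path_space m) g f < d \<longrightarrow> mdist m (g t) (f t) < r"
      using r by blast
  qed simp
  then show ?thesis
    using uniformly_continuous_imp_continuous_map[of "path_space m" m] by (simp add: compatible)
qed

definition bounded_paths :: "real \<Rightarrow> (real \<Rightarrow> (real ^ 'n) option) set" where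
  "bounded_paths K = {f \<in> mspace (path_space m). \<forall>t\<in>{0..1}. f t \<in> Some ` cball 0 K}"

lemma closedin_bounded_paths: "closedin (mtopology_of (path_space m)) (bounded_paths K)"
proof -
  have "closedin (mtopology_of (path_space m)) {f \<in> mspace (path_space m). f t \<in> Some ` cball 0 K}"
    if "t \<in> {0..1}" for t
    using closedin_continuous_map_preimage[OF continuous_map_evaluation[OF that], of "Some ` cball 0 K"]
    by (simp add: compact_imp_closed)
  then have "closedin (mtopology_of (path_space m))
      (\<Inter>t\<in>{0..1}. {f \<in> mspace (path_space m). f t \<in> Some ` cball 0 K})"
    by (intro closedin_INT) auto
  moreover have "(\<Inter>t\<in>{0..1}. {f \<in> mspace (path_space m). f t \<in> Some ` cball 0 K}) = bounded_paths K"
    by (force simp: bounded_paths_def)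
  ultimately show ?thesis by simp
qed

lemma nonexploding_path_bounded:
  assumes f: "f \<in> mspace (path_space m)" and "\<And>t. t \<in> {0..1} \<Longrightarrow> f t \<noteq> None"
  obtains K where "f \<in> bounded_paths K"
proof -
  have "continuous_on {0..1} (\<lambda>t. the (f t))"
    using f assms(2) by (intro continuous_on_the_state) (auto simp: mem_path_space)
  then have "bounded ((\<lambda>t. the (f t)) ` {0..1})"
    by (intro compact_imp_bounded compact_continuous_image) auto
  then obtain K where K: "\<And>t. t \<in> {0..1} \<Longrightarrow> norm (the (f t)) \<le> K"
    unfolding bounded_iff by blast
  have "f t \<in> Some ` cball 0 K" if "t \<in> {0..1}" for t
    using K[OF that] assms(2)[OF that] by (cases "f t") auto
  then have "f \<in> bounded_paths K" using f by (simp add: bounded_paths_def)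
  then show ?thesis by (rule that)
qed

text \<open>
  The paths at which the oscillation of \<open>\<phi>\<close> on scale \<open>\<delta>\<close> is at most \<open>\<eta>\<close>. Testing the strict
  inequality \<open>mdist (path_space m) g f < \<delta>\<close> makes this a closed set: if a path \<open>g\<close> violates the
  condition for \<open>f\<close>, the same \<open>g\<close> violates it for all paths near \<open>f\<close>.
\<close>

definition stable_paths :: "((real \<Rightarrow> (real ^ 'n) option) \<Rightarrow> real) \<Rightarrow> real \<Rightarrow> real \<Rightarrow> (real \<Rightarrow> (real ^ 'n) option) set" where
  "stable_paths \<phi> \<eta> \<delta> = {f \<in> mspace (path_space m).
     \<forall>g\<in>mspace (path_space m). mdist (path_space m) g f < \<delta> \<longrightarrow> \<bar>\<phi> g - \<phi> f\<bar> \<le> \<eta>}"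

lemma closedin_stable_paths:
  assumes \<phi>: "continuous_map (mtopology_of (path_space m)) euclideanreal \<phi>"
  shows "closedin (mtopology_of (path_space m)) (stable_paths \<phi> \<eta> \<delta>)"
proof -
  let ?X = "mspace (path_space m)"
  have "openin (mtopology_of (path_space m)) (mball_of (path_space m) g \<delta> \<inter> {f \<in> ?X. \<bar>\<phi> g - \<phi> f\<bar> > \<eta>})" for g
  proof (rule openin_Int)
    show "openin (mtopology_of (path_space m)) (mball_of (path_space m) g \<delta>)"
      unfolding mtopology_of_def mball_of_def by (intro Metric_space.openin_mball) simp
    have "continuous_map (mtopology_of (path_space m)) euclideanreal (\<lambda>f. \<bar>\<phi> g - \<phi> f\<bar>)"
      by (intro continuous_intros \<phi>)
    from openin_continuous_map_preimage[OF this, of "{\<eta><..}"]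
    show "openin (mtopology_of (path_space m)) {f \<in> ?X. \<bar>\<phi> g - \<phi> f\<bar> > \<eta>}" by simp
  qed
  then have "openin (mtopology_of (path_space m))
      (\<Union>g\<in>?X. mball_of (path_space m) g \<delta> \<inter> {f \<in> ?X. \<bar>\<phi> g - \<phi> f\<bar> > \<eta>})"
    by blast
  moreover have "(\<Union>g\<in>?X. mball_of (path_space m) g \<delta> \<inter> {f \<in> ?X. \<bar>\<phi> g - \<phi> f\<bar> > \<eta>}) =
      ?X - stable_paths \<phi> \<eta> \<delta>"
    by (auto simp: stable_paths_def not_le)
  ultimately show ?thesis
    by (simp add: closedin_def stable_paths_def subset_iff)
qed

lemma continuous_imp_stable:
  assumes \<phi>: "continuous_map (mtopology_of (path_space m)) euclideanreal \<phi>"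
    and f: "f \<in> mspace (path_space m)" and \<eta>: "\<eta> > 0"
  obtains \<delta> where "\<delta> > 0" "f \<in> stable_paths \<phi> \<eta> \<delta>"
proof -
  have "openin (mtopology_of (path_space m)) {g \<in> mspace (path_space m). \<phi> g \<in> ball (\<phi> f) \<eta>}"
    using openin_continuous_map_preimage[OF \<phi>, of "ball (\<phi> f) \<eta>"] by simp
  moreover have "f \<in> {g \<in> mspace (path_space m). \<phi> g \<in> ball (\<phi> f) \<eta>}" using f \<eta> by simp
  ultimately obtain \<delta> where \<delta>: "\<delta> > 0"
    "mball_of (path_space m) f \<delta> \<subseteq> {g \<in> mspace (path_space m). \<phi> g \<in> ball (\<phi> f) \<eta>}"
    unfolding mtopology_of_def mball_of_def Metric_space.openin_mtopology[OF Metric_space_mspace_mdist]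
    by blast
  have "\<bar>\<phi> g - \<phi> f\<bar> \<le> \<eta>" if "g \<in> mspace (path_space m)" "mdist (path_space m) g f < \<delta>" for g
  proof -
    have "g \<in> mball_of (path_space m) f \<delta>" using that f by (simp add: mdist_commute)
    then have "\<phi> g \<in> ball (\<phi> f) \<eta>" using \<delta>(2) by blast
    then show ?thesis by (simp add: dist_real_def abs_minus_commute)
  qed
  then have "f \<in> stable_paths \<phi> \<eta> \<delta>" using f by (simp add: stable_paths_def)
  then show ?thesis by (rule that[OF \<delta>(1)])
qed

text \<open>
  Each nonexploding path is bounded, and \<open>\<phi>\<close> is continuous at it; so the sets
  \<open>bounded_paths k \<inter> stable_paths \<phi> \<eta> (1 / Suc k)\<close> increase to a set of full measure.
\<close>

lemma exists_good_paths:
  assumes N: "prob_space N" "sets N = sets path_borel"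
    and fin: "AE f in N. \<forall>t\<in>{0..1}. f t \<noteq> None"
    and \<phi>: "continuous_map (mtopology_of (path_space m)) euclideanreal \<phi>" and \<eta>: "\<eta> > 0" and r: "r < 1"
  obtains K \<delta> where "\<delta> > 0" "measure N (bounded_paths K \<inter> stable_paths \<phi> \<eta> \<delta>) > r"
proof -
  interpret N: prob_space N by fact
  have spN: "space N = mspace (path_space m)" using sets_eq_imp_space_eq[OF N(2)] by simp
  define E where "E k = bounded_paths (real k) \<inter> stable_paths \<phi> \<eta> (1 / real (Suc k))" for k
  have E: "E k \<in> sets N" for k
    unfolding E_def N(2) using closedin_bounded_paths closedin_stable_paths[OF \<phi>]
    by (intro sets.Int closedin_in_borel_of)
  have bmono: "bounded_paths K \<subseteq> bounded_paths K'" if "K \<le> K'" for K K'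
    using that by (force simp: bounded_paths_def)
  have smono: "stable_paths \<phi> \<eta> \<delta> \<subseteq> stable_paths \<phi> \<eta> \<delta>'" if "\<delta>' \<le> \<delta>" for \<delta> \<delta>'
    using that by (auto simp: stable_paths_def)
  have "incseq E"
  proof (rule incseq_SucI)
    fix k
    have "1 / real (Suc (Suc k)) \<le> 1 / real (Suc k)" by (simp add: field_simps)
    then show "E k \<subseteq> E (Suc k)"
      unfolding E_def using bmono[of "real k" "real (Suc k)"] smono by fastforce
  qed
  then have "(\<lambda>k. measure N (E k)) \<longlonglongrightarrow> measure N (\<Union>k. E k)"
    using E by (intro N.finite_Lim_measure_incseq) auto
  moreover have "measure N (\<Union>k. E k) = 1"
  proof -
    have "AE f in N. f \<in> (\<Union>k. E k)"
      using fin AE_space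
    proof eventually_elim
      case (elim f)
      then have f: "f \<in> mspace (path_space m)" "\<And>t. t \<in> {0..1} \<Longrightarrow> f t \<noteq> None"
        using spN by auto
      obtain K where K: "f \<in> bounded_paths K" using nonexploding_path_bounded[OF f] .
      obtain \<delta> where \<delta>: "\<delta> > 0" "f \<in> stable_paths \<phi> \<eta> \<delta>"
        using continuous_imp_stable[OF \<phi> f(1) \<eta>] .
      obtain k1 :: nat where k1: "K \<le> real k1" using real_arch_simple by blast
      obtain k2 where k2: "inverse (real (Suc k2)) < \<delta>" using reals_Archimedean[OF \<delta>(1)] by blast
      define k where "k = max k1 k2"
      have "1 / real (Suc k) \<le> inverse (real (Suc k2))"
        unfolding k_def by (simp add: field_simps)
      then have "1 / real (Suc k) \<le> \<delta>" using k2 by linarith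
      moreover have "K \<le> real k" using k1 by (simp add: k_def)
      ultimately have "f \<in> E k" unfolding E_def using K \<delta>(2) bmono smono by blast
      then show ?case by blast
    qed
    moreover have "(\<Union>k. E k) \<in> sets N" using E by auto
    ultimately show ?thesis by (simp add: N.prob_eq_1)
  qed
  ultimately have "\<forall>\<^sub>F k in sequentially. measure N (E k) > r"
    using r by (intro order_tendstoD(1)[of _ 1]) auto
  then obtain k where "measure N (E k) > r" by (auto simp: eventually_sequentially)
  then show ?thesis using that[of "1 / real (Suc k)" "real k"] by (simp add: E_def)
qed

text \<open>
  The law of \<open>Z \<epsilon>\<close> is that of \<open>Y\<close> for all \<open>\<epsilon>\<close>, so one set of paths as in \<open>exists_good_paths\<close> serves
  for all \<open>\<epsilon>\<close>. If \<open>Z \<epsilon>\<close> is in this set and \<open>\<epsilon>\<close> is small, then \<open>X \<epsilon>\<close> is so close to \<open>Z \<epsilon>\<close> that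
  the values of the test function differ by at most \<open>\<eta>\<close>; outside it the difference is at most twice
  the bound of the test function.
\<close>

lemma convergence_in_law_by_coupling:
  assumes "prob_space M"
    and X: "\<forall>\<^sub>F \<epsilon> in G. X \<epsilon> \<in> M \<rightarrow>\<^sub>M path_borel"
    and Z: "\<forall>\<^sub>F \<epsilon> in G. Z \<epsilon> \<in> M \<rightarrow>\<^sub>M path_borel"
    and Y: "Y \<in> M \<rightarrow>\<^sub>M path_borel"
    and law: "\<forall>\<^sub>F \<epsilon> in G. distr M path_borel (Z \<epsilon>) = distr M path_borel Y"
    and fin: "AE \<omega> in M. \<forall>t\<in>{0..1}. Y \<omega> t \<noteq> None"
    and close: "\<And>K \<delta>. \<delta> > 0 \<Longrightarrow> \<forall>\<^sub>F \<epsilon> in G. AE \<omega> in M. Z \<epsilon> \<omega> \<in> bounded_paths K \<longrightarrow>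
      (\<forall>t\<in>{0..1}. mdist m (X \<epsilon> \<omega> t) (Z \<epsilon> \<omega> t) \<le> \<delta>)"
  shows "converges_in_law M (mtopology_of (path_space m)) X G Y"
  unfolding converges_in_law_def
proof (intro conjI allI impI X Y)
  interpret prob_space M by fact
  fix \<phi> assume "continuous_map (mtopology_of (path_space m)) euclideanreal \<phi> \<and>
    bounded (\<phi> ` topspace (mtopology_of (path_space m)))"
  then have \<phi>: "continuous_map (mtopology_of (path_space m)) euclideanreal \<phi>"
    and "bounded (\<phi> ` mspace (path_space m))" by auto
  then obtain C where C: "C > 0" "\<And>f. f \<in> mspace (path_space m) \<Longrightarrow> \<bar>\<phi> f\<bar> \<le> C"
    by (auto simp: bounded_pos)
  have \<phi>m: "\<phi> \<in> borel_measurable path_borel"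
    using continuous_map_borel_of[OF \<phi>] by (simp add: borel_of_euclidean)
  have int: "integrable M (\<lambda>\<omega>. \<phi> (W \<omega>))" if W: "W \<in> M \<rightarrow>\<^sub>M path_borel" for W
  proof (rule integrable_const_bound[of _ C])
    show "AE \<omega> in M. norm (\<phi> (W \<omega>)) \<le> C"
      using measurable_space[OF W] C by (intro AE_I2) auto
    show "(\<lambda>\<omega>. \<phi> (W \<omega>)) \<in> borel_measurable M" using measurable_compose[OF W \<phi>m] .
  qed
  define N where "N = distr M path_borel Y"
  have N: "prob_space N" "sets N = sets path_borel"
    unfolding N_def using Y by (auto intro: prob_space_distr)
  have finN: "AE f in N. \<forall>t\<in>{0..1}. f t \<noteq> None"
  proof -
    have "closedin (mtopology_of (path_space m)) (bounded_paths K)" for K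
      by (rule closedin_bounded_paths)
    then have "bounded_paths K \<in> sets path_borel" for K by (rule closedin_in_borel_of)
    then have S: "(\<Union>k. bounded_paths (real k)) \<in> sets path_borel" by auto
    have eq: "(\<Union>k. bounded_paths (real k)) = {f \<in> mspace (path_space m). \<forall>t\<in>{0..1}. f t \<noteq> None}"
    proof (intro equalityI subsetI)
      fix f assume "f \<in> {f \<in> mspace (path_space m). \<forall>t\<in>{0..1}. f t \<noteq> None}"
      then obtain K where K: "f \<in> bounded_paths K" using nonexploding_path_bounded[of f] by auto
      obtain k :: nat where "K \<le> real k" using real_arch_simple by blast
      then have "f \<in> bounded_paths (real k)" using K by (force simp: bounded_paths_def)
      then show "f \<in> (\<Union>k. bounded_paths (real k))" by blast
    qed (force simp: bounded_paths_def)
    show ?thesis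
      unfolding N_def using fin Y S[unfolded eq] by (subst AE_distr_iff) auto
  qed
  show "((\<lambda>\<epsilon>. \<integral>\<omega>. \<phi> (X \<epsilon> \<omega>) \<partial>M) \<longlongrightarrow> (\<integral>\<omega>. \<phi> (Y \<omega>) \<partial>M)) G"
  proof (rule tendstoI)
    fix e :: real assume e: "e > 0"
    \<comment> \<open>The good and the bad event contribute at most \<open>\<eta>\<close> each.\<close>
    define \<eta> where "\<eta> = e / 4"
    have \<eta>: "\<eta> > 0" using e by (simp add: \<eta>_def)
    have "1 - \<eta> / (2 * C) < 1" using \<eta> C by simp
    then obtain K \<delta> where \<delta>: "\<delta> > 0"
      and big: "measure N (bounded_paths K \<inter> stable_paths \<phi> \<eta> \<delta>) > 1 - \<eta> / (2 * C)"
      using exists_good_paths[OF N finN \<phi> \<eta>] by metis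
    define E where "E = bounded_paths K \<inter> stable_paths \<phi> \<eta> \<delta>"
    have E: "E \<in> sets path_borel"
      unfolding E_def using closedin_bounded_paths closedin_stable_paths[OF \<phi>]
      by (intro sets.Int closedin_in_borel_of)
    have "\<delta> / 2 > 0" using \<delta> by simp
    from close[OF this, of K] X Z law
    show "\<forall>\<^sub>F \<epsilon> in G. dist (\<integral>\<omega>. \<phi> (X \<epsilon> \<omega>) \<partial>M) (\<integral>\<omega>. \<phi> (Y \<omega>) \<partial>M) < e"
    proof eventually_elim
      case (elim \<epsilon>)
      note near = elim(1) and XM = elim(2) and ZM = elim(3) and lawZ = elim(4)
      have "(\<integral>\<omega>. \<phi> (Y \<omega>) \<partial>M) = (\<integral>f. \<phi> f \<partial>distr M path_borel Y)"
        using Y \<phi>m by (simp add: integral_distr)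
      also have "\<dots> = (\<integral>\<omega>. \<phi> (Z \<epsilon> \<omega>) \<partial>M)"
        using ZM \<phi>m unfolding lawZ[symmetric] by (simp add: integral_distr)
      finally have YZ: "(\<integral>\<omega>. \<phi> (Y \<omega>) \<partial>M) = (\<integral>\<omega>. \<phi> (Z \<epsilon> \<omega>) \<partial>M)" .
      define Bad where "Bad = space M - (Z \<epsilon> -` E \<inter> space M)"
      have good: "Z \<epsilon> -` E \<inter> space M \<in> sets M" using measurable_sets[OF ZM E] .
      have "measure N E = measure M (Z \<epsilon> -` E \<inter> space M)"
        unfolding N_def lawZ[symmetric] using ZM E by (rule measure_distr)
      then have bad: "measure M Bad < \<eta> / (2 * C)"
        using big prob_compl[OF good] unfolding Bad_def E_def[symmetric] by linarith
      have Bad: "Bad \<in> sets M" unfolding Bad_def using good by auto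
      have "\<bar>(\<integral>\<omega>. \<phi> (X \<epsilon> \<omega>) \<partial>M) - (\<integral>\<omega>. \<phi> (Z \<epsilon> \<omega>) \<partial>M)\<bar> = \<bar>\<integral>\<omega>. \<phi> (X \<epsilon> \<omega>) - \<phi> (Z \<epsilon> \<omega>) \<partial>M\<bar>"
        using int[OF XM] int[OF ZM] by simp
      also have "\<dots> \<le> (\<integral>\<omega>. \<bar>\<phi> (X \<epsilon> \<omega>) - \<phi> (Z \<epsilon> \<omega>)\<bar> \<partial>M)" by (rule integral_abs_bound)
      also have "\<dots> \<le> (\<integral>\<omega>. \<eta> + 2 * C * indicator Bad \<omega> \<partial>M)"
      proof (rule integral_mono_AE)
        show "integrable M (\<lambda>\<omega>. \<bar>\<phi> (X \<epsilon> \<omega>) - \<phi> (Z \<epsilon> \<omega>)\<bar>)"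
          using int[OF XM] int[OF ZM] by simp
        show "integrable M (\<lambda>\<omega>. \<eta> + 2 * C * indicator Bad \<omega>)"
          using Bad by (intro Bochner_Integration.integrable_add integrable_const
              Bochner_Integration.integrable_mult_right integrable_real_indicator)
            (auto simp: emeasure_eq_measure)
        show "AE \<omega> in M. \<bar>\<phi> (X \<epsilon> \<omega>) - \<phi> (Z \<epsilon> \<omega>)\<bar> \<le> \<eta> + 2 * C * indicator Bad \<omega>"
          using near AE_space
        proof eventually_elim
          case (elim \<omega>)
          have x: "X \<epsilon> \<omega> \<in> mspace (path_space m)" and z: "Z \<epsilon> \<omega> \<in> mspace (path_space m)"
            using measurable_space[OF XM elim(2)] measurable_space[OF ZM elim(2)] by auto
          show ?case
          proof (cases "\<omega> \<in> Bad")
            case True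
            then show ?thesis using C(2)[OF x] C(2)[OF z] \<eta> by simp
          next
            case False
            then have zE: "Z \<epsilon> \<omega> \<in> bounded_paths K" "Z \<epsilon> \<omega> \<in> stable_paths \<phi> \<eta> \<delta>"
              using elim(2) by (auto simp: Bad_def E_def)
            have "mdist (path_space m) (X \<epsilon> \<omega>) (Z \<epsilon> \<omega>) \<le> \<delta> / 2"
              using elim(1) zE(1) unfolding mdist_path_space_le[OF x z] by blast
            then have "mdist (path_space m) (X \<epsilon> \<omega>) (Z \<epsilon> \<omega>) < \<delta>" using \<delta> by linarith
            then have "\<bar>\<phi> (X \<epsilon> \<omega>) - \<phi> (Z \<epsilon> \<omega>)\<bar> \<le> \<eta>"
              using zE(2) x by (simp add: stable_paths_def)
            then show ?thesis using False by simp
          qed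
        qed
      qed
      also have "\<dots> = \<eta> + 2 * C * measure M Bad"
      proof -
        have "integrable M (\<lambda>\<omega>. indicat_real Bad \<omega>)"
          using Bad by (intro integrable_real_indicator) (auto simp: emeasure_eq_measure)
        then have "integrable M (\<lambda>\<omega>. 2 * C * indicat_real Bad \<omega>)"
          by (rule Bochner_Integration.integrable_mult_right)
        from Bochner_Integration.integral_add[OF integrable_const[of \<eta>] this]
        have "(\<integral>\<omega>. \<eta> + 2 * C * indicat_real Bad \<omega> \<partial>M) =
            (\<integral>\<omega>. \<eta> \<partial>M) + (\<integral>\<omega>. 2 * C * indicat_real Bad \<omega> \<partial>M)" .
        moreover have "(\<integral>\<omega>. 2 * C * indicat_real Bad \<omega> \<partial>M) = 2 * C * measure M Bad"
          using Bad by (simp add: sets.Int_space_eq2)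
        moreover have "(\<integral>\<omega>. \<eta> \<partial>M) = \<eta>" by (simp add: prob_space)
        ultimately show ?thesis by (simp only:)
      qed
      also have "\<dots> < \<eta> + 2 * C * (\<eta> / (2 * C))"
        using bad C(1) by (intro add_strict_left_mono mult_strict_left_mono) auto
      also have "\<dots> < e" using C e by (simp add: \<eta>_def)
      finally show ?case unfolding YZ dist_real_def .
    qed
  qed
qed

end

section \<open>The dominant and the rescaled equation\<close>

definition noise :: "real ^ 'n::finite \<Rightarrow> (real \<Rightarrow> real ^ 'n) \<Rightarrow> real \<Rightarrow> real ^ 'n" where
  "noise \<sigma> w t = (\<chi> i. \<sigma> $ i * w t $ i)"

text \<open>
  The solution of the dominant equation as a functional of the driving path \<open>w\<close>.
\<close>

definition dominant_path ::
  "real ^ 'n \<Rightarrow> ('n::finite \<Rightarrow> 'n rpoly) \<Rightarrow> (real \<Rightarrow> real ^ 'n) \<Rightarrow> real \<Rightarrow> real ^ 'n" where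
  "dominant_path \<sigma> P w = picard (poly_field (dominant \<sigma> P)) (prop_dim \<sigma> P) (noise \<sigma> w)"

lemma continuous_on_noise: "continuous_on S w \<Longrightarrow> continuous_on S (noise \<sigma> w)"
  unfolding noise_def[abs_def] by (intro continuous_intros)

lemma continuous_on_dominant_path:
  "continuous_on {0..T} w \<Longrightarrow> continuous_on {0..T} (dominant_path \<sigma> P w)"
  unfolding dominant_path_def
  by (intro continuous_on_picard continuous_poly_field continuous_on_noise)

lemma dominant_path_integral_equation:
  assumes "noise_propagating \<sigma> P" "continuous_on {0..T} w" "t \<in> {0..T}"
  shows "dominant_path \<sigma> P w t =
    integral {0..t} (\<lambda>s. poly_field (dominant \<sigma> P) (dominant_path \<sigma> P w s)) + noise \<sigma> w t"
  unfolding dominant_path_def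
  by (rule picard_dominant_fixed_point[OF assms(1) continuous_poly_field continuous_on_noise[OF assms(2)] assms(3)])

text \<open>
  The functional is nonanticipating.
\<close>

lemma dominant_path_cong:
  assumes "\<And>s. s \<in> {0..t} \<Longrightarrow> w s = w' s" "t \<ge> 0"
  shows "dominant_path \<sigma> P w t = dominant_path \<sigma> P w' t"
  unfolding dominant_path_def using assms by (intro picard_cong) (auto simp: noise_def)

lemma measurable_dominant_path:
  assumes w: "\<And>s. s \<in> {0..t} \<Longrightarrow> (\<lambda>a. w a s) \<in> borel_measurable N" and t: "t \<ge> 0"
  shows "(\<lambda>a. dominant_path \<sigma> P (w a) t) \<in> borel_measurable N"
  unfolding dominant_path_def
proof (rule measurable_picard[OF continuous_poly_field _ t])
  fix s assume "s \<in> {0..t}"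
  then show "(\<lambda>a. noise \<sigma> (w a) s) \<in> borel_measurable N"
    unfolding noise_def
    by (intro measurable_vec_lambda borel_measurable_times borel_measurable_const
        measurable_compose[OF w borel_measurable_nth])
qed

lemma continuous_on_half_line:
  fixes f :: "real \<Rightarrow> 'b::topological_space"
  assumes "\<And>T. continuous_on {0..T} f"
  shows "continuous_on {0..} f"
  unfolding continuous_on_eq_continuous_within
proof
  fix t :: real assume t: "t \<in> {0..}"
  have "continuous (at t within {0..t + 1}) f"
    using assms[of "t + 1"] t by (simp add: continuous_on_eq_continuous_within)
  moreover have "at t within {0..t + 1} = at t within {0..}"
    by (rule at_within_nhd[of t "{..<t + 1}"]) auto
  ultimately show "continuous (at t within {0..}) f" by simp
qed

text \<open>
  Only the initial value requires an exceptional null set: at time 0 the path equals \<open>\<sigma> B\<^sub>0\<close>, which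
  vanishes almost surely. The integral equation holds for every realization.
\<close>

lemma sde_solution_dominant_path:
  fixes B :: "real \<Rightarrow> 'a \<Rightarrow> real ^ 'n::finite"
  assumes BM: "brownian_motion M F B" and np: "noise_propagating \<sigma> P"
  shows "sde_solution M F B (poly_field (dominant \<sigma> P)) \<sigma>
    (\<lambda>t \<omega>. Some (dominant_path \<sigma> P (\<lambda>s. B s \<omega>) t))"
proof -
  interpret brownian_motion M F B by fact
  have cB: "continuous_on {0..T} (\<lambda>s. B s \<omega>)" if "\<omega> \<in> space M" for \<omega> T
    by (rule continuous_on_subset[OF continuous[OF that]]) auto
  have "(\<lambda>\<omega>. Some (dominant_path \<sigma> P (\<lambda>s. B s \<omega>) t)) \<in> F t \<rightarrow>\<^sub>M state_borel" if t: "0 \<le> t" for t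
  proof (rule measurable_compose[OF measurable_dominant_path[OF _ t] measurable_Some_state])
    fix s assume s: "s \<in> {0..t}"
    show "B s \<in> borel_measurable (F t)"
    proof (rule measurable_from_subalg)
      show "subalgebra (F t) (F s)" using sets_F_mono[of s t] s space_F by (simp add: subalgebra_def)
      show "B s \<in> borel_measurable (F s)" using s by (intro adapted) auto
    qed
  qed
  moreover have "continuous_map (top_of_set {0..}) state_topology
      (\<lambda>t. Some (dominant_path \<sigma> P (\<lambda>s. B s \<omega>) t))" if "\<omega> \<in> space M" for \<omega>
  proof -
    have "continuous_on {0..} (dominant_path \<sigma> P (\<lambda>s. B s \<omega>))"
      by (intro continuous_on_half_line continuous_on_dominant_path cB that)
    then have "continuous_map (top_of_set {0..}) euclidean (dominant_path \<sigma> P (\<lambda>s. B s \<omega>))" by simp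
    from continuous_map_compose[OF this continuous_map_Some] show ?thesis by (simp add: o_def)
  qed
  moreover have "AE \<omega> in M. Some (dominant_path \<sigma> P (\<lambda>s. B s \<omega>) 0) = Some 0 \<and>
     (\<forall>t\<ge>0. Some (dominant_path \<sigma> P (\<lambda>s. B s \<omega>) t) \<noteq> None \<longrightarrow>
       the (Some (dominant_path \<sigma> P (\<lambda>s. B s \<omega>) t)) =
       integral {0..t} (\<lambda>s. poly_field (dominant \<sigma> P) (the (Some (dominant_path \<sigma> P (\<lambda>s. B s \<omega>) s)))) +
       (\<chi> i. \<sigma> $ i * B t \<omega> $ i))"
    using start AE_space
  proof eventually_elim
    case (elim \<omega>)
    have eq: "dominant_path \<sigma> P (\<lambda>s. B s \<omega>) t =
        integral {0..t} (\<lambda>s. poly_field (dominant \<sigma> P) (dominant_path \<sigma> P (\<lambda>s. B s \<omega>) s)) +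
        (\<chi> i. \<sigma> $ i * B t \<omega> $ i)" if "t \<ge> 0" for t
      using dominant_path_integral_equation[OF np cB[OF elim(2)], of t t] that by (simp add: noise_def)
    have "dominant_path \<sigma> P (\<lambda>s. B s \<omega>) 0 = 0"
      using eq[of 0] elim(1) by (simp add: vec_eq_iff)
    then show ?case using eq by simp
  qed
  ultimately show ?thesis unfolding sde_solution_def by simp
qed

text \<open>
  Stability with equal drifts: the perturbation \<open>\<eta>\<close> is zero, and so is the distance of an arbitrary
  solution from the explicit one. This includes that the arbitrary solution does not explode.
\<close>

lemma dominant_solution_unique:
  fixes B :: "real \<Rightarrow> 'a \<Rightarrow> real ^ 'n::finite"
  assumes BM: "brownian_motion M F B" and np: "noise_propagating \<sigma> P"
    and y: "sde_solution M F B (poly_field (dominant \<sigma> P)) \<sigma> y"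
  shows "AE \<omega> in M. \<forall>t\<ge>0. y t \<omega> = Some (dominant_path \<sigma> P (\<lambda>s. B s \<omega>) t)"
proof -
  interpret brownian_motion M F B by fact
  let ?V = "poly_field (dominant \<sigma> P)"
  have cB: "continuous_on {0..T} (\<lambda>s. B s \<omega>)" if "\<omega> \<in> space M" for \<omega> T
    by (rule continuous_on_subset[OF continuous[OF that]]) auto
  have "AE \<omega> in M. y 0 \<omega> = Some 0 \<and> (\<forall>t\<ge>0. y t \<omega> \<noteq> None \<longrightarrow>
      the (y t \<omega>) = integral {0..t} (\<lambda>s. ?V (the (y s \<omega>))) + noise \<sigma> (\<lambda>s. B s \<omega>) t)"
    using y unfolding sde_solution_def noise_def by blast
  then show ?thesis
    using AE_space
  proof eventually_elim
    case (elim \<omega>)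
    let ?z = "dominant_path \<sigma> P (\<lambda>s. B s \<omega>)"
    show ?case
    proof (intro allI impI)
      fix T :: real assume T: "0 \<le> T"
      have z: "continuous_on {0..T} ?z" by (intro continuous_on_dominant_path cB elim)
      then have "bounded (?z ` {0..T})" by (intro compact_imp_bounded compact_continuous_image) auto
      then obtain K where K: "\<And>t. t \<in> {0..T} \<Longrightarrow> norm (?z t) \<le> K" unfolding bounded_iff by blast
      obtain L where L: "L-lipschitz_on (cball 0 (K + 1)) ?V"
        by (rule lipschitz_poly_field[OF bounded_cball])
      have "continuous_map (top_of_set {0..}) state_topology (\<lambda>t. y t \<omega>)"
        using y elim(2) by (simp add: sde_solution_def)
      then have cy: "continuous_map (top_of_set {0..T}) state_topology (\<lambda>t. y t \<omega>)"
        by (rule continuous_map_from_subtopology_mono) auto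
      have "\<exists>v. y T \<omega> = Some v \<and> norm (v - ?z T) \<le> 0 * T * exp (L * T)"
        by (rule integral_equation_stability[OF T cy z, where V = ?V and W = ?V and K = K
              and u = "noise \<sigma> (\<lambda>s. B s \<omega>)"])
           (use elim(1) T K L in \<open>auto intro: dominant_path_integral_equation[OF np cB[OF elim(2)]] continuous_poly_field\<close>)
      then show "y T \<omega> = Some (?z T)" by auto
    qed
  qed
qed

lemma dominant_solution_nonexplosive:
  fixes B :: "real \<Rightarrow> 'a \<Rightarrow> real ^ 'n::finite"
  assumes "brownian_motion M F B" "noise_propagating \<sigma> P"
    and "sde_solution M F B (poly_field (dominant \<sigma> P)) \<sigma> y"
  shows "nonexplosive M y"
  unfolding nonexplosive_def
  using dominant_solution_unique[OF assms]
proof eventually_elim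
  case (elim \<omega>)
  then have no: "{ereal t | t. 0 \<le> t \<and> y t \<omega> = None} = {}" by auto
  show ?case unfolding explosion_time_def no by (simp add: top_ereal_def)
qed

lemma integral_time_change:
  fixes f :: "real \<Rightarrow> real"
  assumes f: "f integrable_on {0..\<epsilon> * t}" and \<epsilon>: "\<epsilon> > 0"
  shows "integral {0..\<epsilon> * t} f = \<epsilon> * integral {0..t} (\<lambda>s. f (\<epsilon> * s))"
proof -
  have "((\<lambda>s. f (\<epsilon> * s)) has_integral (1 / \<bar>\<epsilon>\<bar>) *\<^sub>R integral {0..\<epsilon> * t} f) ((\<lambda>x. x / \<epsilon>) ` {0..\<epsilon> * t})"
    using f \<epsilon> by (intro has_integral_stretch_real) (auto simp: integrable_integral)
  moreover have "(\<lambda>x. x / \<epsilon>) ` {0..\<epsilon> * t} = {0..t}"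
    using \<epsilon> by (simp add: image_divide_atLeastAtMost)
  ultimately show ?thesis using \<epsilon> by (simp add: integral_unique)
qed

text \<open>
  Time is changed by \<open>s \<mapsto> \<epsilon> s\<close>, and component \<open>j\<close> is divided by \<open>\<epsilon> powr b j\<close>. The noise is divided
  by \<open>sqrt \<epsilon>\<close> in every component: where \<open>\<sigma> $ j > 0\<close> this is the right factor since \<open>b j = 1/2\<close>, and
  elsewhere the noise vanishes.
\<close>

lemma rescaled_integral_equation:
  fixes x :: "real \<Rightarrow> 'a \<Rightarrow> (real ^ 'n::finite) option" and w :: "real \<Rightarrow> real ^ 'n"
  assumes \<epsilon>: "\<epsilon> > 0" and t: "t \<ge> 0" and \<sigma>: "\<forall>i. 0 \<le> \<sigma> $ i"
    and x: "continuous_map (top_of_set {0..}) state_topology (\<lambda>t. x t \<omega>)"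
    and absorb: "\<And>s t. 0 \<le> s \<Longrightarrow> s \<le> t \<Longrightarrow> x s \<omega> = None \<Longrightarrow> x t \<omega> = None"
    and x_eq: "\<And>t. t \<ge> 0 \<Longrightarrow> x t \<omega> \<noteq> None \<Longrightarrow>
      the (x t \<omega>) = integral {0..t} (\<lambda>s. poly_field P (the (x s \<omega>))) + noise \<sigma> w t"
    and alive: "rescale (final_scaling \<sigma> P) x \<epsilon> t \<omega> \<noteq> None"
  shows "the (rescale (final_scaling \<sigma> P) x \<epsilon> t \<omega>) =
    integral {0..t} (\<lambda>s. scaled_field (scale_exp \<sigma> P) P \<epsilon> (the (rescale (final_scaling \<sigma> P) x \<epsilon> s \<omega>))) +
    noise \<sigma> (\<lambda>s. (1 / sqrt \<epsilon>) *\<^sub>R w (\<epsilon> * s)) t"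
proof -
  define b where "b = (\<lambda>j. scale_exp \<sigma> P j)"
  define y where "y s = rescale (final_scaling \<sigma> P) x \<epsilon> s \<omega>" for s
  define X where "X s = the (x s \<omega>)" for s
  have xt: "x (\<epsilon> * t) \<omega> \<noteq> None" using alive by (simp add: rescale_def)
  have xs: "x s \<omega> \<noteq> None" if "s \<in> {0..\<epsilon> * t}" for s
    using absorb[of s "\<epsilon> * t"] that xt by auto
  have "continuous_map (top_of_set {0..\<epsilon> * t}) state_topology (\<lambda>t. x t \<omega>)"
    by (rule continuous_map_from_subtopology_mono[OF x]) auto
  then have cX: "continuous_on {0..\<epsilon> * t} X"
    unfolding X_def by (rule continuous_on_the_state) (rule xs)
  have cV: "continuous_on {0..\<epsilon> * t} (\<lambda>s. poly_field P (X s))"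
    by (rule continuous_on_compose2[OF continuous_poly_field[of UNIV] cX]) simp
  have y_X: "the (y s) = (\<chi> j. X (\<epsilon> * s) $ j / \<epsilon> powr b j)" if "s \<in> {0..t}" for s
  proof -
    have "x (\<epsilon> * s) \<omega> \<noteq> None" using that \<epsilon> by (intro xs) auto
    then show ?thesis by (auto simp: y_def rescale_def X_def b_def)
  qed
  have field: "scaled_field b P \<epsilon> (the (y s)) $ j = \<epsilon> powr (1 - b j) * poly_field P (X (\<epsilon> * s)) $ j"
    if "s \<in> {0..t}" for s j
  proof -
    have "(\<chi> i. \<epsilon> powr b i * the (y s) $ i) = X (\<epsilon> * s)"
      using \<epsilon> by (simp add: y_X[OF that] vec_eq_iff)
    then show ?thesis by (simp add: scaled_field_def)
  qed
  have cVe: "continuous_on {0..t} (\<lambda>s. poly_field P (X (\<epsilon> * s)))"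
    by (rule continuous_on_compose2[OF cV]) (use \<epsilon> in \<open>auto intro!: continuous_intros\<close>)
  have cS: "(\<lambda>s. scaled_field b P \<epsilon> (the (y s))) integrable_on {0..t}"
  proof (rule integrable_continuous_interval)
    have "continuous_on {0..t} (\<lambda>s. \<chi> j. \<epsilon> powr (1 - b j) * poly_field P (X (\<epsilon> * s)) $ j)"
      using cVe by (intro continuous_intros)
    then show "continuous_on {0..t} (\<lambda>s. scaled_field b P \<epsilon> (the (y s)))"
      by (rule continuous_on_eq) (simp add: vec_eq_iff field)
  qed
  have comp: "the (y t) $ j = integral {0..t} (\<lambda>s. scaled_field b P \<epsilon> (the (y s))) $ j +
      noise \<sigma> (\<lambda>s. (1 / sqrt \<epsilon>) *\<^sub>R w (\<epsilon> * s)) t $ j" for j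
  proof -
    have int: "(\<lambda>s. poly_field P (X s)) integrable_on {0..\<epsilon> * t}"
      using cV by (rule integrable_continuous_interval)
    have intj: "(\<lambda>s. poly_field P (X s) $ j) integrable_on {0..\<epsilon> * t}"
      by (intro integrable_continuous_interval continuous_intros cV)
    have noise_j: "\<sigma> $ j * w (\<epsilon> * t) $ j / \<epsilon> powr b j = \<sigma> $ j * ((1 / sqrt \<epsilon>) * w (\<epsilon> * t) $ j)"
    proof (cases "\<sigma> $ j = 0")
      case False
      then have "b j = 1 / 2" unfolding b_def using \<sigma> by (intro scale_exp_noisy) (simp add: less_le)
      then have "\<epsilon> powr b j = sqrt \<epsilon>" using \<epsilon> by (simp only: powr_half_sqrt less_imp_le)
      then show ?thesis by simp
    qed simp
    have "X (\<epsilon> * t) = integral {0..\<epsilon> * t} (\<lambda>s. poly_field P (X s)) + noise \<sigma> w (\<epsilon> * t)"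
      unfolding X_def using x_eq[of "\<epsilon> * t"] xt \<epsilon> t by simp
    then have "X (\<epsilon> * t) $ j = integral {0..\<epsilon> * t} (\<lambda>s. poly_field P (X s) $ j) + \<sigma> $ j * w (\<epsilon> * t) $ j"
      using int by (simp add: noise_def)
    also have "integral {0..\<epsilon> * t} (\<lambda>s. poly_field P (X s) $ j) =
        \<epsilon> * integral {0..t} (\<lambda>s. poly_field P (X (\<epsilon> * s)) $ j)"
      by (rule integral_time_change[OF intj \<epsilon>])
    finally have "the (y t) $ j = \<epsilon> powr (1 - b j) * integral {0..t} (\<lambda>s. poly_field P (X (\<epsilon> * s)) $ j) +
        \<sigma> $ j * ((1 / sqrt \<epsilon>) * w (\<epsilon> * t) $ j)"
      using t \<epsilon> noise_j by (simp add: y_X add_divide_distrib powr_diff)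
    also have "\<epsilon> powr (1 - b j) * integral {0..t} (\<lambda>s. poly_field P (X (\<epsilon> * s)) $ j) =
        integral {0..t} (\<lambda>s. \<epsilon> powr (1 - b j) * poly_field P (X (\<epsilon> * s)) $ j)"
      by simp
    also have "\<dots> = integral {0..t} (\<lambda>s. scaled_field b P \<epsilon> (the (y s)) $ j)"
      by (rule integral_cong) (simp add: field)
    also have "\<dots> = integral {0..t} (\<lambda>s. scaled_field b P \<epsilon> (the (y s))) $ j"
      using cS by simp
    finally show ?thesis by (simp add: noise_def)
  qed
  show ?thesis
    using comp unfolding vec_eq_iff y_def b_def by simp
qed

lemma continuous_scaled_field: "continuous_on S (scaled_field b P \<epsilon>)"
proof -
  have "continuous_on S (\<lambda>v. poly_field P (\<chi> i. \<epsilon> powr b i * v $ i))"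
    by (rule continuous_on_compose2[OF continuous_poly_field[of UNIV]]) (auto intro!: continuous_intros)
  then show ?thesis unfolding scaled_field_def by (intro continuous_intros)
qed

text \<open>
  The threshold for \<open>\<epsilon>\<close> depends on \<open>\<delta>\<close> and \<open>K\<close> but not on the driving path \<open>w\<close>. This uniformity matters
  because the driving path changes with \<open>\<epsilon>\<close> in the application.
\<close>

lemma (in compatible_metric) rescaled_path_close:
  fixes P :: "'n \<Rightarrow> 'n rpoly"
  assumes np: "noise_propagating \<sigma> P" and \<delta>: "\<delta> > 0"
  shows "\<forall>\<^sub>F \<epsilon> in at_right 0. \<forall>y w. continuous_map (top_of_set {0..1}) state_topology y \<and>
     continuous_on {0..1} w \<and> y 0 \<noteq> None \<and>
     (\<forall>t\<in>{0..1}. y t \<noteq> None \<longrightarrow>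
       the (y t) = integral {0..t} (\<lambda>s. scaled_field (scale_exp \<sigma> P) P \<epsilon> (the (y s))) + noise \<sigma> w t) \<and>
     (\<forall>t\<in>{0..1}. norm (dominant_path \<sigma> P w t) \<le> K) \<longrightarrow>
     (\<forall>t\<in>{0..1}. mdist m (y t) (Some (dominant_path \<sigma> P w t)) \<le> \<delta>)"
proof -
  let ?V = "poly_field (dominant \<sigma> P)"
  obtain L where L: "L-lipschitz_on (cball 0 (K + 1)) ?V"
    by (rule lipschitz_poly_field[OF bounded_cball])
  obtain d where d: "d > 0"
    "\<And>v u. v \<in> cball 0 (K + 1) \<Longrightarrow> u \<in> cball 0 (K + 1) \<Longrightarrow> dist v u < d \<Longrightarrow> mdist m (Some v) (Some u) < \<delta>"
    using Some_uniformly_continuous[OF compact_cball \<delta>, of "0 :: real ^ 'n" "K + 1"] by metis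
  \<comment> \<open>The factor \<open>exp L\<close> cancels the Gronwall constant; the minimum keeps the solution in the ball of
      radius \<open>K + 1\<close> on which the drifts are compared and \<open>Some\<close> is uniformly continuous.\<close>
  define \<eta> where "\<eta> = min d 1 / (2 * exp L)"
  have \<eta>: "\<eta> > 0" using d by (simp add: \<eta>_def)
  have \<eta>L: "\<eta> * 1 * exp (L * 1) = min d 1 / 2" by (simp add: \<eta>_def)
  from scaled_field_tendsto_dominant[OF np \<eta>, of "K + 1"] show ?thesis
  proof eventually_elim
    case (elim \<epsilon>)
    show ?case
    proof (intro allI impI ballI, elim conjE)
      fix y w and t :: real
      assume y: "continuous_map (top_of_set {0..1}) state_topology y" and w: "continuous_on {0..1} w"
        and y0: "y 0 \<noteq> None" and K: "\<forall>t\<in>{0..1}. norm (dominant_path \<sigma> P w t) \<le> K"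
        and y_eq: "\<forall>t\<in>{0..1}. y t \<noteq> None \<longrightarrow>
         the (y t) = integral {0..t} (\<lambda>s. scaled_field (scale_exp \<sigma> P) P \<epsilon> (the (y s))) + noise \<sigma> w t"
        and t: "t \<in> {0..1}"
      have "\<exists>v. y t = Some v \<and> norm (v - dominant_path \<sigma> P w t) \<le> \<eta> * 1 * exp (L * 1)"
      proof (rule integral_equation_stability[where V = "scaled_field (scale_exp \<sigma> P) P \<epsilon>" and W = ?V
            and K = K and u = "noise \<sigma> w"])
        show "\<eta> * 1 * exp (L * 1) < 1" unfolding \<eta>L by simp
        show "continuous_on {0..1} (dominant_path \<sigma> P w)" using w by (rule continuous_on_dominant_path)
        show "s \<in> {0..1} \<Longrightarrow> dominant_path \<sigma> P w s =
            integral {0..s} (\<lambda>s. ?V (dominant_path \<sigma> P w s)) + noise \<sigma> w s" for s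
          by (rule dominant_path_integral_equation[OF np w])
      qed (use y y0 y_eq K L t elim in \<open>auto intro: continuous_scaled_field\<close>)
      then obtain v where v: "y t = Some v" "norm (v - dominant_path \<sigma> P w t) \<le> min d 1 / 2"
        unfolding \<eta>L by blast
      have z: "norm (dominant_path \<sigma> P w t) \<le> K" using K t by blast
      have "norm v \<le> norm (v - dominant_path \<sigma> P w t) + norm (dominant_path \<sigma> P w t)"
        using norm_triangle_ineq[of "v - dominant_path \<sigma> P w t" "dominant_path \<sigma> P w t"] by simp
      then have "v \<in> cball 0 (K + 1)" using v(2) z by simp
      moreover have "dominant_path \<sigma> P w t \<in> cball 0 (K + 1)" using z by simp
      moreover have "dist v (dominant_path \<sigma> P w t) < d" using v(2) d(1) by (simp add: dist_norm)
      ultimately show "mdist m (y t) (Some (dominant_path \<sigma> P w t)) \<le> \<delta>"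
        unfolding v(1) by (intro less_imp_le d(2))
    qed
  qed
qed

section \<open>The limit theorem\<close>

text \<open>
  The solution functional with values in the path space.
\<close>

definition dominant_state_path ::
  "real ^ 'n \<Rightarrow> ('n::finite \<Rightarrow> 'n rpoly) \<Rightarrow> (real \<Rightarrow> real ^ 'n) \<Rightarrow> real \<Rightarrow> (real ^ 'n) option" where
  "dominant_state_path \<sigma> P w = (\<lambda>t\<in>{0..1}. Some (dominant_path \<sigma> P w t))"

context compatible_metric
begin

lemma path01_in_path_space:
  assumes x: "continuous_map (top_of_set {0..}) state_topology (\<lambda>t. x t \<omega>)"
    and "\<And>s t. 0 \<le> s \<Longrightarrow> s \<le> t \<Longrightarrow> x s \<omega> = None \<Longrightarrow> x t \<omega> = None"
  shows "path01 x \<omega> \<in> mspace (path_space m)"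
proof -
  have "continuous_map (top_of_set {0..1}) state_topology (\<lambda>t. x t \<omega>)"
    by (rule continuous_map_from_subtopology_mono[OF x]) auto
  then have "continuous_map (top_of_set {0..1}) state_topology (path01 x \<omega>)"
    by (rule continuous_map_eq) (simp add: path01_def)
  then show ?thesis using assms(2) by (auto simp: mem_path_space path01_def)
qed

lemma measurable_path01:
  assumes "\<And>t. t \<ge> 0 \<Longrightarrow> x t \<in> N \<rightarrow>\<^sub>M state_borel"
    and "\<And>\<omega>. \<omega> \<in> space N \<Longrightarrow> path01 x \<omega> \<in> mspace (path_space m)"
  shows "path01 x \<in> N \<rightarrow>\<^sub>M path_borel"
proof (rule measurable_path)
  show "path01 x \<in> N \<rightarrow>\<^sub>M cylinders"
    unfolding path01_def[abs_def] using assms(1) by (intro measurable_restrict) auto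
qed (use assms(2) in auto)

lemma dominant_state_path_in_path_space:
  assumes "continuous_on {0..1} w"
  shows "dominant_state_path \<sigma> P w \<in> mspace (path_space m)"
proof -
  have "continuous_map (top_of_set {0..1}) euclidean (dominant_path \<sigma> P w)"
    using continuous_on_dominant_path[OF assms] by simp
  from continuous_map_compose[OF this continuous_map_Some]
  have "continuous_map (top_of_set {0..1}) state_topology (dominant_state_path \<sigma> P w)"
    by (rule continuous_map_eq) (simp add: dominant_state_path_def)
  then show ?thesis by (auto simp: mem_path_space dominant_state_path_def)
qed

lemma
  fixes B :: "real \<Rightarrow> 'a \<Rightarrow> real ^ 'n"
  assumes BM: "brownian_motion M F B"
  shows measurable_dominant_state_path:
      "(\<lambda>\<omega>. dominant_state_path \<sigma> P (\<lambda>s. B s \<omega>)) \<in> M \<rightarrow>\<^sub>M path_borel"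
    and dominant_state_path_law: "\<And>G (C :: real \<Rightarrow> 'a \<Rightarrow> real ^ 'n). brownian_motion M G C \<Longrightarrow>
      distr M path_borel (\<lambda>\<omega>. dominant_state_path \<sigma> P (\<lambda>s. B s \<omega>)) =
      distr M path_borel (\<lambda>\<omega>. dominant_state_path \<sigma> P (\<lambda>s. C s \<omega>))"
proof -
  let ?R = "\<lambda>B \<omega>. \<lambda>r\<in>{0..1::real}. B r \<omega> :: real ^ 'n"
  \<comment> \<open>On the product space the functional is applied to arbitrary functions, but only its values at
      continuous ones matter. It sees the driving path on \<open>{0..1}\<close> only.\<close>
  have map: "dominant_state_path \<sigma> P \<in> PiM {0..1} (\<lambda>_. borel) \<rightarrow>\<^sub>M cylinders"
    unfolding dominant_state_path_def[abs_def]
    by (intro measurable_restrict measurable_compose[OF measurable_dominant_path measurable_Some_state]) auto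
  have restr: "dominant_state_path \<sigma> P (\<lambda>s. B s \<omega>) = dominant_state_path \<sigma> P (?R B \<omega>)"
    for B :: "real \<Rightarrow> 'a \<Rightarrow> real ^ 'n" and \<omega>
    unfolding dominant_state_path_def by (rule restrict_ext) (auto intro: dominant_path_cong)
  have meas: "?R B \<in> M \<rightarrow>\<^sub>M PiM {0..1} (\<lambda>_. borel)"
      "(\<lambda>\<omega>. dominant_state_path \<sigma> P (\<lambda>s. B s \<omega>)) \<in> M \<rightarrow>\<^sub>M cylinders"
      "(\<lambda>\<omega>. dominant_state_path \<sigma> P (\<lambda>s. B s \<omega>)) \<in> space M \<rightarrow> mspace (path_space m)"
    if "brownian_motion M F B" for F and B :: "real \<Rightarrow> 'a \<Rightarrow> real ^ 'n"
  proof -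
    interpret brownian_motion M F B by fact
    show R: "?R B \<in> M \<rightarrow>\<^sub>M PiM {0..1} (\<lambda>_. borel)"
      by (intro measurable_restrict random_variable_B) simp
    show "(\<lambda>\<omega>. dominant_state_path \<sigma> P (\<lambda>s. B s \<omega>)) \<in> M \<rightarrow>\<^sub>M cylinders"
      unfolding restr by (rule measurable_compose[OF R map])
    show "(\<lambda>\<omega>. dominant_state_path \<sigma> P (\<lambda>s. B s \<omega>)) \<in> space M \<rightarrow> mspace (path_space m)"
      by (intro funcsetI dominant_state_path_in_path_space continuous_on_subset[OF continuous]) auto
  qed
  show "(\<lambda>\<omega>. dominant_state_path \<sigma> P (\<lambda>s. B s \<omega>)) \<in> M \<rightarrow>\<^sub>M path_borel"
    by (rule measurable_path[OF meas(2,3)[OF BM]])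
  fix G and C :: "real \<Rightarrow> 'a \<Rightarrow> real ^ 'n" assume BM': "brownian_motion M G C"
  have dist: "distr M cylinders (\<lambda>\<omega>. dominant_state_path \<sigma> P (\<lambda>s. B s \<omega>)) =
      distr (distr M (PiM {0..1} (\<lambda>_. borel)) (?R B)) cylinders (dominant_state_path \<sigma> P)"
    if "brownian_motion M F B" for F and B :: "real \<Rightarrow> 'a \<Rightarrow> real ^ 'n"
    unfolding restr by (subst distr_distr[OF map meas(1)[OF that]]) (simp add: o_def)
  show "distr M path_borel (\<lambda>\<omega>. dominant_state_path \<sigma> P (\<lambda>s. B s \<omega>)) =
      distr M path_borel (\<lambda>\<omega>. dominant_state_path \<sigma> P (\<lambda>s. C s \<omega>))"
  proof (rule path_distr_eq[OF meas(2,3)[OF BM] meas(2,3)[OF BM']])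
    have "distr M (PiM {0..1} (\<lambda>_. borel)) (?R B) = distr M (PiM {0..1} (\<lambda>_. borel)) (?R C)"
      by (rule brownian_law_unique[OF BM BM']) auto
    then show "distr M cylinders (\<lambda>\<omega>. dominant_state_path \<sigma> P (\<lambda>s. B s \<omega>)) =
        distr M cylinders (\<lambda>\<omega>. dominant_state_path \<sigma> P (\<lambda>s. C s \<omega>))"
      by (simp only: dist[OF BM] dist[OF BM'])
  qed
qed

end

text \<open>
  A linear homeomorphism of \<open>\<real>\<^sup>n\<close> maps compact sets to compact sets, so it extends continuously to
  the point at infinity.
\<close>

lemma continuous_map_rescale_state:
  fixes c :: "'n::finite \<Rightarrow> real"
  assumes c: "\<And>j. c j > 0"
  shows "continuous_map state_topology state_topology (map_option (\<lambda>v. \<chi> j. v $ j / c j))"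
proof -
  define g where "g v = (\<chi> j. v $ j / c j)" for v :: "real ^ 'n"
  define h where "h v = (\<chi> j. v $ j * c j)" for v :: "real ^ 'n"
  have gh: "g (h v) = v" "h (g v) = v" for v
    using c by (simp_all add: g_def h_def vec_eq_iff less_imp_neq[symmetric])
  have g: "continuous_on UNIV g" and h: "continuous_on UNIV h"
    unfolding g_def h_def using c
    by (auto intro!: continuous_intros simp: less_imp_neq[symmetric])
  have pre: "{z \<in> topspace state_topology. map_option g z \<in> U} = {z. map_option g z \<in> U}" for U
    by (simp add: UNIV_option_conv[symmetric])
  have "continuous_map state_topology state_topology (map_option g)"
    unfolding continuous_map_def
  proof (intro conjI allI impI)
    fix U :: "(real ^ 'n) option set" assume "openin state_topology U"
    then consider (finite_part) V where "open V" "U = Some ` V" |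
        (neighbourhood) C where "compact C" "U = insert None (Some ` (UNIV - C))"
      by (auto simp: openin_Alexandroff_compactification)
    then show "openin state_topology {z \<in> topspace state_topology. map_option g z \<in> U}"
      unfolding pre
    proof cases
      case finite_part
      have "z \<in> {z. map_option g z \<in> U} \<longleftrightarrow> z \<in> Some ` (g -` V)" for z
        unfolding finite_part by (cases z) auto
      then have "{z. map_option g z \<in> U} = Some ` (g -` V)" by blast
      moreover have "open (g -` V)" using g finite_part by (simp add: open_vimage)
      ultimately show "openin state_topology {z. map_option g z \<in> U}" by simp
    next
      case neighbourhood
      have "g v \<in> C \<longleftrightarrow> v \<in> h ` C" for v
        using gh(1) gh(2)[of v] by (metis imageE imageI)
      then have "z \<in> {z. map_option g z \<in> U} \<longleftrightarrow> z \<in> insert None (Some ` (UNIV - h ` C))" for z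
        unfolding neighbourhood by (cases z) auto
      then have "{z. map_option g z \<in> U} = insert None (Some ` (UNIV - h ` C))" by blast
      moreover have "compact (h ` C)"
        using neighbourhood(1) continuous_on_subset[OF h] by (intro compact_continuous_image) auto
      ultimately show "openin state_topology {z. map_option g z \<in> U}"
        unfolding openin_Alexandroff_compactification
        by (intro disjI2 exI[of _ "h ` C"]) (simp add: compact_imp_closed)
    qed
  qed (simp add: UNIV_option_conv[symmetric])
  then show ?thesis unfolding g_def .
qed

theorem corollary5p4:
  fixes M :: "'a measure"
    and F :: "real \<Rightarrow> 'a measure"
    and B :: "real \<Rightarrow> 'a \<Rightarrow> real ^ 'n::finite"
    and P :: "'n \<Rightarrow> 'n rpoly"
    and \<sigma> :: "real ^ 'n"
    and x :: "real \<Rightarrow> 'a \<Rightarrow> (real ^ 'n) option"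
    and m :: "(real ^ 'n) option metric"
  assumes "brownian_motion M F B"
    and "\<forall>i. 0 \<le> \<sigma> $ i"
    and "sde_solution M F B (poly_field P) \<sigma> x"
    and "mtopology_of m = state_topology"
    and "noise_propagating \<sigma> P"
  shows "(\<exists>y. sde_solution M F B (poly_field (dominant \<sigma> P)) \<sigma> y) \<and>
    (\<forall>y. sde_solution M F B (poly_field (dominant \<sigma> P)) \<sigma> y \<longrightarrow>
       converges_in_law M (mtopology_of (path_space m))
         (\<lambda>\<epsilon>. path01 (rescale (final_scaling \<sigma> P) x \<epsilon>)) (at_right 0) (path01 y) \<and>
       nonexplosive M y)"
proof (intro conjI allI impI)
  note BM = assms(1) and np = assms(5)
  interpret brownian_motion M F B by fact
  interpret compatible_metric m by unfold_locales fact
  show "\<exists>y. sde_solution M F B (poly_field (dominant \<sigma> P)) \<sigma> y"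
    using sde_solution_dominant_path[OF BM np] by blast
  fix y assume y: "sde_solution M F B (poly_field (dominant \<sigma> P)) \<sigma> y"
  show "nonexplosive M y" by (rule dominant_solution_nonexplosive[OF BM np y])
  \<comment> \<open>For each \<open>\<epsilon>\<close> the limit equation is solved with the Brownian motion that drives the rescaled
      process; its solution \<open>Z \<epsilon>\<close> has the law of \<open>y\<close> and is close to the rescaled process.\<close>
  define W where "W \<epsilon> t \<omega> = (1 / sqrt \<epsilon>) *\<^sub>R B (\<epsilon> * t) \<omega>" for \<epsilon> t \<omega>
  have W: "brownian_motion M (\<lambda>t. F (\<epsilon> * t)) (W \<epsilon>)" if "\<epsilon> > 0" for \<epsilon>
    unfolding W_def[abs_def] by (rule brownian_scaling[OF that])
  define Z where "Z \<epsilon> \<omega> = dominant_state_path \<sigma> P (\<lambda>s. W \<epsilon> s \<omega>)" for \<epsilon> \<omega>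
  let ?X = "\<lambda>\<epsilon>. path01 (rescale (final_scaling \<sigma> P) x \<epsilon>)"
  have meas: "z t \<in> M \<rightarrow>\<^sub>M state_borel" if "sde_solution M F B V \<sigma> z" "t \<ge> 0" for z V t
    using that measurable_from_subalg[OF subalgebra] unfolding sde_solution_def by blast
  have paths: "continuous_map (top_of_set {0..}) state_topology (\<lambda>t. z t \<omega>)"
      "\<And>s t. 0 \<le> s \<Longrightarrow> s \<le> t \<Longrightarrow> z s \<omega> = None \<Longrightarrow> z t \<omega> = None"
    if "sde_solution M F B V \<sigma> z" "\<omega> \<in> space M" for z V \<omega>
    using that unfolding sde_solution_def by blast+
  have Ym: "path01 y \<in> M \<rightarrow>\<^sub>M path_borel"
  proof (rule measurable_path01)
    show "path01 y \<omega> \<in> mspace (path_space m)" if \<omega>: "\<omega> \<in> space M" for \<omega>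
      by (rule path01_in_path_space[where x = y and \<omega> = \<omega>, OF paths(1)[OF y \<omega>]])
         (rule paths(2)[OF y \<omega>])
  qed (rule meas[OF y])
  have y_unique: "AE \<omega> in M. \<forall>t\<ge>0. y t \<omega> = Some (dominant_path \<sigma> P (\<lambda>s. B s \<omega>) t)"
    by (rule dominant_solution_unique[OF BM np y])
  have state_map: "continuous_map state_topology state_topology
      (map_option (\<lambda>v. \<chi> j. v $ j / \<epsilon> powr scale_exp \<sigma> P j))" if "\<epsilon> > 0" for \<epsilon>
    using that by (intro continuous_map_rescale_state) simp
  have rescaled_paths:
      "continuous_map (top_of_set {0..}) state_topology (\<lambda>t. rescale (final_scaling \<sigma> P) x \<epsilon> t \<omega>)"
      "\<And>s t. 0 \<le> s \<Longrightarrow> s \<le> t \<Longrightarrow> rescale (final_scaling \<sigma> P) x \<epsilon> s \<omega> = None \<Longrightarrow>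
        rescale (final_scaling \<sigma> P) x \<epsilon> t \<omega> = None"
    if e: "\<epsilon> > 0" and \<omega>: "\<omega> \<in> space M" for \<epsilon> \<omega>
  proof -
    have "continuous_map (top_of_set {0..}) (top_of_set {0..}) (\<lambda>t. \<epsilon> * t)"
      using e by (auto simp: continuous_map_in_subtopology intro!: continuous_intros)
    from continuous_map_compose[OF this paths(1)[OF assms(3) \<omega>]]
    have "continuous_map (top_of_set {0..}) state_topology (\<lambda>t. x (\<epsilon> * t) \<omega>)" by (simp add: o_def)
    from continuous_map_compose[OF this state_map[OF e]]
    show "continuous_map (top_of_set {0..}) state_topology (\<lambda>t. rescale (final_scaling \<sigma> P) x \<epsilon> t \<omega>)"
      by (simp add: o_def rescale_def)
    fix s t :: real assume "0 \<le> s" "s \<le> t" "rescale (final_scaling \<sigma> P) x \<epsilon> s \<omega> = None"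
    then show "rescale (final_scaling \<sigma> P) x \<epsilon> t \<omega> = None"
      using paths(2)[OF assms(3) \<omega>, of "\<epsilon> * s" "\<epsilon> * t"] e by (simp add: rescale_def)
  qed
  show "converges_in_law M (mtopology_of (path_space m)) ?X (at_right 0) (path01 y)"
  proof (rule convergence_in_law_by_coupling[where Z = Z])
    show "prob_space M" by unfold_locales
    show "path01 y \<in> M \<rightarrow>\<^sub>M path_borel" by (rule Ym)
    have pos: "\<forall>\<^sub>F \<epsilon>::real in at_right 0. \<epsilon> > 0" by (rule eventually_at_right_less)
    show "\<forall>\<^sub>F \<epsilon> in at_right 0. ?X \<epsilon> \<in> M \<rightarrow>\<^sub>M path_borel"
      using pos
    proof eventually_elim
      case (elim \<epsilon>)
      show ?case
      proof (rule measurable_path01)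
        show "?X \<epsilon> \<omega> \<in> mspace (path_space m)" if \<omega>: "\<omega> \<in> space M" for \<omega>
          by (rule path01_in_path_space[where x = "rescale (final_scaling \<sigma> P) x \<epsilon>"
                and \<omega> = \<omega>, OF rescaled_paths(1)[OF elim \<omega>]]) (rule rescaled_paths(2)[OF elim \<omega>])
        fix t :: real assume "t \<ge> 0"
        then have "x (\<epsilon> * t) \<in> M \<rightarrow>\<^sub>M state_borel" using elim by (intro meas[OF assms(3)]) simp
        from measurable_compose[OF this continuous_map_borel_of[OF state_map[OF elim]]]
        show "rescale (final_scaling \<sigma> P) x \<epsilon> t \<in> M \<rightarrow>\<^sub>M state_borel"
          by (simp add: rescale_def[abs_def])
      qed
    qed
    show "\<forall>\<^sub>F \<epsilon> in at_right 0. Z \<epsilon> \<in> M \<rightarrow>\<^sub>M path_borel"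
      using pos unfolding Z_def[abs_def]
      by eventually_elim (rule measurable_dominant_state_path[OF W])
    show "\<forall>\<^sub>F \<epsilon> in at_right 0. distr M path_borel (Z \<epsilon>) = distr M path_borel (path01 y)"
      using pos
    proof eventually_elim
      case (elim \<epsilon>)
      have "distr M path_borel (Z \<epsilon>) = distr M path_borel (\<lambda>\<omega>. dominant_state_path \<sigma> P (\<lambda>s. B s \<omega>))"
        unfolding Z_def[abs_def] by (rule dominant_state_path_law[OF W[OF elim] BM])
      also have "\<dots> = distr M path_borel (path01 y)"
      proof (rule distr_cong_AE[OF refl refl])
        show "AE \<omega> in M. dominant_state_path \<sigma> P (\<lambda>s. B s \<omega>) = path01 y \<omega>"
          using y_unique
          by eventually_elim (auto simp: dominant_state_path_def path01_def intro!: restrict_ext)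
      qed (rule measurable_dominant_state_path[OF BM], rule Ym)
      finally show ?case .
    qed
    show "AE \<omega> in M. \<forall>t\<in>{0..1}. path01 y \<omega> t \<noteq> None"
      using y_unique by eventually_elim (simp add: path01_def)
    fix K \<delta> :: real assume \<delta>: "\<delta> > 0"
    have x_AE: "AE \<omega> in M. x 0 \<omega> = Some 0 \<and> (\<forall>t\<ge>0. x t \<omega> \<noteq> None \<longrightarrow>
        the (x t \<omega>) = integral {0..t} (\<lambda>s. poly_field P (the (x s \<omega>))) + noise \<sigma> (\<lambda>s. B s \<omega>) t)"
      using assms(3) unfolding sde_solution_def noise_def by blast
    show "\<forall>\<^sub>F \<epsilon> in at_right 0. AE \<omega> in M. Z \<epsilon> \<omega> \<in> bounded_paths K \<longrightarrow>
        (\<forall>t\<in>{0..1}. mdist m (?X \<epsilon> \<omega> t) (Z \<epsilon> \<omega> t) \<le> \<delta>)"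
      using pos rescaled_path_close[OF np \<delta>, of K]
    proof eventually_elim
      case (elim \<epsilon>)
      note e = elim(1) and close = elim(2)
      show ?case
        using x_AE AE_space
      proof eventually_elim
        case (elim \<omega>)
        let ?y = "\<lambda>t. rescale (final_scaling \<sigma> P) x \<epsilon> t \<omega>" and ?w = "\<lambda>s. W \<epsilon> s \<omega>"
        have "continuous_map (top_of_set {0..1}) state_topology ?y"
          by (rule continuous_map_from_subtopology_mono[OF rescaled_paths(1)[OF e elim(2)]]) auto
        moreover have "continuous_on {0..1} ?w"
          by (rule continuous_on_subset[OF brownian_motion.continuous[OF W[OF e] elim(2)]]) auto
        moreover have "?y 0 \<noteq> None" using elim(1) by (simp add: rescale_def)
        moreover have "the (?y t) =
            integral {0..t} (\<lambda>s. scaled_field (scale_exp \<sigma> P) P \<epsilon> (the (?y s))) + noise \<sigma> ?w t"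
          if "t \<in> {0..1}" "?y t \<noteq> None" for t
          unfolding W_def
        proof (rule rescaled_integral_equation[where x = x and \<omega> = \<omega>,
              OF e _ assms(2) paths(1)[OF assms(3) elim(2)]])
          show "x t \<omega> = None" if "0 \<le> s" "s \<le> t" "x s \<omega> = None" for s t
            by (rule paths(2)[OF assms(3) elim(2) that])
        qed (use that elim(1) in auto)
        moreover have "norm (dominant_path \<sigma> P ?w t) \<le> K"
          if "Z \<epsilon> \<omega> \<in> bounded_paths K" "t \<in> {0..1}" for t
          using that by (auto simp: bounded_paths_def Z_def dominant_state_path_def)
        ultimately have "Z \<epsilon> \<omega> \<in> bounded_paths K \<Longrightarrow>
            \<forall>t\<in>{0..1}. mdist m (?y t) (Some (dominant_path \<sigma> P ?w t)) \<le> \<delta>"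
          using close by blast
        then show ?case by (simp add: path01_def Z_def dominant_state_path_def)
      qed
    qed
  qed
qed

end
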